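(* Let $f:R\to T$ be a faithfully flat ring homomorphism, $\mathfrak{a}$ a proper ideal of $R$, and $M$ a finitely generated $R$-module. (i) $M$ is $\mathfrak{a}$-relative Cohen-Macaulay if and only if $T\otimes_R M$ is $\mathfrak{a}T$-relative Cohen-Macaulay. (ii) $M$ is $\mathfrak{a}$-relative maximal Cohen-Macaulay if and only if $T\otimes_R M$ is $\mathfrak{a}T$-relative maximal Cohen-Macaulay. (iii) $M$ is $\mathfrak{a}$-relative Gorenstein if and only if $T\otimes_R M$ is $\mathfrak{a}T$-relative Gorenstein.
   Context: All rings are commutative Noetherian with identity (not necessarily local). $\mathfrak{a}T$ denotes the extension of $\mathfrak{a}$ to $T$ along $f$. For an ideal $\mathfrak{a}$ of a ring $R$ and an $R$-module $N$, $H^i_{\mathfrak{a}}(N)=\varinjlim_{n}\operatorname{Ext}^i_R(R/\mathfrak{a}^n,N)$ is the $i$-th local cohomology module, and $\operatorname{cd}(\mathfrak{a},N)$ is the largest integer $i$ with $H^i_{\mathfrak{a}}(N)\neq 0$ ($-\infty$ if there is none). For $M$ finitely generated, $\operatorname{grade}(\mathfrak{a},M)=\inf\{i: \operatorname{Ext}^i_R(R/\mathfrak{a},M)\ne 0\}=\inf\{i : H^i_{\mathfrak{a}}(M)\neq 0\}$; it is $\infty$ if $M=\mathfrak{a}M$, and otherwise is the common length of the maximal $M$-regular sequences in $\mathfrak{a}$. Definitions, for a proper ideal $\mathfrak{a}$ of a ring $R$ and a finitely generated $R$-module $M$ (to be applied also to $T$, $\mathfrak{a}T$ and the $T$-module $T\otimes_R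 M$): $M$ is $\mathfrak{a}$-relative Cohen-Macaulay if either $M=\mathfrak{a}M$, or $M\neq\mathfrak{a}M$ and $\operatorname{grade}(\mathfrak{a},M)=\operatorname{cd}(\mathfrak{a},M)$. $M$ is $\mathfrak{a}$-relative maximal Cohen-Macaulay if $\operatorname{grade}(\mathfrak{a},M)=\operatorname{cd}(\mathfrak{a},R)$. $M$ is $\mathfrak{a}$-relative Gorenstein if $\operatorname{Ext}^i_R(R/\mathfrak{a},M)=0$ for all $i\neq\operatorname{cd}(\mathfrak{a},R)$. *)

theory Defs
  imports "HOL-Algebra.Algebra" "HOL-Library.Extended_Real"
begin

(* The ring component (mult, one) of a module record carries no information for a module;
   the constructions below leave it undefined. *)

section \<open>Modules over a commutative ring\<close>

definition mod_hom ::
  "('r, 'p) ring_scheme \<Rightarrow> ('r, 'a, 'x) module_scheme \<Rightarrow> ('r, 'b, 'y) module_scheme \<Rightarrow> ('a \<Rightarrow> 'b) set"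
  where "mod_hom R A B =
    {h \<in> carrier A \<rightarrow> carrier B.
       (\<forall>x\<in>carrier A. \<forall>y\<in>carrier A. h (x \<oplus>\<^bsub>A\<^esub> y) = h x \<oplus>\<^bsub>B\<^esub> h y) \<and>
       (\<forall>r\<in>carrier R. \<forall>x\<in>carrier A. h (r \<odot>\<^bsub>A\<^esub> x) = r \<odot>\<^bsub>B\<^esub> h x)}"

definition zero_module :: "('r, 'a, 'x) module_scheme \<Rightarrow> bool"
  where "zero_module A \<longleftrightarrow> carrier A = {\<zero>\<^bsub>A\<^esub>}"

definition exact_at ::
  "('r, 'a, 'x) module_scheme \<Rightarrow> ('a \<Rightarrow> 'b) \<Rightarrow> ('r, 'b, 'y) module_scheme \<Rightarrow> ('b \<Rightarrow> 'c)
    \<Rightarrow> ('r, 'c, 'z) module_scheme \<Rightarrow> bool"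
  where "exact_at A g B h C \<longleftrightarrow> g ` carrier A = {y \<in> carrier B. h y = \<zero>\<^bsub>C\<^esub>}"

definition fin_gen_module :: "('r, 'p) ring_scheme \<Rightarrow> ('r, 'a, 'x) module_scheme \<Rightarrow> bool"
  where "fin_gen_module R A \<longleftrightarrow>
    (\<exists>S. finite S \<and> S \<subseteq> carrier A \<and>
       (\<forall>x\<in>carrier A. \<exists>c\<in>S \<rightarrow> carrier R. x = (\<Oplus>\<^bsub>A\<^esub>s\<in>S. c s \<odot>\<^bsub>A\<^esub> s)))"

definition ring_module :: "('r, 'p) ring_scheme \<Rightarrow> ('r, 'r) module"
  where "ring_module R =
    \<lparr>carrier = carrier R, monoid.mult = monoid.mult R, monoid.one = \<one>\<^bsub>R\<^esub>, ring.zero = \<zero>\<^bsub>R\<^esub>,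
     ring.add = ring.add R, smult = monoid.mult R\<rparr>"

definition quot_module :: "('r, 'a, 'x) module_scheme \<Rightarrow> 'a set \<Rightarrow> ('r, 'a set) module"
  where "quot_module A H =
    \<lparr>carrier = a_rcosets\<^bsub>A\<^esub> H, monoid.mult = undefined, monoid.one = undefined, ring.zero = H, ring.add = set_add A,
     smult = (\<lambda>r U. \<Union>x\<in>U. H +>\<^bsub>A\<^esub> (r \<odot>\<^bsub>A\<^esub> x))\<rparr>"

definition cyclic_module :: "('r, 'p) ring_scheme \<Rightarrow> 'r set \<Rightarrow> ('r, 'r set) module"
  where "cyclic_module R I = quot_module (ring_module R) I"

definition cyclic_proj :: "('r, 'p) ring_scheme \<Rightarrow> 'r set \<Rightarrow> 'r set \<Rightarrow> 'r set"
    \<comment> \<open>the canonical projection from R/I to R/J, for I contained in J\<close>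
  where "cyclic_proj R J U = (\<Union>x\<in>U. J +>\<^bsub>R\<^esub> x)"

definition ideal_smult :: "'r set \<Rightarrow> ('r, 'a, 'x) module_scheme \<Rightarrow> 'a set"
    \<comment> \<open>the submodule IA of A\<close>
  where "ideal_smult I A = generate (add_monoid A) {r \<odot>\<^bsub>A\<^esub> x | r x. r \<in> I \<and> x \<in> carrier A}"

(* The free module of rank b; vectors are padded with zeros, so that the modules of all
   ranks have elements of the same type. *)
definition free_module :: "('r, 'p) ring_scheme \<Rightarrow> nat \<Rightarrow> ('r, nat \<Rightarrow> 'r) module"
  where "free_module R b =
    \<lparr>carrier = {v. (\<forall>j<b. v j \<in> carrier R) \<and> (\<forall>j\<ge>b. v j = \<zero>\<^bsub>R\<^esub>)},
     monoid.mult = undefined, monoid.one = undefined,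
     ring.zero = (\<lambda>j. \<zero>\<^bsub>R\<^esub>), ring.add = (\<lambda>v w j. v j \<oplus>\<^bsub>R\<^esub> w j), smult = (\<lambda>r v j. r \<otimes>\<^bsub>R\<^esub> v j)\<rparr>"

definition hom_module ::
  "('r, 'p) ring_scheme \<Rightarrow> ('r, 'a, 'x) module_scheme \<Rightarrow> ('r, 'b, 'y) module_scheme
    \<Rightarrow> ('r, 'a \<Rightarrow> 'b) module"
  where "hom_module R A N =
    \<lparr>carrier = mod_hom R A N \<inter> extensional (carrier A), monoid.mult = undefined, monoid.one = undefined,
     ring.zero = (\<lambda>x\<in>carrier A. \<zero>\<^bsub>N\<^esub>),
     ring.add = (\<lambda>g h. \<lambda>x\<in>carrier A. g x \<oplus>\<^bsub>N\<^esub> h x),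
     smult = (\<lambda>r h. \<lambda>x\<in>carrier A. r \<odot>\<^bsub>N\<^esub> h x)\<rparr>"

section \<open>Ext\<close>

(* A resolution ... -> P 1 -> P 0 -> A -> 0 by free modules of finite rank. Over a Noetherian
   ring every finitely generated module A has one, and Ext is only used for such A. *)
record ('r, 'a) free_res =
  res_rank :: "nat \<Rightarrow> nat"
  res_diff :: "nat \<Rightarrow> (nat \<Rightarrow> 'r) \<Rightarrow> (nat \<Rightarrow> 'r)"   (* P (i + 1) -> P i *)
  res_aug  :: "(nat \<Rightarrow> 'r) \<Rightarrow> 'a"                    (* P 0 -> A *)

definition res_mod :: "('r, 'p) ring_scheme \<Rightarrow> ('r, 'a) free_res \<Rightarrow> nat \<Rightarrow> ('r, nat \<Rightarrow> 'r) module"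
  where "res_mod R P i = free_module R (res_rank P i)"

definition is_free_resolution ::
  "('r, 'p) ring_scheme \<Rightarrow> ('r, 'a, 'x) module_scheme \<Rightarrow> ('r, 'a) free_res \<Rightarrow> bool"
  where "is_free_resolution R A P \<longleftrightarrow>
    (\<forall>i. res_diff P i \<in> mod_hom R (res_mod R P (Suc i)) (res_mod R P i)) \<and>
    res_aug P \<in> mod_hom R (res_mod R P 0) A \<and>
    (\<forall>i. exact_at (res_mod R P (Suc (Suc i))) (res_diff P (Suc i)) (res_mod R P (Suc i))
           (res_diff P i) (res_mod R P i)) \<and>
    exact_at (res_mod R P (Suc 0)) (res_diff P 0) (res_mod R P 0) (res_aug P) A \<and>
    res_aug P ` carrier (res_mod R P 0) = carrier A"

definition resolution ::
  "('r, 'p) ring_scheme \<Rightarrow> ('r, 'a, 'x) module_scheme \<Rightarrow> ('r, 'a) free_res"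
  where "resolution R A = (SOME P. is_free_resolution R A P)"

definition cocycles ::
  "('r, 'p) ring_scheme \<Rightarrow> ('r, 'a) free_res \<Rightarrow> nat \<Rightarrow> ('r, 'n, 'y) module_scheme
    \<Rightarrow> ((nat \<Rightarrow> 'r) \<Rightarrow> 'n) set"
  where "cocycles R P i N =
    {h \<in> carrier (hom_module R (res_mod R P i) N).
       \<forall>x\<in>carrier (res_mod R P (Suc i)). h (res_diff P i x) = \<zero>\<^bsub>N\<^esub>}"

definition coboundaries ::
  "('r, 'p) ring_scheme \<Rightarrow> ('r, 'a) free_res \<Rightarrow> nat \<Rightarrow> ('r, 'n, 'y) module_scheme
    \<Rightarrow> ((nat \<Rightarrow> 'r) \<Rightarrow> 'n) set"
  where "coboundaries R P i N =
    (case i of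
       0 \<Rightarrow> {\<zero>\<^bsub>hom_module R (res_mod R P 0) N\<^esub>}
     | Suc j \<Rightarrow> (\<lambda>h. \<lambda>x\<in>carrier (res_mod R P (Suc j)). h (res_diff P j x)) `
                 carrier (hom_module R (res_mod R P j) N))"

definition Ext_module ::
  "('r, 'p) ring_scheme \<Rightarrow> ('r, 'a, 'x) module_scheme \<Rightarrow> nat \<Rightarrow> ('r, 'n, 'y) module_scheme
    \<Rightarrow> ('r, ((nat \<Rightarrow> 'r) \<Rightarrow> 'n) set) module"
  where "Ext_module R A i N =
    (let P = resolution R A in
       quot_module ((hom_module R (res_mod R P i) N)\<lparr>carrier := cocycles R P i N\<rparr>)
         (coboundaries R P i N))"

(* phi is a chain map Q -> P over the module homomorphism u : B -> A *)
definition is_lift ::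
  "('r, 'p) ring_scheme \<Rightarrow> ('r, 'b) free_res \<Rightarrow> ('r, 'a) free_res \<Rightarrow> ('b \<Rightarrow> 'a)
    \<Rightarrow> (nat \<Rightarrow> (nat \<Rightarrow> 'r) \<Rightarrow> (nat \<Rightarrow> 'r)) \<Rightarrow> bool"
  where "is_lift R Q P u \<phi> \<longleftrightarrow>
    (\<forall>i. \<phi> i \<in> mod_hom R (res_mod R Q i) (res_mod R P i)) \<and>
    (\<forall>x\<in>carrier (res_mod R Q 0). res_aug P (\<phi> 0 x) = u (res_aug Q x)) \<and>
    (\<forall>i. \<forall>x\<in>carrier (res_mod R Q (Suc i)).
       res_diff P i (\<phi> (Suc i) x) = \<phi> i (res_diff Q i x))"

(* The map Ext^i(A, N) -> Ext^i(B, N) induced by u : B -> A. All lifts of u are homotopic, so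
   the choice of phi does not matter. *)
definition Ext_map ::
  "('r, 'p) ring_scheme \<Rightarrow> ('r, 'b, 'z) module_scheme \<Rightarrow> ('r, 'a, 'x) module_scheme \<Rightarrow> ('b \<Rightarrow> 'a)
    \<Rightarrow> nat \<Rightarrow> ('r, 'n, 'y) module_scheme
    \<Rightarrow> ((nat \<Rightarrow> 'r) \<Rightarrow> 'n) set \<Rightarrow> ((nat \<Rightarrow> 'r) \<Rightarrow> 'n) set"
  where "Ext_map R B A u i N U =
    (let Q = resolution R B; P = resolution R A; \<phi> = (SOME \<phi>. is_lift R Q P u \<phi>) in
       \<Union>h\<in>U. coboundaries R Q i N +>\<^bsub>hom_module R (res_mod R Q i) N\<^esub>
                (\<lambda>x\<in>carrier (res_mod R Q i). h (\<phi> i x)))"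

section \<open>Local cohomology\<close>

(* E n are the modules of a direct system indexed by nat, tau n k : E n -> E k (n \<le> k) its
   transition maps; elements of the limit are equivalence classes of pairs (n, x), x in E n. *)
definition dirlim_rel ::
  "(nat \<Rightarrow> ('r, 'e, 'x) module_scheme) \<Rightarrow> (nat \<Rightarrow> nat \<Rightarrow> 'e \<Rightarrow> 'e) \<Rightarrow> ((nat \<times> 'e) \<times> (nat \<times> 'e)) set"
  where "dirlim_rel E \<tau> =
    {((n, x), (m, y)). x \<in> carrier (E n) \<and> y \<in> carrier (E m) \<and>
       (\<exists>k. n \<le> k \<and> m \<le> k \<and> \<tau> n k x = \<tau> m k y)}"

definition direct_limit ::
  "(nat \<Rightarrow> ('r, 'e, 'x) module_scheme) \<Rightarrow> (nat \<Rightarrow> nat \<Rightarrow> 'e \<Rightarrow> 'e) \<Rightarrow> ('r, (nat \<times> 'e) set) module"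
  where "direct_limit E \<tau> =
    \<lparr>carrier = (SIGMA n:UNIV. carrier (E n)) // dirlim_rel E \<tau>,
     monoid.mult = undefined, monoid.one = undefined,
     ring.zero = dirlim_rel E \<tau> `` {(0, \<zero>\<^bsub>E 0\<^esub>)},
     ring.add = (\<lambda>U V. \<Union>(n, x)\<in>U. \<Union>(m, y)\<in>V.
              dirlim_rel E \<tau> ``
                {(max n m, \<tau> n (max n m) x \<oplus>\<^bsub>E (max n m)\<^esub> \<tau> m (max n m) y)}),
     smult = (\<lambda>r U. \<Union>(n, x)\<in>U. dirlim_rel E \<tau> `` {(n, r \<odot>\<^bsub>E n\<^esub> x)})\<rparr>"

definition ideal_power :: "('r, 'p) ring_scheme \<Rightarrow> 'r set \<Rightarrow> nat \<Rightarrow> 'r set"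
  where "ideal_power R I n = I [^]\<^bsub>ideals_set R\<^esub> n"

definition local_cohomology ::
  "('r, 'p) ring_scheme \<Rightarrow> 'r set \<Rightarrow> nat \<Rightarrow> ('r, 'n, 'y) module_scheme
    \<Rightarrow> ('r, (nat \<times> ((nat \<Rightarrow> 'r) \<Rightarrow> 'n) set) set) module"
  where "local_cohomology R I i N =
    direct_limit
      (\<lambda>n. Ext_module R (cyclic_module R (ideal_power R I n)) i N)
      (\<lambda>n k. Ext_map R (cyclic_module R (ideal_power R I k)) (cyclic_module R (ideal_power R I n))
               (cyclic_proj R (ideal_power R I n)) i N)"

(* -\<infinity> if all local cohomology vanishes. Over a Noetherian ring only finitely many local
   cohomology modules are nonzero, so otherwise the supremum is a maximum. *)
definition cd :: "('r, 'p) ring_scheme \<Rightarrow> 'r set \<Rightarrow> ('r, 'n, 'y) module_scheme \<Rightarrow> ereal"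
  where "cd R I N = Sup {ereal (real i) | i. \<not> zero_module (local_cohomology R I i N)}"

definition grade :: "('r, 'p) ring_scheme \<Rightarrow> 'r set \<Rightarrow> ('r, 'n, 'y) module_scheme \<Rightarrow> ereal"
  where "grade R I N = Inf {ereal (real i) | i. \<not> zero_module (Ext_module R (cyclic_module R I) i N)}"

section \<open>Base change and faithful flatness\<close>

(* The R-bilinearity relations in the free abelian group on T \<times> M, where R acts on T through f *)
definition tensor_relations ::
  "('r, 'p) ring_scheme \<Rightarrow> ('t, 'q) ring_scheme \<Rightarrow> ('r \<Rightarrow> 't) \<Rightarrow> ('r, 'm, 'y) module_scheme
    \<Rightarrow> ('t \<times> 'm \<Rightarrow>\<^sub>0 int) set"
  where "tensor_relations R T f M = generate (free_Abelian_group (carrier T \<times> carrier M))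
    ({frag_of (s \<oplus>\<^bsub>T\<^esub> t, m) - frag_of (s, m) - frag_of (t, m) | s t m.
        s \<in> carrier T \<and> t \<in> carrier T \<and> m \<in> carrier M} \<union>
     {frag_of (t, m \<oplus>\<^bsub>M\<^esub> n) - frag_of (t, m) - frag_of (t, n) | t m n.
        t \<in> carrier T \<and> m \<in> carrier M \<and> n \<in> carrier M} \<union>
     {frag_of (t \<otimes>\<^bsub>T\<^esub> f r, m) - frag_of (t, r \<odot>\<^bsub>M\<^esub> m) | t r m.
        t \<in> carrier T \<and> r \<in> carrier R \<and> m \<in> carrier M})"

(* The tensor product of T and M over R, as a T-module *)
definition base_change ::
  "('r, 'p) ring_scheme \<Rightarrow> ('t, 'q) ring_scheme \<Rightarrow> ('r \<Rightarrow> 't) \<Rightarrow> ('r, 'm, 'y) module_scheme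
    \<Rightarrow> ('t, ('t \<times> 'm \<Rightarrow>\<^sub>0 int) set) module"
  where "base_change R T f M =
    (let G = free_Abelian_group (carrier T \<times> carrier M); H = tensor_relations R T f M in
      \<lparr>carrier = carrier (G Mod H), monoid.mult = undefined, monoid.one = undefined,
       ring.zero = monoid.one (G Mod H), ring.add = monoid.mult (G Mod H),
       smult = (\<lambda>t U. \<Union>c\<in>U. H #>\<^bsub>G\<^esub> frag_extend (\<lambda>(s, m). frag_of (t \<otimes>\<^bsub>T\<^esub> s, m)) c)\<rparr>)"

(* The map id \<otimes> g induced by g : M -> N on the base changes *)
definition base_change_map ::
  "('r, 'p) ring_scheme \<Rightarrow> ('t, 'q) ring_scheme \<Rightarrow> ('r \<Rightarrow> 't) \<Rightarrow> ('r, 'n, 'y) module_scheme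
    \<Rightarrow> ('m \<Rightarrow> 'n) \<Rightarrow> ('t \<times> 'm \<Rightarrow>\<^sub>0 int) set \<Rightarrow> ('t \<times> 'n \<Rightarrow>\<^sub>0 int) set"
  where "base_change_map R T f N g U =
    (\<Union>c\<in>U. tensor_relations R T f N #>\<^bsub>free_Abelian_group (carrier T \<times> carrier N)\<^esub>
               frag_extend (\<lambda>(t, m). frag_of (t, g m)) c)"

(* A sequence of R-modules is exact iff its base change to T is. HOL cannot quantify over
   modules of all types inside a definition. The modules with elements of type
   (nat \<Rightarrow> 'r) set include, up to isomorphism, all finitely generated R-modules (as
   quotients of free_module R b). This is no restriction: flatness can be tested on the inclusions of
   ideals, and faithfulness on cyclic modules. *)
definition faithfully_flat ::
  "('r, 'p) ring_scheme \<Rightarrow> ('t, 'q) ring_scheme \<Rightarrow> ('r \<Rightarrow> 't) \<Rightarrow> bool"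
  where "faithfully_flat R T f \<longleftrightarrow>
    (\<forall>(A :: ('r, (nat \<Rightarrow> 'r) set) module) (B :: ('r, (nat \<Rightarrow> 'r) set) module)
      (C :: ('r, (nat \<Rightarrow> 'r) set) module) g h.
       module R A \<longrightarrow> module R B \<longrightarrow> module R C \<longrightarrow> g \<in> mod_hom R A B \<longrightarrow> h \<in> mod_hom R B C \<longrightarrow>
       (exact_at A g B h C \<longleftrightarrow>
        exact_at (base_change R T f A) (base_change_map R T f B g) (base_change R T f B)
          (base_change_map R T f C h) (base_change R T f C)))"

section \<open>Relative Cohen-Macaulay and Gorenstein modules\<close>

definition rel_CM :: "('r, 'p) ring_scheme \<Rightarrow> 'r set \<Rightarrow> ('r, 'm, 'y) module_scheme \<Rightarrow> bool"
  where "rel_CM R I M \<longleftrightarrow>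
    carrier M = ideal_smult I M \<or> (carrier M \<noteq> ideal_smult I M \<and> grade R I M = cd R I M)"

definition rel_maximal_CM :: "('r, 'p) ring_scheme \<Rightarrow> 'r set \<Rightarrow> ('r, 'm, 'y) module_scheme \<Rightarrow> bool"
  where "rel_maximal_CM R I M \<longleftrightarrow> grade R I M = cd R I (ring_module R)"

definition rel_Gorenstein :: "('r, 'p) ring_scheme \<Rightarrow> 'r set \<Rightarrow> ('r, 'm, 'y) module_scheme \<Rightarrow> bool"
  where "rel_Gorenstein R I M \<longleftrightarrow>
    (\<forall>i. ereal (real i) \<noteq> cd R I (ring_module R) \<longrightarrow>
         zero_module (Ext_module R (cyclic_module R I) i M))"

end

theory Submission
  imports Defs
begin

text \<open>Let \<open>P\<close> be a resolution of \<open>R/\<aa>\<^sup>n\<close> by free modules of finite rank. A cocycle of \<open>Hom(P, M)\<close> is a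
  solution vector in \<open>M\<close> of a homogeneous linear system over \<open>R\<close>, and a coboundary is a vector for which
  an inhomogeneous system is solvable. Flatness says that the solutions over \<open>T \<otimes> M\<close> of a homogeneous
  system with coefficients in \<open>R\<close> are spanned by solutions over \<open>M\<close>; faithfulness says that a system
  which is solvable over \<open>T \<otimes> M\<close> is solvable over \<open>M\<close>. Since the base change of \<open>P\<close> resolves
  \<open>T/(\<aa>T)\<^sup>n\<close>, the groups Ext and the local cohomology of \<open>M\<close> vanish in the same degrees as
  those of \<open>T \<otimes> M\<close>. As \<open>M = \<aa>M\<close> also descends, so do all three notions.\<close>

section \<open>Modules, linear combinations and powers\<close>

text \<open>Both sides are defined through arbitrary choices: \<open>resolution\<close> picks some
  resolution over each ring and \<open>Ext_map\<close> picks some lift, so the two sides share no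
  data. No isomorphism between T \<otimes> Ext and Ext is built. The three notions ask only in which
  degrees groups vanish, so it is enough to show that vanishing does not depend on resolutions and
  lifts, and then to compare one resolution over R with its own base change. For local cohomology
  the limit adds one point: a cocycle over T is a combination of finitely many cocycles over R, each
  of which dies at some stage, so all of them die at a common later one. A second obstacle is the
  type in \<open>faithfully_flat\<close>, which quantifies only over modules of sets of vectors over
  R. As M is finitely generated, all its powers embed into that type by one injection, and the
  sequences to which flatness is applied consist of submodules of such powers. The value of
  \<open>cd\<close> at the ring itself is compared through the isomorphism of T \<otimes> R with T;
  therefore the transfer of local cohomology allows a module merely isomorphic to the base
  change.\<close>

lemma mod_homI:
  assumes "\<And>x. x \<in> carrier A \<Longrightarrow> h x \<in> carrier B"
    and "\<And>x y. x \<in> carrier A \<Longrightarrow> y \<in> carrier A \<Longrightarrow> h (x \<oplus>\<^bsub>A\<^esub> y) = h x \<oplus>\<^bsub>B\<^esub> h y"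
    and "\<And>r x. r \<in> carrier R \<Longrightarrow> x \<in> carrier A \<Longrightarrow> h (r \<odot>\<^bsub>A\<^esub> x) = r \<odot>\<^bsub>B\<^esub> h x"
  shows "h \<in> mod_hom R A B"
  using assms unfolding mod_hom_def by auto

lemma mod_hom_closed: "h \<in> mod_hom R A B \<Longrightarrow> x \<in> carrier A \<Longrightarrow> h x \<in> carrier B"
  and mod_hom_add: "h \<in> mod_hom R A B \<Longrightarrow> x \<in> carrier A \<Longrightarrow> y \<in> carrier A \<Longrightarrow>
    h (x \<oplus>\<^bsub>A\<^esub> y) = h x \<oplus>\<^bsub>B\<^esub> h y"
  and mod_hom_smult: "h \<in> mod_hom R A B \<Longrightarrow> r \<in> carrier R \<Longrightarrow> x \<in> carrier A \<Longrightarrow>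
    h (r \<odot>\<^bsub>A\<^esub> x) = r \<odot>\<^bsub>B\<^esub> h x"
  unfolding mod_hom_def by auto

lemma mod_hom_zero:
  assumes "module R A" "module R B" "h \<in> mod_hom R A B"
  shows "h \<zero>\<^bsub>A\<^esub> = \<zero>\<^bsub>B\<^esub>"
proof -
  interpret A: module R A by fact
  interpret B: module R B by fact
  have "h (\<zero>\<^bsub>R\<^esub> \<odot>\<^bsub>A\<^esub> \<zero>\<^bsub>A\<^esub>) = \<zero>\<^bsub>R\<^esub> \<odot>\<^bsub>B\<^esub> h \<zero>\<^bsub>A\<^esub>"
    using assms(3) by (intro mod_hom_smult) auto
  then show ?thesis
    using mod_hom_closed[OF assms(3) A.zero_closed] by simp
qed

lemma mod_hom_minus:
  assumes "module R A" "module R B" "h \<in> mod_hom R A B" "x \<in> carrier A" "y \<in> carrier A"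
  shows "h (x \<ominus>\<^bsub>A\<^esub> y) = h x \<ominus>\<^bsub>B\<^esub> h y"
proof -
  interpret A: module R A by fact
  interpret B: module R B by fact
  have 1: "\<ominus>\<^bsub>A\<^esub> y = (\<ominus>\<^bsub>R\<^esub> \<one>\<^bsub>R\<^esub>) \<odot>\<^bsub>A\<^esub> y"
    using assms(5) by (simp add: A.smult_l_minus)
  have 2: "\<ominus>\<^bsub>B\<^esub> h y = (\<ominus>\<^bsub>R\<^esub> \<one>\<^bsub>R\<^esub>) \<odot>\<^bsub>B\<^esub> h y"
    using mod_hom_closed[OF assms(3,5)] by (simp add: B.smult_l_minus)
  show ?thesis
    using assms unfolding a_minus_def 1 2
    by (simp add: mod_hom_add[OF assms(3)] mod_hom_smult[OF assms(3)])
qed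

lemma mod_hom_comp:
  "g \<in> mod_hom R A B \<Longrightarrow> h \<in> mod_hom R B C \<Longrightarrow> (\<lambda>x. h (g x)) \<in> mod_hom R A C"
  by (rule mod_homI) (simp_all add: mod_hom_closed mod_hom_add mod_hom_smult)

lemma mod_hom_const_zero:
  assumes "module R A" "module R B"
  shows "(\<lambda>x. \<zero>\<^bsub>B\<^esub>) \<in> mod_hom R A B"
proof -
  interpret B: module R B by fact
  show ?thesis by (rule mod_homI) auto
qed

lemma mod_hom_diff:
  assumes "module R A" "module R B" "g \<in> mod_hom R A B" "h \<in> mod_hom R A B"
  shows "(\<lambda>x. g x \<ominus>\<^bsub>B\<^esub> h x) \<in> mod_hom R A B"
proof -
  interpret A: module R A by fact
  interpret B: module R B by fact
  note gh = mod_hom_closed[OF assms(3)] mod_hom_closed[OF assms(4)]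
  show ?thesis
  proof (rule mod_homI)
    fix x y assume xy: "x \<in> carrier A" "y \<in> carrier A"
    then show "g (x \<oplus>\<^bsub>A\<^esub> y) \<ominus>\<^bsub>B\<^esub> h (x \<oplus>\<^bsub>A\<^esub> y) = g x \<ominus>\<^bsub>B\<^esub> h x \<oplus>\<^bsub>B\<^esub> (g y \<ominus>\<^bsub>B\<^esub> h y)"
      using gh by (simp add: mod_hom_add[OF assms(3)] mod_hom_add[OF assms(4)] a_minus_def
          B.minus_add B.a_ac)
  next
    fix r x assume rx: "r \<in> carrier R" "x \<in> carrier A"
    then show "g (r \<odot>\<^bsub>A\<^esub> x) \<ominus>\<^bsub>B\<^esub> h (r \<odot>\<^bsub>A\<^esub> x) = r \<odot>\<^bsub>B\<^esub> (g x \<ominus>\<^bsub>B\<^esub> h x)"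
      using gh by (simp add: mod_hom_smult[OF assms(3)] mod_hom_smult[OF assms(4)] a_minus_def
          B.smult_r_distr B.smult_r_minus)
  qed (use gh in auto)
qed

lemma (in module) mod_hom_incl: "H \<subseteq> carrier M \<Longrightarrow> (\<lambda>x. x) \<in> mod_hom R (M\<lparr>carrier := H\<rparr>) M"
  by (rule mod_homI) auto

lemma (in module) submodule_kernel:
  assumes "module R B" "h \<in> mod_hom R M B"
  shows "submodule {x \<in> carrier M. h x = \<zero>\<^bsub>B\<^esub>} R M"
proof -
  interpret B: module R B by fact
  have "h (\<ominus>\<^bsub>M\<^esub> x) = \<zero>\<^bsub>B\<^esub>" if "x \<in> carrier M" "h x = \<zero>\<^bsub>B\<^esub>" for x
    using mod_hom_smult[OF assms(2), of "\<ominus>\<^bsub>R\<^esub> \<one>\<^bsub>R\<^esub>" x] that by (simp add: smult_l_minus)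
  then show ?thesis
    using mod_hom_zero[OF _ assms] module_axioms
    by (intro submoduleI) (auto simp: mod_hom_add[OF assms(2)] mod_hom_smult[OF assms(2)])
qed

lemma (in module) submodule_image:
  assumes "module R B" "h \<in> mod_hom R M B"
  shows "submodule (h ` carrier M) R B"
proof -
  interpret B: module R B by fact
  note closed = mod_hom_closed[OF assms(2)]
  show ?thesis
  proof (rule B.submoduleI)
    show "h ` carrier M \<subseteq> carrier B" using closed by blast
    show "\<zero>\<^bsub>B\<^esub> \<in> h ` carrier M"
      using imageI[OF M.zero_closed, of h] by (simp only: mod_hom_zero[OF module_axioms assms])
    show smult: "r \<odot>\<^bsub>B\<^esub> y \<in> h ` carrier M" if "r \<in> carrier R" "y \<in> h ` carrier M" for r y
      using that by (auto simp flip: mod_hom_smult[OF assms(2)])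
    show "\<ominus>\<^bsub>B\<^esub> y \<in> h ` carrier M" if "y \<in> h ` carrier M" for y
      using smult[OF _ that, of "\<ominus>\<^bsub>R\<^esub> \<one>\<^bsub>R\<^esub>"] that closed by (auto simp: B.smult_l_minus)
    show "y \<oplus>\<^bsub>B\<^esub> z \<in> h ` carrier M" if "y \<in> h ` carrier M" "z \<in> h ` carrier M" for y z
      using that by (auto simp flip: mod_hom_add[OF assms(2)])
  qed
qed

text \<open>Families are indexed by natural numbers and read only below b, so a linear combination
  is a recursion on b and its algebra is plain induction. Elements of \<open>free_module\<close> and
  rows of matrices are families of the same kind and serve directly as coefficients.\<close>

primrec lincomb :: "('r, 'n, 'y) module_scheme \<Rightarrow> nat \<Rightarrow> (nat \<Rightarrow> 'r) \<Rightarrow> (nat \<Rightarrow> 'n) \<Rightarrow> 'n" where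
  "lincomb N 0 v x = \<zero>\<^bsub>N\<^esub>"
| "lincomb N (Suc b) v x = lincomb N b v x \<oplus>\<^bsub>N\<^esub> v b \<odot>\<^bsub>N\<^esub> x b"

lemma lincomb_cong:
  "(\<And>k. k < b \<Longrightarrow> v k = w k) \<Longrightarrow> (\<And>k. k < b \<Longrightarrow> x k = y k) \<Longrightarrow>
    lincomb N b v x = lincomb N b w y"
  by (induction b) auto

lemma (in module) lincomb_closed [simp]:
  "(\<And>k. k < b \<Longrightarrow> v k \<in> carrier R) \<Longrightarrow> (\<And>k. k < b \<Longrightarrow> x k \<in> carrier M) \<Longrightarrow>
    lincomb M b v x \<in> carrier M"
  by (induction b) auto

lemma (in module) lincomb_zero:
  "(\<And>k. k < b \<Longrightarrow> v k \<odot>\<^bsub>M\<^esub> x k = \<zero>\<^bsub>M\<^esub>) \<Longrightarrow> lincomb M b v x = \<zero>\<^bsub>M\<^esub>"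
  by (induction b) auto

lemma (in module) lincomb_delta_right:
  assumes "\<And>k. k < b \<Longrightarrow> v k \<in> carrier R" "y \<in> carrier M"
  shows "lincomb M b v (\<lambda>j. if j = k then y else \<zero>\<^bsub>M\<^esub>) = (if k < b then v k \<odot>\<^bsub>M\<^esub> y else \<zero>\<^bsub>M\<^esub>)"
  using assms by (induction b) (auto simp: less_Suc_eq)

lemma (in module) lincomb_delta_left:
  assumes "\<And>k. k < b \<Longrightarrow> x k \<in> carrier M"
  shows "lincomb M b (\<lambda>j. if j = k then \<one>\<^bsub>R\<^esub> else \<zero>\<^bsub>R\<^esub>) x = (if k < b then x k else \<zero>\<^bsub>M\<^esub>)"
  using assms by (induction b) (auto simp: less_Suc_eq)

lemma (in module) lincomb_add_left:
  assumes "\<And>k. k < b \<Longrightarrow> v k \<in> carrier R" "\<And>k. k < b \<Longrightarrow> w k \<in> carrier R"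
    "\<And>k. k < b \<Longrightarrow> x k \<in> carrier M"
  shows "lincomb M b (\<lambda>k. v k \<oplus>\<^bsub>R\<^esub> w k) x = lincomb M b v x \<oplus>\<^bsub>M\<^esub> lincomb M b w x"
  using assms by (induction b) (auto simp: smult_l_distr M.a_ac)

lemma (in module) lincomb_add_right:
  assumes "\<And>k. k < b \<Longrightarrow> v k \<in> carrier R" "\<And>k. k < b \<Longrightarrow> x k \<in> carrier M"
    "\<And>k. k < b \<Longrightarrow> y k \<in> carrier M"
  shows "lincomb M b v (\<lambda>k. x k \<oplus>\<^bsub>M\<^esub> y k) = lincomb M b v x \<oplus>\<^bsub>M\<^esub> lincomb M b v y"
  using assms by (induction b) (auto simp: smult_r_distr M.a_ac)

lemma (in module) lincomb_smult_left:
  assumes "r \<in> carrier R" "\<And>k. k < b \<Longrightarrow> v k \<in> carrier R" "\<And>k. k < b \<Longrightarrow> x k \<in> carrier M"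
  shows "lincomb M b (\<lambda>k. r \<otimes>\<^bsub>R\<^esub> v k) x = r \<odot>\<^bsub>M\<^esub> lincomb M b v x"
  using assms by (induction b) (auto simp: smult_r_distr smult_assoc1)

lemma (in module) lincomb_smult_right:
  assumes "r \<in> carrier R" "\<And>k. k < b \<Longrightarrow> v k \<in> carrier R" "\<And>k. k < b \<Longrightarrow> x k \<in> carrier M"
  shows "lincomb M b v (\<lambda>k. r \<odot>\<^bsub>M\<^esub> x k) = r \<odot>\<^bsub>M\<^esub> lincomb M b v x"
proof -
  have "v k \<odot>\<^bsub>M\<^esub> (r \<odot>\<^bsub>M\<^esub> x k) = r \<odot>\<^bsub>M\<^esub> (v k \<odot>\<^bsub>M\<^esub> x k)" if "k < b" for k
    using assms that by (metis R.m_comm smult_assoc1)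
  then show ?thesis
    using assms by (induction b) (auto simp: smult_r_distr)
qed

text \<open>The scalars of the target are independent of those of the source: \<open>h\<close> is
  merely additive, and \<open>N\<close> may be a module over another ring, with \<open>w k\<close>
  in place of \<open>v k\<close>. This covers linear maps as well as \<open>f\<close> itself and the
  map x to 1 \<otimes> x, which turn r into \<open>f r\<close>.\<close>

lemma (in module) lincomb_image:
  assumes "h \<zero>\<^bsub>M\<^esub> = \<zero>\<^bsub>N\<^esub>"
    and "\<And>y z. y \<in> carrier M \<Longrightarrow> z \<in> carrier M \<Longrightarrow> h (y \<oplus>\<^bsub>M\<^esub> z) = h y \<oplus>\<^bsub>N\<^esub> h z"
    and "\<And>k. k < b \<Longrightarrow> v k \<in> carrier R" "\<And>k. k < b \<Longrightarrow> x k \<in> carrier M"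
    and "\<And>k. k < b \<Longrightarrow> h (v k \<odot>\<^bsub>M\<^esub> x k) = w k \<odot>\<^bsub>N\<^esub> y k"
  shows "h (lincomb M b v x) = lincomb N b w y"
  using assms by (induction b) auto

lemma mod_hom_lincomb:
  assumes "module R A" "module R B" "h \<in> mod_hom R A B"
    and "\<And>k. k < b \<Longrightarrow> v k \<in> carrier R" "\<And>k. k < b \<Longrightarrow> x k \<in> carrier A"
  shows "h (lincomb A b v x) = lincomb B b v (\<lambda>k. h (x k))"
  using assms
  by (intro module.lincomb_image[OF assms(1)]) (auto simp: mod_hom_zero mod_hom_add mod_hom_smult)

text \<open>The same zero padding as in \<open>free_module\<close>, which is thereby a power of
  \<open>ring_module\<close>. All powers of M share one element type, so a single embedding into the
  type used by \<open>faithfully_flat\<close> serves for all of them.\<close>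

definition pow_module :: "('r, 'a, 'x) module_scheme \<Rightarrow> nat \<Rightarrow> ('r, nat \<Rightarrow> 'a) module"
  where "pow_module M b =
    \<lparr>carrier = {v. (\<forall>j<b. v j \<in> carrier M) \<and> (\<forall>j\<ge>b. v j = \<zero>\<^bsub>M\<^esub>)},
     monoid.mult = undefined, monoid.one = undefined,
     ring.zero = (\<lambda>j. \<zero>\<^bsub>M\<^esub>), ring.add = (\<lambda>v w j. v j \<oplus>\<^bsub>M\<^esub> w j), smult = (\<lambda>r v j. r \<odot>\<^bsub>M\<^esub> v j)\<rparr>"

lemma free_module_eq_pow: "free_module R b = pow_module (ring_module R) b"
  by (simp add: free_module_def pow_module_def ring_module_def)

lemma pow_module_simps [simp]:
  "\<zero>\<^bsub>pow_module M b\<^esub> = (\<lambda>j. \<zero>\<^bsub>M\<^esub>)"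
  "v \<oplus>\<^bsub>pow_module M b\<^esub> w = (\<lambda>j. v j \<oplus>\<^bsub>M\<^esub> w j)"
  "r \<odot>\<^bsub>pow_module M b\<^esub> v = (\<lambda>j. r \<odot>\<^bsub>M\<^esub> v j)"
  by (simp_all add: pow_module_def)

lemma ring_module_simps [simp]:
  "carrier (ring_module R) = carrier R"
  "\<zero>\<^bsub>ring_module R\<^esub> = \<zero>\<^bsub>R\<^esub>"
  "x \<oplus>\<^bsub>ring_module R\<^esub> y = x \<oplus>\<^bsub>R\<^esub> y"
  "x \<odot>\<^bsub>ring_module R\<^esub> y = x \<otimes>\<^bsub>R\<^esub> y"
  by (simp_all add: ring_module_def)

lemma free_module_simps [simp]:
  "\<zero>\<^bsub>free_module R b\<^esub> = (\<lambda>j. \<zero>\<^bsub>R\<^esub>)"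
  "v \<oplus>\<^bsub>free_module R b\<^esub> w = (\<lambda>j. v j \<oplus>\<^bsub>R\<^esub> w j)"
  "r \<odot>\<^bsub>free_module R b\<^esub> v = (\<lambda>j. r \<otimes>\<^bsub>R\<^esub> v j)"
  by (simp_all add: free_module_def)

lemma carrier_pow_module:
  "v \<in> carrier (pow_module M b) \<longleftrightarrow> (\<forall>j<b. v j \<in> carrier M) \<and> (\<forall>j\<ge>b. v j = \<zero>\<^bsub>M\<^esub>)"
  by (simp add: pow_module_def)

lemma carrier_free_module:
  "v \<in> carrier (free_module R b) \<longleftrightarrow> (\<forall>j<b. v j \<in> carrier R) \<and> (\<forall>j\<ge>b. v j = \<zero>\<^bsub>R\<^esub>)"
  by (simp add: free_module_def)

lemma (in module) pow_module_nth: "v \<in> carrier (pow_module M b) \<Longrightarrow> v j \<in> carrier M"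
  by (cases "j < b") (auto simp: carrier_pow_module)

lemma (in cring) free_module_nth: "v \<in> carrier (free_module R b) \<Longrightarrow> v j \<in> carrier R"
  by (cases "j < b") (auto simp: carrier_free_module)

lemma (in cring) module_ring_module: "module R (ring_module R)"
proof (rule moduleI)
  show "abelian_group (ring_module R)"
  proof (rule abelian_groupI)
    fix x assume "x \<in> carrier (ring_module R)"
    then show "\<exists>y\<in>carrier (ring_module R). y \<oplus>\<^bsub>ring_module R\<^esub> x = \<zero>\<^bsub>ring_module R\<^esub>"
      by (intro bexI[of _ "\<ominus> x"]) (auto simp: l_neg)
  qed (auto simp: a_ac)
qed (auto simp: l_distr r_distr m_assoc is_cring)

lemma (in cring) submodule_ring_module_ideal:
  assumes "submodule H R (ring_module R)"
  shows "ideal H R"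
proof (rule idealI[OF ring_axioms])
  note H = module.submoduleE[OF module_ring_module assms, simplified]
  show "subgroup H (add_monoid R)"
  proof (rule add.subgroupI)
    show "\<ominus> a \<in> H" if "a \<in> H" for a
      using H(4)[OF a_inv_closed[OF one_closed] that] that H(1) by (auto simp: l_minus)
  qed (use H in auto)
  fix a r assume a: "a \<in> H" and r: "r \<in> carrier R"
  show "r \<otimes> a \<in> H" by (rule H(4)[OF r a])
  then show "a \<otimes> r \<in> H" using a r H(1) by (auto simp: m_comm subset_iff)
qed

lemma (in cring) mod_hom_image_ideal:
  assumes "module R N" "h \<in> mod_hom R N (ring_module R)"
  shows "ideal (h ` carrier N) R"
  by (rule submodule_ring_module_ideal[OF module.submodule_image[OF assms(1) module_ring_module assms(2)]])

lemma (in module) module_pow_module: "module R (pow_module M b)"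
proof (rule moduleI)
  show "abelian_group (pow_module M b)"
  proof (rule abelian_groupI)
    fix x assume x: "x \<in> carrier (pow_module M b)"
    show "\<exists>y\<in>carrier (pow_module M b). y \<oplus>\<^bsub>pow_module M b\<^esub> x = \<zero>\<^bsub>pow_module M b\<^esub>"
      by (rule bexI[of _ "\<lambda>j. \<ominus>\<^bsub>M\<^esub> x j"])
        (use x pow_module_nth[OF x] in \<open>auto simp: carrier_pow_module M.l_neg\<close>)
  next
    fix x y z assume *: "x \<in> carrier (pow_module M b)" "y \<in> carrier (pow_module M b)"
      "z \<in> carrier (pow_module M b)"
    then show "x \<oplus>\<^bsub>pow_module M b\<^esub> y \<oplus>\<^bsub>pow_module M b\<^esub> z =
       x \<oplus>\<^bsub>pow_module M b\<^esub> (y \<oplus>\<^bsub>pow_module M b\<^esub> z)"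
      using *[THEN pow_module_nth] by (simp add: M.a_assoc)
  next
    fix x y assume *: "x \<in> carrier (pow_module M b)" "y \<in> carrier (pow_module M b)"
    then show "x \<oplus>\<^bsub>pow_module M b\<^esub> y = y \<oplus>\<^bsub>pow_module M b\<^esub> x"
      using *[THEN pow_module_nth] by (simp add: M.a_comm)
  next
    fix x assume *: "x \<in> carrier (pow_module M b)"
    then show "\<zero>\<^bsub>pow_module M b\<^esub> \<oplus>\<^bsub>pow_module M b\<^esub> x = x"
      using *[THEN pow_module_nth] by simp
  qed (auto simp: carrier_pow_module)
next
  show "cring R" by (rule R.is_cring)
qed (simp_all add: pow_module_nth smult_l_distr smult_r_distr smult_assoc1, simp add: carrier_pow_module)

lemma (in cring) module_free_module: "module R (free_module R b)"
  unfolding free_module_eq_pow by (rule module.module_pow_module[OF module_ring_module])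

definition unit_vec :: "('r, 'p) ring_scheme \<Rightarrow> nat \<Rightarrow> nat \<Rightarrow> 'r"
  where "unit_vec R j = (\<lambda>k. if k = j then \<one>\<^bsub>R\<^esub> else \<zero>\<^bsub>R\<^esub>)"

lemma (in cring) unit_vec_closed [simp]: "j < b \<Longrightarrow> unit_vec R j \<in> carrier (free_module R b)"
  by (auto simp: unit_vec_def carrier_free_module)

lemma lincomb_pow_module_nth: "lincomb (pow_module M q) b v x k = lincomb M b v (\<lambda>j. x j k)"
  by (induction b) auto

lemma lincomb_free_module_nth:
  "lincomb (free_module R q) b v x k = lincomb (ring_module R) b v (\<lambda>j. x j k)"
  by (induction b) auto

lemma (in module) lincomb_unit_vec:
  "(\<And>k. k < b \<Longrightarrow> x k \<in> carrier M) \<Longrightarrow> j < b \<Longrightarrow> lincomb M b (unit_vec R j) x = x j"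
  unfolding unit_vec_def using lincomb_delta_left[of b x j] by simp

lemma (in cring) free_module_expand:
  assumes "v \<in> carrier (free_module R b)"
  shows "lincomb (free_module R b) b v (unit_vec R) = v"
proof
  fix k
  interpret RM: module R "ring_module R" by (rule module_ring_module)
  have "(\<lambda>j. unit_vec R j k) = (\<lambda>j. if j = k then \<one> else \<zero>)"
    by (auto simp: unit_vec_def)
  then show "lincomb (free_module R b) b v (unit_vec R) k = v k"
    using RM.lincomb_delta_right[of b v \<one> k, unfolded ring_module_simps] assms free_module_nth[OF assms]
    by (auto simp: lincomb_free_module_nth carrier_free_module)
qed

lemma (in module) lincomb_mod_hom:
  assumes "\<And>k. k < b \<Longrightarrow> x k \<in> carrier M"
  shows "(\<lambda>v. lincomb M b v x) \<in> mod_hom R (free_module R b) M"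
  using assms
  by (intro mod_homI) (auto simp: lincomb_add_left lincomb_smult_left carrier_free_module)

lemma (in module) free_hom_expand:
  assumes "h \<in> mod_hom R (free_module R b) M" "v \<in> carrier (free_module R b)"
  shows "h v = lincomb M b v (\<lambda>j. h (unit_vec R j))"
proof -
  have "h v = h (lincomb (free_module R b) b v (unit_vec R))"
    using R.free_module_expand[OF assms(2)] by simp
  also have "\<dots> = lincomb M b v (\<lambda>j. h (unit_vec R j))"
    using assms by (intro mod_hom_lincomb[OF R.module_free_module module_axioms assms(1)])
      (auto intro: R.free_module_nth)
  finally show ?thesis .
qed

lemma free_hom_eqI:
  assumes "module R N" "g \<in> mod_hom R (free_module R b) N" "h \<in> mod_hom R (free_module R b) N"
    and "\<And>j. j < b \<Longrightarrow> g (unit_vec R j) = h (unit_vec R j)"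
    and "v \<in> carrier (free_module R b)"
  shows "g v = h v"
  unfolding module.free_hom_expand[OF assms(1,2,5)] module.free_hom_expand[OF assms(1,3,5)]
  by (rule lincomb_cong) (simp_all add: assms(4))

text \<open>Projectivity of a free module of finite rank: choose preimages of the values on the
  basis and extend linearly.\<close>

lemma free_lift:
  assumes "module R B" "module R C" "g \<in> mod_hom R B C" "h \<in> mod_hom R (free_module R b) C"
    and "\<And>j. j < b \<Longrightarrow> h (unit_vec R j) \<in> g ` carrier B"
  shows "\<exists>k \<in> mod_hom R (free_module R b) B. \<forall>v\<in>carrier (free_module R b). g (k v) = h v"
proof -
  interpret B: module R B by fact
  have "\<forall>j. \<exists>y. j < b \<longrightarrow> y \<in> carrier B \<and> g y = h (unit_vec R j)"
    using assms(5) by (metis imageE)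
  then obtain y where y: "\<And>j. j < b \<Longrightarrow> y j \<in> carrier B" "\<And>j. j < b \<Longrightarrow> g (y j) = h (unit_vec R j)"
    by metis
  let ?k = "\<lambda>v. lincomb B b v y"
  have k: "?k \<in> mod_hom R (free_module R b) B"
    using y by (intro B.lincomb_mod_hom) auto
  have "g (?k v) = h v" if "v \<in> carrier (free_module R b)" for v
    by (rule free_hom_eqI[OF assms(2) mod_hom_comp[OF k assms(3)] assms(4) _ that])
      (use y in \<open>simp add: B.lincomb_unit_vec\<close>)
  then show ?thesis by (intro bexI[OF _ k] ballI)
qed

lemma (in module) lincomb_swap:
  assumes "\<And>j. j < c \<Longrightarrow> u j \<in> carrier R" "\<And>k. k < b \<Longrightarrow> v k \<in> carrier R"
    and "\<And>j k. j < c \<Longrightarrow> k < b \<Longrightarrow> x j k \<in> carrier M"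
  shows "lincomb M c u (\<lambda>j. lincomb M b v (x j)) = lincomb M b v (\<lambda>k. lincomb M c u (\<lambda>j. x j k))"
  using assms
proof (induction c)
  case 0
  then show ?case by (auto intro!: lincomb_zero[symmetric])
next
  case (Suc c)
  then show ?case by (simp add: lincomb_add_right lincomb_smult_right)
qed

lemma (in module) lincomb_append:
  assumes "\<And>l. l < s \<Longrightarrow> t l \<in> carrier R" "\<And>l. l < n \<Longrightarrow> t' l \<in> carrier R"
    and "\<And>l. l < s \<Longrightarrow> w l \<in> carrier M" "\<And>l. l < n \<Longrightarrow> w' l \<in> carrier M"
  shows "lincomb M (s + n) (\<lambda>l. if l < s then t l else t' (l - s)) (\<lambda>l. if l < s then w l else w' (l - s)) =
    lincomb M s t w \<oplus>\<^bsub>M\<^esub> lincomb M n t' w'"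
  using assms(2,4)
proof (induction n)
  case 0
  have "lincomb M s (\<lambda>l. if l < s then t l else t' (l - s)) (\<lambda>l. if l < s then w l else w' (l - s)) = lincomb M s t w"
    by (rule lincomb_cong) auto
  then show ?case using assms by simp
next
  case (Suc n)
  then show ?case using assms(1,3) by (simp add: M.a_assoc)
qed

section \<open>The base change of a module\<close>

locale ring_change = R: cring R + T: cring T
  for R :: "('r, 'p) ring_scheme" and T :: "('t, 'q) ring_scheme" +
  fixes f :: "'r \<Rightarrow> 't"
  assumes f_hom: "f \<in> ring_hom R T"
begin

lemma f_closed [simp]: "r \<in> carrier R \<Longrightarrow> f r \<in> carrier T"
  and f_add: "r \<in> carrier R \<Longrightarrow> s \<in> carrier R \<Longrightarrow> f (r \<oplus>\<^bsub>R\<^esub> s) = f r \<oplus>\<^bsub>T\<^esub> f s"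
  and f_mult: "r \<in> carrier R \<Longrightarrow> s \<in> carrier R \<Longrightarrow> f (r \<otimes>\<^bsub>R\<^esub> s) = f r \<otimes>\<^bsub>T\<^esub> f s"
  and f_one [simp]: "f \<one>\<^bsub>R\<^esub> = \<one>\<^bsub>T\<^esub>"
  using f_hom by (auto simp: ring_hom_def)

lemma f_zero [simp]: "f \<zero>\<^bsub>R\<^esub> = \<zero>\<^bsub>T\<^esub>"
  using ring_hom_zero[OF f_hom R.ring_axioms T.ring_axioms] .

abbreviation tensor_group :: "('r, 'm, 'y) module_scheme \<Rightarrow> ('t \<times> 'm \<Rightarrow>\<^sub>0 int) monoid"
  where "tensor_group M \<equiv> free_Abelian_group (carrier T \<times> carrier M)"

abbreviation tensor_rel :: "('r, 'm, 'y) module_scheme \<Rightarrow> ('t \<times> 'm \<Rightarrow>\<^sub>0 int) set"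
  where "tensor_rel M \<equiv> tensor_relations R T f M"

abbreviation bc :: "('r, 'm, 'y) module_scheme \<Rightarrow> ('t, ('t \<times> 'm \<Rightarrow>\<^sub>0 int) set) module"
  where "bc M \<equiv> base_change R T f M"

definition tensor_class :: "('r, 'm, 'y) module_scheme \<Rightarrow> ('t \<times> 'm \<Rightarrow>\<^sub>0 int) \<Rightarrow> ('t \<times> 'm \<Rightarrow>\<^sub>0 int) set"
  where "tensor_class M c = tensor_rel M #>\<^bsub>tensor_group M\<^esub> c"

definition tens :: "('r, 'm, 'y) module_scheme \<Rightarrow> 't \<Rightarrow> 'm \<Rightarrow> ('t \<times> 'm \<Rightarrow>\<^sub>0 int) set"
  where "tens M t m = tensor_class M (frag_of (t, m))"

text \<open>The three families of bilinearity relations, named apart from the subgroup that they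
  generate so that an induction over \<open>generate\<close> can split into them.\<close>

definition tensor_gens :: "('r, 'm, 'y) module_scheme \<Rightarrow> ('t \<times> 'm \<Rightarrow>\<^sub>0 int) set"
  where "tensor_gens M =
    {frag_of (s \<oplus>\<^bsub>T\<^esub> t, m) - frag_of (s, m) - frag_of (t, m) | s t m.
       s \<in> carrier T \<and> t \<in> carrier T \<and> m \<in> carrier M} \<union>
    {frag_of (t, m \<oplus>\<^bsub>M\<^esub> n) - frag_of (t, m) - frag_of (t, n) | t m n.
       t \<in> carrier T \<and> m \<in> carrier M \<and> n \<in> carrier M} \<union>
    {frag_of (t \<otimes>\<^bsub>T\<^esub> f r, m) - frag_of (t, r \<odot>\<^bsub>M\<^esub> m) | t r m.
       t \<in> carrier T \<and> r \<in> carrier R \<and> m \<in> carrier M}"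

lemma tensor_rel_eq: "tensor_rel M = generate (tensor_group M) (tensor_gens M)"
  by (simp add: tensor_relations_def tensor_gens_def)

lemma tensor_gens_incl: "c \<in> tensor_gens M \<Longrightarrow> c \<in> tensor_rel M"
  unfolding tensor_rel_eq by (rule generate.incl)

lemma keys_diff_frag: "Poly_Mapping.keys a \<subseteq> S \<Longrightarrow> Poly_Mapping.keys b \<subseteq> S \<Longrightarrow> Poly_Mapping.keys (a - b) \<subseteq> S"
  for a b :: "'z \<Rightarrow>\<^sub>0 int"
  using keys_diff[of a b] by blast

lemma keys_add_frag: "Poly_Mapping.keys a \<subseteq> S \<Longrightarrow> Poly_Mapping.keys b \<subseteq> S \<Longrightarrow> Poly_Mapping.keys (a + b) \<subseteq> S"
  for a b :: "'z \<Rightarrow>\<^sub>0 int"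
  using keys_add[of a b] by blast

lemma subgroup_tensor_rel:
  assumes "module R M"
  shows "subgroup (tensor_rel M) (tensor_group M)"
proof -
  interpret M: module R M by fact
  show ?thesis
    unfolding tensor_rel_eq tensor_gens_def
    by (rule group.generate_is_subgroup[OF group_free_Abelian_group])
      (auto dest!: subsetD[OF keys_diff])
qed

lemma tensor_rel_keys:
  "module R M \<Longrightarrow> c \<in> tensor_rel M \<Longrightarrow> Poly_Mapping.keys c \<subseteq> carrier T \<times> carrier M"
  using subgroup.subset[OF subgroup_tensor_rel] by fastforce

lemma tensor_rel_add: "module R M \<Longrightarrow> c \<in> tensor_rel M \<Longrightarrow> d \<in> tensor_rel M \<Longrightarrow> c + d \<in> tensor_rel M"
  using subgroup.m_closed[OF subgroup_tensor_rel] by fastforce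

lemma tensor_rel_minus: "module R M \<Longrightarrow> c \<in> tensor_rel M \<Longrightarrow> - c \<in> tensor_rel M"
  using subgroup.m_inv_closed[OF subgroup_tensor_rel] tensor_rel_keys by fastforce

lemma tensor_rel_zero: "module R M \<Longrightarrow> 0 \<in> tensor_rel M"
  using subgroup.one_closed[OF subgroup_tensor_rel] by fastforce

lemma tensor_class_alt: "tensor_class M c = {h + c | h. h \<in> tensor_rel M}"
  by (auto simp: tensor_class_def r_coset_def)

lemma tensor_class_eq_iff:
  assumes "module R M"
  shows "tensor_class M c = tensor_class M d \<longleftrightarrow> c - d \<in> tensor_rel M"
proof
  assume "tensor_class M c = tensor_class M d"
  moreover have "c \<in> tensor_class M c"
    using tensor_rel_zero[OF assms] by (force simp: tensor_class_alt)
  ultimately show "c - d \<in> tensor_rel M"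
    by (auto simp: tensor_class_alt)
next
  assume *: "c - d \<in> tensor_rel M"
  have "h + c = (h + (c - d)) + d" "h + d = (h + (- (c - d))) + c" for h
    by simp_all
  then show "tensor_class M c = tensor_class M d"
    using tensor_rel_add[OF assms _ *] tensor_rel_add[OF assms _ tensor_rel_minus[OF assms *]]
    unfolding tensor_class_alt by (metis (no_types, opaque_lifting))
qed

lemma tensor_class_self: "module R M \<Longrightarrow> c \<in> tensor_class M c"
  using tensor_rel_zero by (force simp: tensor_class_alt)

lemma carrier_bc: "carrier (bc M) = tensor_class M ` {c. Poly_Mapping.keys c \<subseteq> carrier T \<times> carrier M}"
  by (auto simp: base_change_def Let_def carrier_FactGroup tensor_class_def)

lemma tensor_class_closed:
  "Poly_Mapping.keys c \<subseteq> carrier T \<times> carrier M \<Longrightarrow> tensor_class M c \<in> carrier (bc M)"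
  by (auto simp: carrier_bc)

lemma bc_zero: "module R M \<Longrightarrow> \<zero>\<^bsub>bc M\<^esub> = tensor_class M 0"
  by (simp add: base_change_def Let_def tensor_class_alt)

lemma bc_add:
  assumes "module R M"
  shows "tensor_class M c \<oplus>\<^bsub>bc M\<^esub> tensor_class M d = tensor_class M (c + d)"
proof -
  have *: "(h + c) + (k + d) = (h + k) + (c + d)" "h + (c + d) = (h + c) + (0 + d)" for h k
    by simp_all
  have "tensor_class M c \<oplus>\<^bsub>bc M\<^esub> tensor_class M d = {x + y | x y. x \<in> tensor_class M c \<and> y \<in> tensor_class M d}"
    by (auto simp: base_change_def Let_def set_mult_def)
  also have "\<dots> = tensor_class M (c + d)"
  proof
    show "{x + y | x y. x \<in> tensor_class M c \<and> y \<in> tensor_class M d} \<subseteq> tensor_class M (c + d)"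
      unfolding tensor_class_alt using *(1) tensor_rel_add[OF assms] by blast
    show "tensor_class M (c + d) \<subseteq> {x + y | x y. x \<in> tensor_class M c \<and> y \<in> tensor_class M d}"
      unfolding tensor_class_alt using *(2) tensor_rel_zero[OF assms] by blast
  qed
  finally show ?thesis .
qed

text \<open>Well-definedness of maps induced on the tensor product: checking the three kinds of
  generators is enough, since \<open>frag_extend\<close> is additive. It is used with multiplication
  by a scalar in the first component and with a linear map in the second.\<close>

lemma tensor_rel_image:
  assumes M: "module R M" and N: "module R N"
    and cl: "\<And>t m. t \<in> carrier T \<Longrightarrow> m \<in> carrier M \<Longrightarrow> p t m \<in> carrier T \<and> q t m \<in> carrier N"
    and 1: "\<And>s t m. s \<in> carrier T \<Longrightarrow> t \<in> carrier T \<Longrightarrow> m \<in> carrier M \<Longrightarrow>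
      frag_of (p (s \<oplus>\<^bsub>T\<^esub> t) m, q (s \<oplus>\<^bsub>T\<^esub> t) m) - frag_of (p s m, q s m) - frag_of (p t m, q t m) \<in> tensor_rel N"
    and 2: "\<And>t m n. t \<in> carrier T \<Longrightarrow> m \<in> carrier M \<Longrightarrow> n \<in> carrier M \<Longrightarrow>
      frag_of (p t (m \<oplus>\<^bsub>M\<^esub> n), q t (m \<oplus>\<^bsub>M\<^esub> n)) - frag_of (p t m, q t m) - frag_of (p t n, q t n) \<in> tensor_rel N"
    and 3: "\<And>t r m. t \<in> carrier T \<Longrightarrow> r \<in> carrier R \<Longrightarrow> m \<in> carrier M \<Longrightarrow>
      frag_of (p (t \<otimes>\<^bsub>T\<^esub> f r) m, q (t \<otimes>\<^bsub>T\<^esub> f r) m) - frag_of (p t (r \<odot>\<^bsub>M\<^esub> m), q t (r \<odot>\<^bsub>M\<^esub> m)) \<in> tensor_rel N"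
    and c: "c \<in> tensor_rel M"
  shows "frag_extend (\<lambda>(t, m). frag_of (p t m, q t m)) c \<in> tensor_rel N"
proof -
  interpret M: module R M by fact
  let ?e = "frag_extend (\<lambda>(t, m). frag_of (p t m, q t m))"
  \<comment> \<open>The support is carried through the induction because the inverse in the free
    Abelian group is the negative only for elements supported in the carrier.\<close>
  have "?e c \<in> tensor_rel N \<and> Poly_Mapping.keys c \<subseteq> carrier T \<times> carrier M"
    using c unfolding tensor_rel_eq[of M]
  proof (induction c rule: generate.induct)
    case one
    then show ?case using tensor_rel_zero[OF N] by simp
  next
    case (incl h)
    then show ?case using tensor_rel_keys[OF M tensor_gens_incl]
      by (auto simp: tensor_gens_def frag_extend_diff 1 2 3)
  next
    case (inv h)
    note h = tensor_rel_keys[OF M tensor_gens_incl[OF inv]]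
    have "?e h \<in> tensor_rel N" using inv by (auto simp: tensor_gens_def frag_extend_diff 1 2 3)
    then show ?case using tensor_rel_minus[OF N] h by (simp add: frag_extend_minus)
  next
    case (eng h1 h2)
    then show ?case using tensor_rel_add[OF N] by (simp add: frag_extend_add keys_add_frag)
  qed
  then show ?thesis by blast
qed

lemma tensor_rel_gen1:
  "s \<in> carrier T \<Longrightarrow> t \<in> carrier T \<Longrightarrow> m \<in> carrier M \<Longrightarrow>
    frag_of (s \<oplus>\<^bsub>T\<^esub> t, m) - frag_of (s, m) - frag_of (t, m) \<in> tensor_rel M"
  and tensor_rel_gen2:
  "t \<in> carrier T \<Longrightarrow> m \<in> carrier M \<Longrightarrow> n \<in> carrier M \<Longrightarrow>
    frag_of (t, m \<oplus>\<^bsub>M\<^esub> n) - frag_of (t, m) - frag_of (t, n) \<in> tensor_rel M"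
  and tensor_rel_gen3:
  "t \<in> carrier T \<Longrightarrow> r \<in> carrier R \<Longrightarrow> m \<in> carrier M \<Longrightarrow>
    frag_of (t \<otimes>\<^bsub>T\<^esub> f r, m) - frag_of (t, r \<odot>\<^bsub>M\<^esub> m) \<in> tensor_rel M"
  by (rule tensor_gens_incl; unfold tensor_gens_def; blast)+

text \<open>The operations of \<open>base_change\<close> are unions over all representatives of a
  coset. When the relations are respected, every representative contributes the same coset, and the
  union collapses.\<close>

lemma tensor_class_extend:
  assumes "module R M" "module R N"
    and "\<And>c. c \<in> tensor_rel M \<Longrightarrow> frag_extend e c \<in> tensor_rel N"
  shows "(\<Union>c'\<in>tensor_class M c. tensor_class N (frag_extend e c')) = tensor_class N (frag_extend e c)"
proof -
  have "tensor_class N (frag_extend e c') = tensor_class N (frag_extend e c)"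
    if "c' \<in> tensor_class M c" for c'
    using that assms(3) unfolding tensor_class_eq_iff[OF assms(2)]
    by (auto simp: tensor_class_alt frag_extend_add)
  then show ?thesis using tensor_class_self[OF assms(1)] by blast
qed

lemma bc_smult:
  assumes "module R M" "t \<in> carrier T"
  shows "t \<odot>\<^bsub>bc M\<^esub> tensor_class M c = tensor_class M (frag_extend (\<lambda>(s, m). frag_of (t \<otimes>\<^bsub>T\<^esub> s, m)) c)"
proof -
  interpret M: module R M by fact
  have "frag_extend (\<lambda>(s, m). frag_of (t \<otimes>\<^bsub>T\<^esub> s, m)) c \<in> tensor_rel M" if "c \<in> tensor_rel M" for c
    by (rule tensor_rel_image[OF assms(1,1) _ _ _ _ that])
      (use assms(2) in \<open>auto simp: T.r_distr tensor_rel_gen1 tensor_rel_gen2 tensor_rel_gen3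
        simp flip: T.m_assoc\<close>)
  from tensor_class_extend[OF assms(1,1) this]
  show ?thesis by (simp add: base_change_def Let_def tensor_class_def)
qed

lemma base_change_map_class:
  assumes "module R M" "module R N" "g \<in> mod_hom R M N"
  shows "base_change_map R T f N g (tensor_class M c) =
    tensor_class N (frag_extend (\<lambda>(t, m). frag_of (t, g m)) c)"
proof -
  interpret M: module R M by fact
  note g = mod_hom_closed[OF assms(3)]
  have "frag_extend (\<lambda>(t, m). frag_of (t, g m)) c \<in> tensor_rel N" if "c \<in> tensor_rel M" for c
    by (rule tensor_rel_image[OF assms(1,2) _ _ _ _ that])
      (auto simp: g tensor_rel_gen1 tensor_rel_gen2 tensor_rel_gen3
        mod_hom_add[OF assms(3)] mod_hom_smult[OF assms(3)])
  from tensor_class_extend[OF assms(1,2) this]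
  show ?thesis by (simp add: base_change_map_def tensor_class_def)
qed

lemma tens_closed [simp]: "t \<in> carrier T \<Longrightarrow> m \<in> carrier M \<Longrightarrow> tens M t m \<in> carrier (bc M)"
  by (auto simp: tens_def carrier_bc)

lemma bc_add_closed:
  assumes "module R M" "x \<in> carrier (bc M)" "y \<in> carrier (bc M)"
  shows "x \<oplus>\<^bsub>bc M\<^esub> y \<in> carrier (bc M)"
proof -
  obtain c d where "x = tensor_class M c" "Poly_Mapping.keys c \<subseteq> carrier T \<times> carrier M"
    "y = tensor_class M d" "Poly_Mapping.keys d \<subseteq> carrier T \<times> carrier M"
    using assms(2,3) unfolding carrier_bc by auto
  then show ?thesis by (simp add: bc_add[OF assms(1)] tensor_class_closed keys_add_frag)
qed

lemma frag_smult_keys: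
  "t \<in> carrier T \<Longrightarrow> Poly_Mapping.keys c \<subseteq> carrier T \<times> carrier M \<Longrightarrow>
    Poly_Mapping.keys (frag_extend (\<lambda>(s, m). frag_of (t \<otimes>\<^bsub>T\<^esub> s, m)) c) \<subseteq> carrier T \<times> carrier M"
  using keys_frag_extend[of "\<lambda>(s, m). frag_of (t \<otimes>\<^bsub>T\<^esub> s, m)" c] by fastforce

lemma bc_smult_closed:
  assumes "module R M" "t \<in> carrier T" "x \<in> carrier (bc M)"
  shows "t \<odot>\<^bsub>bc M\<^esub> x \<in> carrier (bc M)"
proof -
  from assms(3) obtain c where "x = tensor_class M c" "Poly_Mapping.keys c \<subseteq> carrier T \<times> carrier M"
    unfolding carrier_bc by auto
  then show ?thesis
    by (simp add: bc_smult[OF assms(1,2)] tensor_class_closed frag_smult_keys[OF assms(2)])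
qed

lemma abelian_group_bc:
  assumes M: "module R M"
  shows "abelian_group (bc M)"
proof (rule abelian_groupI)
  fix x assume "x \<in> carrier (bc M)"
  then obtain c where c: "x = tensor_class M c" "Poly_Mapping.keys c \<subseteq> carrier T \<times> carrier M"
    unfolding carrier_bc by auto
  then have "tensor_class M (- c) \<in> carrier (bc M)" unfolding carrier_bc by auto
  moreover have "tensor_class M (- c) \<oplus>\<^bsub>bc M\<^esub> x = \<zero>\<^bsub>bc M\<^esub>"
    using c by (simp add: bc_add[OF M] bc_zero[OF M])
  ultimately show "\<exists>y\<in>carrier (bc M). y \<oplus>\<^bsub>bc M\<^esub> x = \<zero>\<^bsub>bc M\<^esub>" by blast
qed (use bc_add_closed[OF M] in \<open>auto simp: carrier_bc bc_add[OF M] bc_zero[OF M] add_ac\<close>)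

lemma tens_add_left:
  "module R M \<Longrightarrow> s \<in> carrier T \<Longrightarrow> t \<in> carrier T \<Longrightarrow> m \<in> carrier M \<Longrightarrow>
    tens M (s \<oplus>\<^bsub>T\<^esub> t) m = tens M s m \<oplus>\<^bsub>bc M\<^esub> tens M t m"
  using tensor_rel_gen1 by (simp add: tens_def bc_add tensor_class_eq_iff diff_diff_eq)

lemma tens_add_right:
  "module R M \<Longrightarrow> t \<in> carrier T \<Longrightarrow> m \<in> carrier M \<Longrightarrow> n \<in> carrier M \<Longrightarrow>
    tens M t (m \<oplus>\<^bsub>M\<^esub> n) = tens M t m \<oplus>\<^bsub>bc M\<^esub> tens M t n"
  using tensor_rel_gen2 by (simp add: tens_def bc_add tensor_class_eq_iff diff_diff_eq)

lemma tens_balanced: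
  "module R M \<Longrightarrow> t \<in> carrier T \<Longrightarrow> r \<in> carrier R \<Longrightarrow> m \<in> carrier M \<Longrightarrow>
    tens M t (r \<odot>\<^bsub>M\<^esub> m) = tens M (t \<otimes>\<^bsub>T\<^esub> f r) m"
  using tensor_rel_gen3 by (metis tens_def tensor_class_eq_iff)

lemma smult_tens:
  "module R M \<Longrightarrow> s \<in> carrier T \<Longrightarrow> s \<odot>\<^bsub>bc M\<^esub> tens M t m = tens M (s \<otimes>\<^bsub>T\<^esub> t) m"
  by (simp add: tens_def bc_smult)

lemma tens_zero_left:
  assumes "module R M" "m \<in> carrier M"
  shows "tens M \<zero>\<^bsub>T\<^esub> m = \<zero>\<^bsub>bc M\<^esub>"
proof -
  interpret B: abelian_group "bc M" by (rule abelian_group_bc[OF assms(1)])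
  have "tens M \<zero>\<^bsub>T\<^esub> m = tens M \<zero>\<^bsub>T\<^esub> m \<oplus>\<^bsub>bc M\<^esub> tens M \<zero>\<^bsub>T\<^esub> m"
    using tens_add_left[OF assms(1) T.zero_closed T.zero_closed assms(2)] by simp
  then show ?thesis using assms by (metis B.add.r_cancel_one T.zero_closed tens_closed)
qed

text \<open>Elementary tensors generate the base change already under addition, since the negative
  of t \<otimes> m is the elementary tensor (- t) \<otimes> m.\<close>

lemma bc_induct [consumes 2, case_names zero tens add]:
  assumes M: "module R M" and x: "x \<in> carrier (bc M)"
    and zero: "P \<zero>\<^bsub>bc M\<^esub>"
    and tens: "\<And>t m. t \<in> carrier T \<Longrightarrow> m \<in> carrier M \<Longrightarrow> P (tens M t m)"
    and add: "\<And>x y. x \<in> carrier (bc M) \<Longrightarrow> y \<in> carrier (bc M) \<Longrightarrow> P x \<Longrightarrow> P y \<Longrightarrow> P (x \<oplus>\<^bsub>bc M\<^esub> y)"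
  shows "P x"
proof -
  interpret B: abelian_group "bc M" by (rule abelian_group_bc[OF M])
  have cl: "tensor_class M c \<in> carrier (bc M)" "tensor_class M (- c) \<in> carrier (bc M)"
    if "Poly_Mapping.keys c \<subseteq> carrier T \<times> carrier M" for c
    using that unfolding carrier_bc by auto
  obtain c where c: "x = tensor_class M c" "Poly_Mapping.keys c \<subseteq> carrier T \<times> carrier M"
    using x unfolding carrier_bc by auto
  \<comment> \<open>Induction over the free Abelian group proceeds by differences, while
    \<open>P\<close> is closed only under sums; the claim is therefore proved for c and - c
    together.\<close>
  have "P (tensor_class M c) \<and> P (tensor_class M (- c))"
  proof (rule free_Abelian_group_induct[OF c(2)])
    show "P (tensor_class M 0) \<and> P (tensor_class M (- 0))"
      using zero by (simp add: bc_zero[OF M])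
  next
    fix c d
    assume 2: "Poly_Mapping.keys c \<subseteq> carrier T \<times> carrier M" "Poly_Mapping.keys d \<subseteq> carrier T \<times> carrier M"
      and "P (tensor_class M c) \<and> P (tensor_class M (- c))" "P (tensor_class M d) \<and> P (tensor_class M (- d))"
    then show "P (tensor_class M (c - d)) \<and> P (tensor_class M (- (c - d)))"
      using add[OF cl(1)[OF 2(1)] cl(2)[OF 2(2)]] add[OF cl(1)[OF 2(2)] cl(2)[OF 2(1)]]
      by (simp add: bc_add[OF M])
  next
    fix a assume 3: "a \<in> carrier T \<times> carrier M"
    obtain t m where a: "a = (t, m)" "t \<in> carrier T" "m \<in> carrier M" using 3 by auto
    have "tens M t m \<oplus>\<^bsub>bc M\<^esub> tens M (\<ominus>\<^bsub>T\<^esub> t) m = \<zero>\<^bsub>bc M\<^esub>"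
      using a tens_add_left[OF M, of t "\<ominus>\<^bsub>T\<^esub> t" m] by (simp add: T.r_neg tens_zero_left[OF M])
    moreover have "tens M t m \<oplus>\<^bsub>bc M\<^esub> tensor_class M (- frag_of (t, m)) = \<zero>\<^bsub>bc M\<^esub>"
      by (simp add: tens_def bc_add[OF M] bc_zero[OF M])
    ultimately have "tensor_class M (- frag_of (t, m)) = tens M (\<ominus>\<^bsub>T\<^esub> t) m"
      using a cl(2)[of "frag_of (t, m)"] by (metis B.add.l_cancel T.a_inv_closed tens_closed
          keys_frag_of SigmaI empty_subsetI insert_subset)
    then show "P (tensor_class M (frag_of a)) \<and> P (tensor_class M (- frag_of a))"
      using a tens[of t m] tens[of "\<ominus>\<^bsub>T\<^esub> t" m] by (simp add: tens_def)
  qed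
  then show ?thesis using c by simp
qed

lemma bc_additive_eqI:
  assumes "module R M"
    and "h \<zero>\<^bsub>bc M\<^esub> = k \<zero>\<^bsub>bc M\<^esub>"
    and "\<And>x y. x \<in> carrier (bc M) \<Longrightarrow> y \<in> carrier (bc M) \<Longrightarrow> h (x \<oplus>\<^bsub>bc M\<^esub> y) = h x \<oplus>\<^bsub>Y\<^esub> h y"
    and "\<And>x y. x \<in> carrier (bc M) \<Longrightarrow> y \<in> carrier (bc M) \<Longrightarrow> k (x \<oplus>\<^bsub>bc M\<^esub> y) = k x \<oplus>\<^bsub>Y\<^esub> k y"
    and "\<And>t m. t \<in> carrier T \<Longrightarrow> m \<in> carrier M \<Longrightarrow> h (tens M t m) = k (tens M t m)"
    and "x \<in> carrier (bc M)"
  shows "h x = k x"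
  using assms(1,6) by (induction rule: bc_induct) (auto simp: assms)

lemma bc_smult_add:
  assumes "module R M" "t \<in> carrier T" "x \<in> carrier (bc M)" "y \<in> carrier (bc M)"
  shows "t \<odot>\<^bsub>bc M\<^esub> (x \<oplus>\<^bsub>bc M\<^esub> y) = t \<odot>\<^bsub>bc M\<^esub> x \<oplus>\<^bsub>bc M\<^esub> t \<odot>\<^bsub>bc M\<^esub> y"
  using assms unfolding carrier_bc by (auto simp: bc_add bc_smult frag_extend_add)

lemma bc_smult_zero: "module R M \<Longrightarrow> t \<in> carrier T \<Longrightarrow> t \<odot>\<^bsub>bc M\<^esub> \<zero>\<^bsub>bc M\<^esub> = \<zero>\<^bsub>bc M\<^esub>"
  by (simp add: bc_zero bc_smult)

lemma module_bc:
  assumes M: "module R M"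
  shows "module T (bc M)"
proof -
  interpret B: abelian_group "bc M" by (rule abelian_group_bc[OF M])
  note simps = bc_smult_add[OF M] bc_smult_zero[OF M] bc_smult_closed[OF M] smult_tens[OF M]
  show ?thesis
  proof (rule moduleI)
    fix a b x assume ab: "a \<in> carrier T" "b \<in> carrier T" and x: "x \<in> carrier (bc M)"
    show "(a \<oplus>\<^bsub>T\<^esub> b) \<odot>\<^bsub>bc M\<^esub> x = a \<odot>\<^bsub>bc M\<^esub> x \<oplus>\<^bsub>bc M\<^esub> b \<odot>\<^bsub>bc M\<^esub> x"
      by (rule bc_additive_eqI[OF M, where Y = "bc M"])
        (use ab x in \<open>auto simp: simps B.a_ac T.l_distr tens_add_left[OF M]\<close>)
    show "(a \<otimes>\<^bsub>T\<^esub> b) \<odot>\<^bsub>bc M\<^esub> x = a \<odot>\<^bsub>bc M\<^esub> (b \<odot>\<^bsub>bc M\<^esub> x)"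
      by (rule bc_additive_eqI[OF M, where Y = "bc M"])
        (use ab x in \<open>auto simp: simps T.m_assoc\<close>)
  next
    fix x assume x: "x \<in> carrier (bc M)"
    show "\<one>\<^bsub>T\<^esub> \<odot>\<^bsub>bc M\<^esub> x = x"
      by (rule bc_additive_eqI[OF M, where Y = "bc M"]) (use x in \<open>auto simp: simps\<close>)
  qed (use B.abelian_group_axioms T.is_cring in \<open>auto simp: simps\<close>)
qed

lemma base_change_map_tens:
  assumes "module R M" "module R N" "g \<in> mod_hom R M N"
  shows "base_change_map R T f N g (tens M t m) = tens N t (g m)"
  using base_change_map_class[OF assms] by (simp add: tens_def)

lemma base_change_map_hom:
  assumes "module R M" "module R N" "g \<in> mod_hom R M N"
  shows "base_change_map R T f N g \<in> mod_hom T (bc M) (bc N)"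
proof -
  let ?g = "base_change_map R T f N g"
  interpret M: module T "bc M" by (rule module_bc[OF assms(1)])
  interpret N: module T "bc N" by (rule module_bc[OF assms(2)])
  have g_zero: "?g \<zero>\<^bsub>bc M\<^esub> = \<zero>\<^bsub>bc N\<^esub>"
    by (simp add: bc_zero assms base_change_map_class)
  have plus: "?g (x \<oplus>\<^bsub>bc M\<^esub> y) = ?g x \<oplus>\<^bsub>bc N\<^esub> ?g y" if "x \<in> carrier (bc M)" "y \<in> carrier (bc M)" for x y
    using that by (auto simp: carrier_bc bc_add assms base_change_map_class frag_extend_add)
  have closed: "?g x \<in> carrier (bc N)" if "x \<in> carrier (bc M)" for x
    using assms(1) that
    by (induction rule: bc_induct)
      (auto simp: g_zero plus base_change_map_tens[OF assms] mod_hom_closed[OF assms(3)])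
  show ?thesis
  proof (rule mod_homI)
    fix r x assume r: "r \<in> carrier T" and x: "x \<in> carrier (bc M)"
    show "?g (r \<odot>\<^bsub>bc M\<^esub> x) = r \<odot>\<^bsub>bc N\<^esub> ?g x"
      using assms(1) x
    proof (induction rule: bc_induct)
      case zero
      then show ?case using r by (simp add: g_zero)
    next
      case (tens t m)
      then show ?case
        using r by (simp add: base_change_map_tens[OF assms] smult_tens assms(1,2))
    next
      case (add x y)
      then show ?case
        using r by (simp add: plus closed M.smult_r_distr N.smult_r_distr)
    qed
  qed (auto simp: plus closed)
qed

text \<open>\<open>k\<close> has to agree with the composite on the carrier only. This lets
  different factorizations of one map be compared through a common, simplified
  \<open>k\<close>.\<close>

lemma base_change_map_comp:
  assumes "module R A" "module R B" "module R C" "g \<in> mod_hom R A B" "h \<in> mod_hom R B C"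
    and x: "x \<in> carrier (bc A)"
    and k: "\<And>a. a \<in> carrier A \<Longrightarrow> k a = h (g a)"
  shows "base_change_map R T f C h (base_change_map R T f B g x) = base_change_map R T f C k x"
proof -
  have K: "k \<in> mod_hom R A C"
    using mod_hom_comp[OF assms(4,5)] assms(1)[THEN module.smult_closed]
      abelian_monoid.a_closed[OF abelian_group.axioms(1)[OF module.axioms(2)[OF assms(1)]]]
    by (simp add: mod_hom_def Pi_iff k)
  note G' = base_change_map_hom[OF assms(1,2,4)]
  note H' = base_change_map_hom[OF assms(2,3,5)]
  note K' = base_change_map_hom[OF assms(1,3) K]
  note mods = assms(1-3)[THEN module_bc]
  show ?thesis
    using assms(1) x
  proof (induction rule: bc_induct)
    case zero
    then show ?case
      by (simp add: mod_hom_zero[OF mods(1,2) G'] mod_hom_zero[OF mods(2,3) H'] mod_hom_zero[OF mods(1,3) K'])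
  next
    case (tens t m)
    then show ?case
      by (simp add: base_change_map_tens[OF assms(1,2,4)] base_change_map_tens[OF assms(2,3,5)]
          base_change_map_tens[OF assms(1,3) K] k)
  next
    case (add x y)
    then show ?case
      by (simp add: mod_hom_add[OF G'] mod_hom_add[OF H'] mod_hom_add[OF K'] mod_hom_closed[OF G'])
  qed
qed

lemma base_change_map_id:
  assumes A: "module R A" and x: "x \<in> carrier (bc A)" and k: "\<And>a. a \<in> carrier A \<Longrightarrow> k a = a"
  shows "base_change_map R T f A k x = x"
proof -
  have k': "k \<in> mod_hom R A A"
    using k abelian_monoid.a_closed[OF abelian_group.axioms(1)[OF module.axioms(2)[OF A]]]
      module.smult_closed[OF A] by (intro mod_homI) simp_all
  note K = base_change_map_hom[OF A A k'] and mA = module_bc[OF A]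
  show ?thesis
    using A x
  proof (induction rule: bc_induct)
    case zero
    then show ?case by (rule mod_hom_zero[OF mA mA K])
  next
    case (tens t m)
    then show ?case by (simp add: base_change_map_tens[OF A A k'] k)
  next
    case (add x y)
    then show ?case by (simp add: mod_hom_add[OF K])
  qed
qed

end

section \<open>Transporting exactness\<close>

text \<open>Exactness at \<open>B\<close> depends on \<open>C\<close> only through the elements that
  are sent to zero, so an injection preserving zero is enough there; the bijections on
  \<open>A\<close> and \<open>B\<close> carry image and kernel over.\<close>

lemma exact_at_cong_bij:
  assumes "bij_betw \<alpha> (carrier A) (carrier A')" "bij_betw \<beta> (carrier B) (carrier B')"
    and "inj_on \<gamma> (carrier C)" "\<gamma> \<zero>\<^bsub>C\<^esub> = \<zero>\<^bsub>C'\<^esub>" "\<zero>\<^bsub>C\<^esub> \<in> carrier C"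
    and g: "\<And>x. x \<in> carrier A \<Longrightarrow> g x \<in> carrier B" and h: "\<And>y. y \<in> carrier B \<Longrightarrow> h y \<in> carrier C"
    and g': "\<And>x. x \<in> carrier A \<Longrightarrow> g' (\<alpha> x) = \<beta> (g x)"
    and h': "\<And>y. y \<in> carrier B \<Longrightarrow> h' (\<beta> y) = \<gamma> (h y)"
  shows "exact_at A g B h C \<longleftrightarrow> exact_at A' g' B' h' C'"
proof -
  have A': "carrier A' = \<alpha> ` carrier A" and B': "carrier B' = \<beta> ` carrier B"
    using assms(1,2) by (auto simp: bij_betw_def)
  have ker: "{y \<in> carrier B'. h' y = \<zero>\<^bsub>C'\<^esub>} = \<beta> ` {y \<in> carrier B. h y = \<zero>\<^bsub>C\<^esub>}"
  proof -
    have "h' (\<beta> y) = \<zero>\<^bsub>C'\<^esub> \<longleftrightarrow> h y = \<zero>\<^bsub>C\<^esub>" if "y \<in> carrier B" for y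
      using inj_on_eq_iff[OF assms(3) h[OF that] assms(5)] h'[OF that] assms(4) by simp
    then show ?thesis unfolding B' by blast
  qed
  have img: "g' ` carrier A' = \<beta> ` (g ` carrier A)"
    unfolding A' image_image using g' by (intro image_cong) auto
  have "inj_on \<beta> (carrier B)" using assms(2) by (simp add: bij_betw_def)
  then show ?thesis
    unfolding exact_at_def ker img using g
    by (intro inj_on_image_eq_iff[symmetric]) auto
qed

text \<open>Transport of structure along an injection into another type. The operations are computed
  in \<open>A\<close> after applying \<open>inv_into\<close>, so \<open>\<kappa>\<close> becomes an
  isomorphism onto the copy.\<close>

definition copy_module :: "('a \<Rightarrow> 'b) \<Rightarrow> ('r, 'a, 'x) module_scheme \<Rightarrow> ('r, 'b) module"
  where "copy_module \<kappa> A =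
    \<lparr>carrier = \<kappa> ` carrier A, monoid.mult = undefined, monoid.one = undefined,
     ring.zero = \<kappa> \<zero>\<^bsub>A\<^esub>,
     ring.add = (\<lambda>u v. \<kappa> (inv_into (carrier A) \<kappa> u \<oplus>\<^bsub>A\<^esub> inv_into (carrier A) \<kappa> v)),
     smult = (\<lambda>r u. \<kappa> (r \<odot>\<^bsub>A\<^esub> inv_into (carrier A) \<kappa> u))\<rparr>"

lemma copy_module_simps:
  "carrier (copy_module \<kappa> A) = \<kappa> ` carrier A"
  "\<zero>\<^bsub>copy_module \<kappa> A\<^esub> = \<kappa> \<zero>\<^bsub>A\<^esub>"
  "inj_on \<kappa> (carrier A) \<Longrightarrow> x \<in> carrier A \<Longrightarrow> y \<in> carrier A \<Longrightarrow>
     \<kappa> x \<oplus>\<^bsub>copy_module \<kappa> A\<^esub> \<kappa> y = \<kappa> (x \<oplus>\<^bsub>A\<^esub> y)"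
  "inj_on \<kappa> (carrier A) \<Longrightarrow> x \<in> carrier A \<Longrightarrow> r \<odot>\<^bsub>copy_module \<kappa> A\<^esub> \<kappa> x = \<kappa> (r \<odot>\<^bsub>A\<^esub> x)"
  by (simp_all add: copy_module_def)

lemma module_copy_module:
  assumes "module R A" "inj_on \<kappa> (carrier A)"
  shows "module R (copy_module \<kappa> A)"
proof -
  interpret A: module R A by fact
  note simps = copy_module_simps(1,2) copy_module_simps(3,4)[OF assms(2)]
  show ?thesis
  proof (rule moduleI)
    show "abelian_group (copy_module \<kappa> A)"
    proof (rule abelian_groupI)
      fix x assume "x \<in> carrier (copy_module \<kappa> A)"
      then obtain a where a: "x = \<kappa> a" "a \<in> carrier A" by (auto simp: simps)
      then have "\<kappa> (\<ominus>\<^bsub>A\<^esub> a) \<oplus>\<^bsub>copy_module \<kappa> A\<^esub> x = \<zero>\<^bsub>copy_module \<kappa> A\<^esub>"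
        by (simp add: simps A.l_neg)
      then show "\<exists>y\<in>carrier (copy_module \<kappa> A). y \<oplus>\<^bsub>copy_module \<kappa> A\<^esub> x = \<zero>\<^bsub>copy_module \<kappa> A\<^esub>"
        using a by (auto simp: copy_module_simps(1))
    qed (auto simp: simps A.a_ac)
  qed (auto simp: simps A.R.is_cring A.smult_l_distr A.smult_r_distr A.smult_assoc1)
qed

lemma copy_module_hom:
  assumes "module R A" "inj_on \<kappa> (carrier A)"
  shows "\<kappa> \<in> mod_hom R A (copy_module \<kappa> A)"
    and "inv_into (carrier A) \<kappa> \<in> mod_hom R (copy_module \<kappa> A) A"
proof -
  interpret A: module R A by fact
  note simps = copy_module_simps(1,2) copy_module_simps(3,4)[OF assms(2)]
  show "\<kappa> \<in> mod_hom R A (copy_module \<kappa> A)" by (rule mod_homI) (auto simp: simps)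
  show "inv_into (carrier A) \<kappa> \<in> mod_hom R (copy_module \<kappa> A) A"
    using assms(2) by (intro mod_homI) (auto simp: simps)
qed

section \<open>Finitely generated modules and their embedding into sets of coefficient
  vectors\<close>

lemma fin_gen_lincomb:
  assumes "module R M" "fin_gen_module R M"
  shows "\<exists>n m. (\<forall>i<n. m i \<in> carrier M) \<and>
    (\<forall>x\<in>carrier M. \<exists>v. (\<forall>i<n. v i \<in> carrier R) \<and> x = lincomb M n v m)"
proof -
  interpret M: module R M by fact
  obtain S where S: "finite S" "S \<subseteq> carrier M"
    "\<And>x. x \<in> carrier M \<Longrightarrow> \<exists>c\<in>S \<rightarrow> carrier R. x = (\<Oplus>\<^bsub>M\<^esub>s\<in>S. c s \<odot>\<^bsub>M\<^esub> s)"
    using assms(2) unfolding fin_gen_module_def by blast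
  obtain m where m: "bij_betw m {0..<card S} S"
    using ex_bij_betw_nat_finite[OF S(1)] by blast
  have sum: "lincomb M n v m = (\<Oplus>\<^bsub>M\<^esub>i\<in>{0..<n}. v i \<odot>\<^bsub>M\<^esub> m i)"
    if "\<forall>i<n. v i \<in> carrier R" "\<forall>i<n. m i \<in> carrier M" for n v
    using that by (induction n) (auto simp: atLeast0_lessThan_Suc Pi_def M.a_comm)
  have mS: "m i \<in> S" if "i < card S" for i
    using m that by (auto simp: bij_betw_def)
  show ?thesis
  proof (intro exI[of _ "card S"] exI[of _ m] conjI allI impI ballI)
    show "m i \<in> carrier M" if "i < card S" for i
      using mS[OF that] S by auto
    fix x assume "x \<in> carrier M"
    then obtain c where c: "c \<in> S \<rightarrow> carrier R" "x = (\<Oplus>\<^bsub>M\<^esub>s\<in>S. c s \<odot>\<^bsub>M\<^esub> s)"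
      using S(3) by blast
    have "x = (\<Oplus>\<^bsub>M\<^esub>s\<in>m ` {0..<card S}. c s \<odot>\<^bsub>M\<^esub> s)"
      using c(2) m by (simp add: bij_betw_def)
    also have "\<dots> = (\<Oplus>\<^bsub>M\<^esub>i\<in>{0..<card S}. c (m i) \<odot>\<^bsub>M\<^esub> m i)"
      using m c(1) S(2) by (intro M.finsum_reindex) (auto simp: bij_betw_def)
    also have "\<dots> = lincomb M (card S) (\<lambda>i. c (m i)) m"
      using c(1) S(2) mS by (intro sum[symmetric]) auto
    finally show "\<exists>v. (\<forall>i<card S. v i \<in> carrier R) \<and> x = lincomb M (card S) v m"
      using funcset_mem[OF c(1) mS] by (intro exI[of _ "\<lambda>i. c (m i)"] conjI allI impI)
  qed
qed

text \<open>A module generated by \<open>n\<close> elements embeds into a type of sets of coefficient vectors: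
  map an element to the set of all its representations. Doing this for all coordinates at once
  (via \<^const>\<open>prod_encode\<close>) yields one embedding for all powers of the module.\<close>

lemma fin_gen_embedding:
  fixes R :: "('r, 'p) ring_scheme" and M :: "('r, 'm, 'y) module_scheme"
  assumes "module R M" "fin_gen_module R M"
  obtains \<kappa> :: "(nat \<Rightarrow> 'm) \<Rightarrow> (nat \<Rightarrow> 'r) set" where "inj_on \<kappa> {x. \<forall>k. x k \<in> carrier M}"
proof -
  obtain n m where m: "\<And>i. i < n \<Longrightarrow> m i \<in> carrier M"
    "\<And>x. x \<in> carrier M \<Longrightarrow> \<exists>v. (\<forall>i<n. v i \<in> carrier R) \<and> x = lincomb M n v m"
    using fin_gen_lincomb[OF assms] by blast
  define \<kappa> :: "(nat \<Rightarrow> 'm) \<Rightarrow> (nat \<Rightarrow> 'r) set"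
    where "\<kappa> x = {v. \<forall>k. x k = lincomb M n (\<lambda>i. v (prod_encode (k, i))) m}" for x
  \<comment> \<open>Injectivity needs only that every set of representations is nonempty: a common
    member of two such sets determines both elements.\<close>
  have ne: "\<exists>v. v \<in> \<kappa> x" if x: "\<forall>k. x k \<in> carrier M" for x
  proof -
    have "\<forall>k. \<exists>w. x k = lincomb M n w m" using m(2) x by blast
    from choice[OF this] obtain w where w: "\<And>k. x k = lincomb M n (w k) m" by blast
    have "(\<lambda>j. case prod_decode j of (k, i) \<Rightarrow> w k i) \<in> \<kappa> x"
      by (simp add: \<kappa>_def flip: w)
    then show ?thesis by (simp only: ex_in_conv) blast
  qed
  have "inj_on \<kappa> {x. \<forall>k. x k \<in> carrier M}"
  proof (rule inj_onI)
    fix x y assume xy: "x \<in> {x. \<forall>k. x k \<in> carrier M}" "\<kappa> x = \<kappa> y"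
    from xy(1) have "\<forall>k. x k \<in> carrier M" by simp
    from ne[OF this] obtain v where v: "v \<in> \<kappa> x" by (rule exE)
    moreover have "v \<in> \<kappa> y" using v xy(2) by simp
    ultimately show "x = y" unfolding \<kappa>_def by (intro ext) simp
  qed
  then show thesis by (rule that)
qed

section \<open>Universal property of the base change, and its spanning tensors\<close>

context ring_change
begin

text \<open>Balanced biadditive maps factor through the tensor product. Only the additive group of
  the target enters; linearity over T is checked where the lemma is applied.\<close>

lemma bc_universal:
  assumes M: "module R M" and Y: "abelian_group Y"
    and cl: "\<And>t m. t \<in> carrier T \<Longrightarrow> m \<in> carrier M \<Longrightarrow> \<beta> t m \<in> carrier Y"
    and 1: "\<And>s t m. s \<in> carrier T \<Longrightarrow> t \<in> carrier T \<Longrightarrow> m \<in> carrier M \<Longrightarrow>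
      \<beta> (s \<oplus>\<^bsub>T\<^esub> t) m = \<beta> s m \<oplus>\<^bsub>Y\<^esub> \<beta> t m"
    and 2: "\<And>t m n. t \<in> carrier T \<Longrightarrow> m \<in> carrier M \<Longrightarrow> n \<in> carrier M \<Longrightarrow>
      \<beta> t (m \<oplus>\<^bsub>M\<^esub> n) = \<beta> t m \<oplus>\<^bsub>Y\<^esub> \<beta> t n"
    and 3: "\<And>t r m. t \<in> carrier T \<Longrightarrow> r \<in> carrier R \<Longrightarrow> m \<in> carrier M \<Longrightarrow>
      \<beta> (t \<otimes>\<^bsub>T\<^esub> f r) m = \<beta> t (r \<odot>\<^bsub>M\<^esub> m)"
  obtains \<phi> where "\<And>x. x \<in> carrier (bc M) \<Longrightarrow> \<phi> x \<in> carrier Y"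
    and "\<And>x y. x \<in> carrier (bc M) \<Longrightarrow> y \<in> carrier (bc M) \<Longrightarrow> \<phi> (x \<oplus>\<^bsub>bc M\<^esub> y) = \<phi> x \<oplus>\<^bsub>Y\<^esub> \<phi> y"
    and "\<And>t m. t \<in> carrier T \<Longrightarrow> m \<in> carrier M \<Longrightarrow> \<phi> (tens M t m) = \<beta> t m"
proof -
  interpret M: module R M by fact
  interpret Y: abelian_group Y by fact
  have "(\<lambda>(t, m). \<beta> t m) ` (carrier T \<times> carrier M) \<subseteq> carrier (add_monoid Y)"
    using cl by auto
  then have "\<exists>h. h \<in> hom (tensor_group M) (add_monoid Y) \<and>
      (\<forall>x\<in>carrier T \<times> carrier M. h (frag_of x) = (\<lambda>(t, m). \<beta> t m) x)"
    by (rule comm_group.free_Abelian_group_universal[OF Y.a_comm_group]) (intro exI conjI ballI)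
  then obtain h where h: "h \<in> hom (tensor_group M) (add_monoid Y)"
    "\<And>t m. t \<in> carrier T \<Longrightarrow> m \<in> carrier M \<Longrightarrow> h (frag_of (t, m)) = \<beta> t m"
    by auto
  let ?K = "\<lambda>c. Poly_Mapping.keys c \<subseteq> carrier T \<times> carrier M"
  have h_cl: "h c \<in> carrier Y" if "?K c" for c
    using hom_in_carrier[OF h(1)] that by simp
  have h_add: "h (c + d) = h c \<oplus>\<^bsub>Y\<^esub> h d" if "?K c" "?K d" for c d
    using hom_mult[OF h(1), of c d] that by simp
  have h_zero: "h 0 = \<zero>\<^bsub>Y\<^esub>"
    using h_add[of 0 0] h_cl[of 0] by simp
  have h_neg: "h (- c) = \<ominus>\<^bsub>Y\<^esub> h c" if "?K c" for c
    using h_add[of "- c" c] h_cl[of c] h_cl[of "- c"] that h_zero by (simp add: Y.minus_equality)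
  have h_diff: "h (c - d) = h c \<ominus>\<^bsub>Y\<^esub> h d" if "?K c" "?K d" for c d
    using h_add[of c "- d"] h_neg[of d] that by (simp add: a_minus_def)
  have h_of: "h (frag_of (t, m)) = \<beta> t m" if "t \<in> carrier T" "m \<in> carrier M" for t m
    using h(2) that by simp
  \<comment> \<open>The image of a relation such as (s + t, m) - (s, m) - (t, m), sorted by
    associativity and commutativity, is a sum of this shape.\<close>
  have cancel: "a \<oplus>\<^bsub>Y\<^esub> (b \<oplus>\<^bsub>Y\<^esub> (\<ominus>\<^bsub>Y\<^esub> a \<oplus>\<^bsub>Y\<^esub> \<ominus>\<^bsub>Y\<^esub> b)) = \<zero>\<^bsub>Y\<^esub>"
    if "a \<in> carrier Y" "b \<in> carrier Y" for a b
    using Y.r_neg[of "a \<oplus>\<^bsub>Y\<^esub> b"] that by (simp add: Y.minus_add Y.a_assoc)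
  have ker: "h c = \<zero>\<^bsub>Y\<^esub> \<and> ?K c" if "c \<in> tensor_rel M" for c
    using that unfolding tensor_rel_eq
  proof (induction c rule: generate.induct)
    case one
    then show ?case using h_zero by simp
  next
    case (incl c)
    then show ?case
      using tensor_rel_keys[OF M tensor_gens_incl[OF incl]]
      by (auto simp: tensor_gens_def h_diff h_of cl 1 2 3 keys_diff_frag a_minus_def Y.minus_add Y.a_ac Y.r_neg cancel)
  next
    case (inv c)
    note K = tensor_rel_keys[OF M tensor_gens_incl[OF inv]]
    have "h c = \<zero>\<^bsub>Y\<^esub>" using inv
      by (auto simp: tensor_gens_def h_diff h_of cl 1 2 3 keys_diff_frag a_minus_def Y.minus_add Y.a_ac Y.r_neg cancel)
    then show ?case using K by (simp add: h_neg)
  next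
    case (eng c d)
    then show ?case by (simp add: h_add keys_add_frag)
  qed
  \<comment> \<open>\<open>h\<close> vanishes on the relations and so is constant on cosets; any
    representative supported in the carrier defines the value.\<close>
  define \<phi> where "\<phi> x = h (SOME c. ?K c \<and> x = tensor_class M c)" for x
  have \<phi>: "\<phi> (tensor_class M c) = h c" if "?K c" for c
  proof -
    define d where "d = (SOME d. ?K d \<and> tensor_class M c = tensor_class M d)"
    have d: "?K d \<and> tensor_class M c = tensor_class M d"
      unfolding d_def by (rule someI[of _ c]) (simp add: that)
    then have "h (c - d) = \<zero>\<^bsub>Y\<^esub>" using ker[of "c - d"] by (simp add: tensor_class_eq_iff[OF M])
    then have "h c = h d" using h_add[of "c - d" d] keys_diff_frag[OF that, of d] d h_cl[of d] by simp
    then show ?thesis unfolding \<phi>_def d_def by simp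
  qed
  show thesis
    by (rule that[of \<phi>]) (auto simp: carrier_bc \<phi> h_cl bc_add[OF M] h_add tens_def h_of keys_add_frag)
qed

text \<open>Each tensor t \<otimes> w is rewritten as t (1 \<otimes> w). This separates the
  coefficients from T and the elements of M, so that later the \<open>w l\<close> can be treated as
  vectors over R alone.\<close>

lemma bc_span:
  assumes "module R M" "z \<in> carrier (bc M)"
  shows "\<exists>s t w. (\<forall>l<s. t l \<in> carrier T) \<and> (\<forall>l<s. w l \<in> carrier M) \<and>
    z = lincomb (bc M) s t (\<lambda>l. tens M \<one>\<^bsub>T\<^esub> (w l))"
  using assms
proof (induction rule: bc_induct)
  case zero
  show ?case by (intro exI[of _ 0]) simp
next
  case (tens t m)
  interpret B: module T "bc M" by (rule module_bc[OF assms(1)])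
  have "tens M t m = lincomb (bc M) 1 (\<lambda>_. t) (\<lambda>_. tens M \<one>\<^bsub>T\<^esub> m)"
    using tens smult_tens[OF assms(1) tens(1)] by simp
  then show ?case using tens by (intro exI[of _ 1] exI[of _ "\<lambda>_. t"] exI[of _ "\<lambda>_. m"]) simp
next
  case (add x y)
  interpret B: module T "bc M" by (rule module_bc[OF assms(1)])
  obtain s t w where 1: "\<forall>l<s. t l \<in> carrier T" "\<forall>l<s. w l \<in> carrier M"
    "x = lincomb (bc M) s t (\<lambda>l. tens M \<one>\<^bsub>T\<^esub> (w l))" using add.IH(1) by blast
  obtain s' t' w' where 2: "\<forall>l<s'. t' l \<in> carrier T" "\<forall>l<s'. w' l \<in> carrier M"
    "y = lincomb (bc M) s' t' (\<lambda>l. tens M \<one>\<^bsub>T\<^esub> (w' l))" using add.IH(2) by blast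
  let ?u = "\<lambda>l. if l < s then t l else t' (l - s)" and ?v = "\<lambda>l. if l < s then w l else w' (l - s)"
  have "lincomb (bc M) (s + s') ?u (\<lambda>l. tens M \<one>\<^bsub>T\<^esub> (?v l)) =
      lincomb (bc M) (s + s') ?u (\<lambda>l. if l < s then tens M \<one>\<^bsub>T\<^esub> (w l) else tens M \<one>\<^bsub>T\<^esub> (w' (l - s)))"
    by (rule lincomb_cong) simp_all
  also have "\<dots> = x \<oplus>\<^bsub>bc M\<^esub> y"
    unfolding 1(3) 2(3) using 1(1,2) 2(1,2) by (intro B.lincomb_append) simp_all
  finally show ?case using 1(1,2) 2(1,2) by (intro exI[of _ "s + s'"] exI[of _ ?u] exI[of _ ?v]) auto
qed

lemma base_change_map_smult:
  assumes "module R M" "r \<in> carrier R" "x \<in> carrier (bc M)"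
    and g: "\<And>m. m \<in> carrier M \<Longrightarrow> g m = r \<odot>\<^bsub>M\<^esub> m"
  shows "base_change_map R T f M g x = f r \<odot>\<^bsub>bc M\<^esub> x"
proof -
  interpret M: module R M by fact
  interpret B: module T "bc M" by (rule module_bc[OF assms(1)])
  have G: "g \<in> mod_hom R M M"
    by (rule mod_homI)
      (simp_all add: g assms(2) M.smult_r_distr R.m_comm flip: M.smult_assoc1)
  show ?thesis
    using assms(1,3)
  proof (induction rule: bc_induct)
    case zero
    then show ?case
      using assms(2) by (simp add: mod_hom_zero[OF B.module_axioms B.module_axioms base_change_map_hom[OF assms(1,1) G]])
  next
    case (tens t m)
    then show ?case
      using assms(2) by (simp add: base_change_map_tens[OF assms(1,1) G] g tens_balanced[OF assms(1)]
          smult_tens[OF assms(1)] T.m_comm)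
  next
    case (add x y)
    then show ?case
      using assms(2)
      by (simp add: mod_hom_add[OF base_change_map_hom[OF assms(1,1) G]] B.smult_r_distr)
  qed
qed

end

section \<open>Base change of finite powers and of matrices\<close>

definition pow_incl :: "('r, 'm, 'y) module_scheme \<Rightarrow> nat \<Rightarrow> 'm \<Rightarrow> nat \<Rightarrow> 'm"
  where "pow_incl M k y = (\<lambda>j. if j = k then y else \<zero>\<^bsub>M\<^esub>)"

context module
begin

lemma pow_incl_hom: "k < q \<Longrightarrow> pow_incl M k \<in> mod_hom R M (pow_module M q)"
  by (rule mod_homI) (auto simp: pow_incl_def carrier_pow_module fun_eq_iff)

lemma pow_nth_hom: "(\<lambda>x. x k) \<in> mod_hom R (pow_module M q) M"
  by (rule mod_homI) (auto simp: pow_module_nth)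

lemma pow_module_expand:
  assumes "x \<in> carrier (pow_module M q)"
  shows "lincomb (pow_module M q) q (\<lambda>_. \<one>\<^bsub>R\<^esub>) (\<lambda>k. pow_incl M k (x k)) = x"
proof
  fix i
  have x: "x k \<in> carrier M" for k using pow_module_nth[OF assms] .
  have "lincomb M q (\<lambda>_. \<one>\<^bsub>R\<^esub>) (\<lambda>k. pow_incl M k (x k) i) =
      lincomb M q (\<lambda>j. if j = i then \<one>\<^bsub>R\<^esub> else \<zero>\<^bsub>R\<^esub>) x" for q
    using x by (induction q) (auto simp: pow_incl_def lincomb_delta_left)
  then show "lincomb (pow_module M q) q (\<lambda>_. \<one>\<^bsub>R\<^esub>) (\<lambda>k. pow_incl M k (x k)) i = x i"
    using x assms by (simp add: lincomb_pow_module_nth lincomb_delta_left carrier_pow_module)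
qed

definition matrix_map :: "(nat \<Rightarrow> nat \<Rightarrow> 'a) \<Rightarrow> nat \<Rightarrow> nat \<Rightarrow> (nat \<Rightarrow> 'c) \<Rightarrow> nat \<Rightarrow> 'c"
  where "matrix_map B r q x = (\<lambda>j. if j < r then lincomb M q (B j) x else \<zero>\<^bsub>M\<^esub>)"

lemma matrix_map_hom:
  assumes "\<And>j k. j < r \<Longrightarrow> k < q \<Longrightarrow> B j k \<in> carrier R"
  shows "matrix_map B r q \<in> mod_hom R (pow_module M q) (pow_module M r)"
  by (rule mod_homI) (auto simp: carrier_pow_module matrix_map_def fun_eq_iff assms
      lincomb_add_right lincomb_smult_right)

end

context ring_change
begin

text \<open>The coordinate projections are jointly injective on T \<otimes>
  \<open>pow_module M r\<close>: every element is the sum over j of its j-th projection, included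
  back at place j. On elementary tensors this is the decomposition of a vector into its coordinates,
  and both sides are additive.\<close>

lemma bc_pow_eqI:
  assumes M: "module R M" and "y \<in> carrier (bc (pow_module M r))" "z \<in> carrier (bc (pow_module M r))"
    and "\<And>j. j < r \<Longrightarrow> base_change_map R T f M (\<lambda>x. x j) y = base_change_map R T f M (\<lambda>x. x j) z"
  shows "y = z"
proof -
  interpret M: module R M by fact
  let ?P = "pow_module M r"
  let ?pr = "\<lambda>j. base_change_map R T f M (\<lambda>x. x j)"
  let ?in = "\<lambda>j. base_change_map R T f ?P (pow_incl M j)"
  have P: "module R ?P" by (rule M.module_pow_module)
  interpret B: module T "bc ?P" by (rule module_bc[OF P])
  interpret BM: module T "bc M" by (rule module_bc[OF M])
  note pr = base_change_map_hom[OF P M M.pow_nth_hom]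
  note inc = base_change_map_hom[OF M P M.pow_incl_hom]
  have expand: "lincomb (bc ?P) r (\<lambda>_. \<one>\<^bsub>T\<^esub>) (\<lambda>j. ?in j (?pr j x)) = x" if "x \<in> carrier (bc ?P)" for x
    using P that
  proof (induction rule: bc_induct)
    case zero
    have "?in j (?pr j \<zero>\<^bsub>bc ?P\<^esub>) = \<zero>\<^bsub>bc ?P\<^esub>" if "j < r" for j
      using mod_hom_zero[OF B.module_axioms BM.module_axioms pr]
        mod_hom_zero[OF BM.module_axioms B.module_axioms inc[OF that]] by simp
    then show ?case by (intro B.lincomb_zero) simp
  next
    case (tens t m)
    have m: "m j \<in> carrier M" for j using M.pow_module_nth[OF tens(2)] .
    have "tens ?P t m = tens ?P t (lincomb ?P r (\<lambda>_. \<one>\<^bsub>R\<^esub>) (\<lambda>k. pow_incl M k (m k)))"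
      using M.pow_module_expand[OF tens(2)] by simp
    also have "\<dots> = lincomb (bc ?P) r (\<lambda>_. \<one>\<^bsub>T\<^esub>) (\<lambda>k. tens ?P t (pow_incl M k (m k)))"
    proof (rule module.lincomb_image[OF P])
      have "tens ?P t \<zero>\<^bsub>?P\<^esub> = tens ?P t (\<zero>\<^bsub>R\<^esub> \<odot>\<^bsub>?P\<^esub> \<zero>\<^bsub>?P\<^esub>)" by simp
      also have "\<dots> = tens ?P (t \<otimes>\<^bsub>T\<^esub> f \<zero>\<^bsub>R\<^esub>) \<zero>\<^bsub>?P\<^esub>"
        using tens module.module_pow_module[OF M] by (intro tens_balanced[OF P]) (auto simp: carrier_pow_module)
      also have "\<dots> = \<zero>\<^bsub>bc ?P\<^esub>"
        using tens tens_zero_left[OF P, of "\<zero>\<^bsub>?P\<^esub>"] by (simp add: carrier_pow_module)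
      finally show "tens ?P t \<zero>\<^bsub>?P\<^esub> = \<zero>\<^bsub>bc ?P\<^esub>" .
    next
      fix k assume "k < r"
      then have "pow_incl M k (m k) \<in> carrier ?P" using mod_hom_closed[OF M.pow_incl_hom m] by blast
      then show "tens ?P t (\<one>\<^bsub>R\<^esub> \<odot>\<^bsub>?P\<^esub> pow_incl M k (m k)) =
          \<one>\<^bsub>T\<^esub> \<odot>\<^bsub>bc ?P\<^esub> tens ?P t (pow_incl M k (m k))"
        using tens(1) module.smult_one[OF P] by (simp add: del: pow_module_simps)
    qed (use tens m mod_hom_closed[OF M.pow_incl_hom m] in \<open>auto simp: tens_add_right[OF P] simp del: pow_module_simps\<close>)
    also have "\<dots> = lincomb (bc ?P) r (\<lambda>_. \<one>\<^bsub>T\<^esub>) (\<lambda>j. ?in j (?pr j (tens ?P t m)))"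
      using m by (intro lincomb_cong)
        (simp_all add: base_change_map_tens[OF P M M.pow_nth_hom] base_change_map_tens[OF M P M.pow_incl_hom])
    finally show ?case by simp
  next
    case (add x y)
    have "lincomb (bc ?P) r (\<lambda>_. \<one>\<^bsub>T\<^esub>) (\<lambda>j. ?in j (?pr j (x \<oplus>\<^bsub>bc ?P\<^esub> y))) =
      lincomb (bc ?P) r (\<lambda>_. \<one>\<^bsub>T\<^esub>) (\<lambda>j. ?in j (?pr j x) \<oplus>\<^bsub>bc ?P\<^esub> ?in j (?pr j y))"
      using add by (intro lincomb_cong)
        (simp_all add: mod_hom_add[OF pr] mod_hom_add[OF inc] mod_hom_closed[OF pr])
    also have "\<dots> = lincomb (bc ?P) r (\<lambda>_. \<one>\<^bsub>T\<^esub>) (\<lambda>j. ?in j (?pr j x)) \<oplus>\<^bsub>bc ?P\<^esub>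
        lincomb (bc ?P) r (\<lambda>_. \<one>\<^bsub>T\<^esub>) (\<lambda>j. ?in j (?pr j y))"
      using add by (intro B.lincomb_add_right)
        (simp_all add: mod_hom_closed[OF pr] mod_hom_closed[OF inc])
    finally show ?case using add by simp
  qed
  have "y = lincomb (bc ?P) r (\<lambda>_. \<one>\<^bsub>T\<^esub>) (\<lambda>j. ?in j (?pr j y))"
    using expand[OF assms(2)] by simp
  also have "\<dots> = lincomb (bc ?P) r (\<lambda>_. \<one>\<^bsub>T\<^esub>) (\<lambda>j. ?in j (?pr j z))"
    using assms(4) by (intro lincomb_cong) auto
  also have "\<dots> = z" using expand[OF assms(3)] .
  finally show ?thesis .
qed

text \<open>The element of \<open>T \<otimes> M\<^sup>q\<close> that corresponds to an element of \<open>(T \<otimes> M)\<^sup>q\<close>.\<close>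

definition bc_vec :: "('r, 'm, 'y) module_scheme \<Rightarrow> nat \<Rightarrow> (nat \<Rightarrow> ('t \<times> 'm \<Rightarrow>\<^sub>0 int) set)
    \<Rightarrow> ('t \<times> (nat \<Rightarrow> 'm) \<Rightarrow>\<^sub>0 int) set"
  where "bc_vec M q x = lincomb (bc (pow_module M q)) q (\<lambda>_. \<one>\<^bsub>T\<^esub>)
    (\<lambda>k. base_change_map R T f (pow_module M q) (pow_incl M k) (x k))"

lemma bc_vec_closed:
  assumes "module R M" "\<And>k. k < q \<Longrightarrow> x k \<in> carrier (bc M)"
  shows "bc_vec M q x \<in> carrier (bc (pow_module M q))"
proof -
  interpret M: module R M by fact
  interpret B: module T "bc (pow_module M q)" by (rule module_bc[OF M.module_pow_module])
  show ?thesis unfolding bc_vec_def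
    using assms(2) mod_hom_closed[OF base_change_map_hom[OF M.module_axioms M.module_pow_module M.pow_incl_hom]]
    by (intro B.lincomb_closed) auto
qed

lemma base_change_map_vec:
  assumes M: "module R M" and N: "module R N" and x: "\<And>k. k < q \<Longrightarrow> x k \<in> carrier (bc M)"
    and g: "g \<in> mod_hom R (pow_module M q) N"
  shows "base_change_map R T f N g (bc_vec M q x) =
    lincomb (bc N) q (\<lambda>_. \<one>\<^bsub>T\<^esub>) (\<lambda>k. base_change_map R T f N (\<lambda>y. g (pow_incl M k y)) (x k))"
proof -
  interpret M: module R M by fact
  note P = M.module_pow_module
  note inc = base_change_map_hom[OF M P M.pow_incl_hom]
  have "base_change_map R T f N g (bc_vec M q x) =
    lincomb (bc N) q (\<lambda>_. \<one>\<^bsub>T\<^esub>) (\<lambda>k. base_change_map R T f N g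
      (base_change_map R T f (pow_module M q) (pow_incl M k) (x k)))"
    unfolding bc_vec_def using mod_hom_closed[OF inc x]
    by (intro mod_hom_lincomb[OF module_bc[OF P] module_bc[OF N] base_change_map_hom[OF P N g]]) auto
  also have "\<dots> = lincomb (bc N) q (\<lambda>_. \<one>\<^bsub>T\<^esub>) (\<lambda>k. base_change_map R T f N (\<lambda>y. g (pow_incl M k y)) (x k))"
    using x by (intro lincomb_cong refl base_change_map_comp[OF M P N M.pow_incl_hom g])
  finally show ?thesis .
qed

text \<open>A linear form with coefficients \<open>B\<close> on the power of M becomes the form with
  coefficients \<open>f (B k)\<close> on the coordinates, because on the k-th summand it is
  multiplication by \<open>B k\<close>. A linear equation over T \<otimes> M is thus a statement
  about the single element \<open>bc_vec M q x\<close>.\<close>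

lemma base_change_map_vec_matrix:
  assumes M: "module R M" and x: "\<And>k. k < q \<Longrightarrow> x k \<in> carrier (bc M)"
    and B: "\<And>k. k < q \<Longrightarrow> B k \<in> carrier R"
    and g: "g \<in> mod_hom R (pow_module M q) M"
    and gB: "\<And>y. y \<in> carrier (pow_module M q) \<Longrightarrow> g y = lincomb M q B y"
  shows "base_change_map R T f M g (bc_vec M q x) = lincomb (bc M) q (\<lambda>k. f (B k)) x"
proof -
  interpret M: module R M by fact
  interpret BM: module T "bc M" by (rule module_bc[OF M])
  have "base_change_map R T f M (\<lambda>y. g (pow_incl M k y)) (x k) = f (B k) \<odot>\<^bsub>bc M\<^esub> x k" if k: "k < q" for k
  proof (rule base_change_map_smult[OF M B[OF k] x[OF k]])
    fix m assume m: "m \<in> carrier M"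
    show "g (pow_incl M k m) = B k \<odot>\<^bsub>M\<^esub> m"
      using gB[OF mod_hom_closed[OF M.pow_incl_hom[OF k] m]] M.lincomb_delta_right[of q B m k] B m k
      by (simp add: pow_incl_def)
  qed
  then have "lincomb (bc M) q (\<lambda>_. \<one>\<^bsub>T\<^esub>) (\<lambda>k. base_change_map R T f M (\<lambda>y. g (pow_incl M k y)) (x k)) =
      lincomb (bc M) q (\<lambda>_. \<one>\<^bsub>T\<^esub>) (\<lambda>k. f (B k) \<odot>\<^bsub>bc M\<^esub> x k)"
    by (intro lincomb_cong) simp_all
  with base_change_map_vec[OF M M x g] have *: "base_change_map R T f M g (bc_vec M q x) =
      lincomb (bc M) q (\<lambda>_. \<one>\<^bsub>T\<^esub>) (\<lambda>k. f (B k) \<odot>\<^bsub>bc M\<^esub> x k)"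
    by simp
  have "lincomb (bc M) q (\<lambda>_. \<one>\<^bsub>T\<^esub>) (\<lambda>k. f (B k) \<odot>\<^bsub>bc M\<^esub> x k) = lincomb (bc M) q (\<lambda>k. f (B k)) x"
    using x B by (induction q) auto
  with * show ?thesis by simp
qed

lemma base_change_map_vec_nth:
  assumes M: "module R M" and x: "\<And>k. k < q \<Longrightarrow> x k \<in> carrier (bc M)" and "i < q"
  shows "base_change_map R T f M (\<lambda>y. y i) (bc_vec M q x) = x i"
proof -
  interpret M: module R M by fact
  interpret BM: module T "bc M" by (rule module_bc[OF M])
  \<comment> \<open>The i-th projection is the linear form whose coefficients are 1 at i and 0
    elsewhere.\<close>
  have "base_change_map R T f M (\<lambda>y. y i) (bc_vec M q x) =
      lincomb (bc M) q (\<lambda>k. f (if k = i then \<one>\<^bsub>R\<^esub> else \<zero>\<^bsub>R\<^esub>)) x"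
    using assms M.lincomb_delta_left[of q _ i]
    by (intro base_change_map_vec_matrix[OF M x _ M.pow_nth_hom]) (auto simp: M.pow_module_nth)
  also have "\<dots> = lincomb (bc M) q (\<lambda>k. if k = i then \<one>\<^bsub>T\<^esub> else \<zero>\<^bsub>T\<^esub>) x"
    by (rule lincomb_cong) auto
  finally show ?thesis using assms BM.lincomb_delta_left[of q x i] by simp
qed

end

section \<open>Consequences of faithful flatness\<close>

locale flat_change = ring_change R T f
  for R :: "('r, 'p) ring_scheme" and T :: "('t, 'q) ring_scheme" and f +
  assumes flat: "faithfully_flat R T f"
begin

text \<open>The definition of faithful flatness only speaks about modules with elements of type
  \<open>(nat \<Rightarrow> 'r) set\<close>; the embedding \<open>\<kappa>\<close> transports it to other types.\<close>

lemma flat_exact: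
  fixes A B C :: "('r, 'a, 'x) module_scheme" and \<kappa> :: "'a \<Rightarrow> (nat \<Rightarrow> 'r) set"
  assumes \<kappa>: "inj_on \<kappa> S" "carrier A \<subseteq> S" "carrier B \<subseteq> S" "carrier C \<subseteq> S"
    and A: "module R A" and B: "module R B" and C: "module R C"
    and g: "g \<in> mod_hom R A B" and h: "h \<in> mod_hom R B C"
  shows "exact_at A g B h C \<longleftrightarrow>
    exact_at (bc A) (base_change_map R T f B g) (bc B) (base_change_map R T f C h) (bc C)"
proof -
  let ?A = "copy_module \<kappa> A" and ?B = "copy_module \<kappa> B" and ?C = "copy_module \<kappa> C"
  let ?i = "\<lambda>A. inv_into (carrier A) \<kappa>"
  have inj: "inj_on \<kappa> (carrier A)" "inj_on \<kappa> (carrier B)" "inj_on \<kappa> (carrier C)"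
    using \<kappa> by (auto intro: inj_on_subset)
  have A': "module R ?A" and B': "module R ?B" and C': "module R ?C"
    using A B C inj by (auto intro: module_copy_module)
  note kA = copy_module_hom[OF A inj(1)] and kB = copy_module_hom[OF B inj(2)]
    and kC = copy_module_hom[OF C inj(3)]
  define g' where "g' = (\<lambda>u. \<kappa> (g (?i A u)))"
  define h' where "h' = (\<lambda>u. \<kappa> (h (?i B u)))"
  have g': "g' \<in> mod_hom R ?A ?B" and h': "h' \<in> mod_hom R ?B ?C"
    unfolding g'_def h'_def
    by (rule mod_hom_comp[OF mod_hom_comp[OF kA(2) g] kB(1)])
      (rule mod_hom_comp[OF mod_hom_comp[OF kB(2) h] kC(1)])
  have ig: "g' (\<kappa> x) = \<kappa> (g x)" if "x \<in> carrier A" for x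
    using that inj by (simp add: g'_def)
  have ih: "h' (\<kappa> x) = \<kappa> (h x)" if "x \<in> carrier B" for x
    using that inj by (simp add: h'_def)
  interpret C: module R C by fact
  have 1: "exact_at A g B h C \<longleftrightarrow> exact_at ?A g' ?B h' ?C"
    by (rule exact_at_cong_bij[of \<kappa> _ _ \<kappa> _ _ \<kappa>])
      (use inj in \<open>simp_all add: bij_betw_def copy_module_simps(1,2) ig ih mod_hom_closed[OF g] mod_hom_closed[OF h]\<close>)
  \<comment> \<open>The copies have elements of the type over which the definition quantifies, so it
    can be instantiated with them.\<close>
  have 2: "exact_at ?A g' ?B h' ?C \<longleftrightarrow>
      exact_at (bc ?A) (base_change_map R T f ?B g') (bc ?B) (base_change_map R T f ?C h') (bc ?C)"
    using flat A' B' C' g' h' unfolding faithfully_flat_def by blast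
  \<comment> \<open>Base change is functorial, so the base change of \<open>\<kappa>\<close> is
    inverted by that of its inverse; this carries exactness over T from the copies to the
    originals.\<close>
  have bij: "bij_betw (base_change_map R T f (copy_module \<kappa> N) \<kappa>) (carrier (bc N)) (carrier (bc (copy_module \<kappa> N)))"
    if N: "module R N" and inj: "inj_on \<kappa> (carrier N)" for N :: "('r, 'a, 'x) module_scheme"
  proof (rule bij_betw_byWitness[where f' = "base_change_map R T f N (?i N)"])
    note N' = module_copy_module[OF N inj] and k = copy_module_hom[OF N inj]
    have "base_change_map R T f N (?i N) (base_change_map R T f (copy_module \<kappa> N) \<kappa> x) = x"
      if "x \<in> carrier (bc N)" for x
      using base_change_map_comp[OF N N' N k that, of "\<lambda>a. a"] base_change_map_id[OF N that, of "\<lambda>a. a"] inj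
      by simp
    then show "\<forall>x\<in>carrier (bc N). base_change_map R T f N (?i N) (base_change_map R T f (copy_module \<kappa> N) \<kappa> x) = x"
      by blast
    have "base_change_map R T f (copy_module \<kappa> N) \<kappa> (base_change_map R T f N (?i N) x) = x"
      if "x \<in> carrier (bc (copy_module \<kappa> N))" for x
      using base_change_map_comp[OF N' N N' k(2,1) that, of "\<lambda>a. a"] base_change_map_id[OF N' that, of "\<lambda>a. a"]
      by (simp add: copy_module_simps(1) f_inv_into_f)
    then show "\<forall>x\<in>carrier (bc (copy_module \<kappa> N)). base_change_map R T f (copy_module \<kappa> N) \<kappa> (base_change_map R T f N (?i N) x) = x"
      by blast
    show "base_change_map R T f (copy_module \<kappa> N) \<kappa> ` carrier (bc N) \<subseteq> carrier (bc (copy_module \<kappa> N))"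
      using mod_hom_closed[OF base_change_map_hom[OF N N' k(1)]] by blast
    show "base_change_map R T f N (?i N) ` carrier (bc (copy_module \<kappa> N)) \<subseteq> carrier (bc N)"
      using mod_hom_closed[OF base_change_map_hom[OF N' N k(2)]] by blast
  qed
  have 3: "exact_at (bc A) (base_change_map R T f B g) (bc B) (base_change_map R T f C h) (bc C) \<longleftrightarrow>
      exact_at (bc ?A) (base_change_map R T f ?B g') (bc ?B) (base_change_map R T f ?C h') (bc ?C)"
  proof (rule exact_at_cong_bij[OF bij[OF A inj(1)] bij[OF B inj(2)]])
    show "inj_on (base_change_map R T f ?C \<kappa>) (carrier (bc C))"
      using bij[OF C inj(3)] by (simp add: bij_betw_def)
    show "base_change_map R T f ?C \<kappa> \<zero>\<^bsub>bc C\<^esub> = \<zero>\<^bsub>bc ?C\<^esub>"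
      by (rule mod_hom_zero[OF module_bc[OF C] module_bc[OF C'] base_change_map_hom[OF C C' kC(1)]])
    show "\<zero>\<^bsub>bc C\<^esub> \<in> carrier (bc C)"
      using abelian_group_bc[OF C] by (simp add: abelian_group_def abelian_monoid.zero_closed)
    show "base_change_map R T f B g x \<in> carrier (bc B)" if "x \<in> carrier (bc A)" for x
      using mod_hom_closed[OF base_change_map_hom[OF A B g] that] .
    show "base_change_map R T f C h x \<in> carrier (bc C)" if "x \<in> carrier (bc B)" for x
      using mod_hom_closed[OF base_change_map_hom[OF B C h] that] .
    show "base_change_map R T f ?B g' (base_change_map R T f ?A \<kappa> x) =
        base_change_map R T f ?B \<kappa> (base_change_map R T f B g x)" if "x \<in> carrier (bc A)" for x
      using base_change_map_comp[OF A A' B' kA(1) g' that, of "\<lambda>a. \<kappa> (g a)"]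
        base_change_map_comp[OF A B B' g kB(1) that, of "\<lambda>a. \<kappa> (g a)"] ig by simp
    show "base_change_map R T f ?C h' (base_change_map R T f ?B \<kappa> x) =
        base_change_map R T f ?C \<kappa> (base_change_map R T f C h x)" if "x \<in> carrier (bc B)" for x
      using base_change_map_comp[OF B B' C' kB(1) h' that, of "\<lambda>a. \<kappa> (h a)"]
        base_change_map_comp[OF B C C' h kC(1) that, of "\<lambda>a. \<kappa> (h a)"] ih by simp
  qed
  show ?thesis using 1 2 3 by simp
qed

text \<open>Injectivity of the inclusion of H is exactness of 0, H, N. The zero module is realized
  as a submodule of N, so that one embedding serves all three modules; its base change is zero,
  hence the kernel over T is zero.\<close>

lemma flat_inj:
  fixes N :: "('r, 'a, 'x) module_scheme" and \<kappa> :: "'a \<Rightarrow> (nat \<Rightarrow> 'r) set"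
  assumes \<kappa>: "inj_on \<kappa> (carrier N)" and N: "module R N" and H: "submodule H R N"
    and y: "y \<in> carrier (bc (N\<lparr>carrier := H\<rparr>))" "base_change_map R T f N (\<lambda>x. x) y = \<zero>\<^bsub>bc N\<^esub>"
  shows "y = \<zero>\<^bsub>bc (N\<lparr>carrier := H\<rparr>)\<^esub>"
proof -
  interpret N: module R N by fact
  let ?H = "N\<lparr>carrier := H\<rparr>" and ?Z = "N\<lparr>carrier := {\<zero>\<^bsub>N\<^esub>}\<rparr>"
  have "submodule {\<zero>\<^bsub>N\<^esub>} R N" by (rule N.submoduleI) auto
  from submodule.submodule_is_module[OF this N] have Z: "module R ?Z" .
  have H': "module R ?H" by (rule submodule.submodule_is_module[OF H N])
  interpret H: module R ?H by fact
  have sub: "H \<subseteq> carrier N" using N.submoduleE(1)[OF H] .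
  have 0: "\<zero>\<^bsub>N\<^esub> \<in> H" using H.zero_closed by simp
  have z: "(\<lambda>x. x) \<in> mod_hom R ?Z ?H" using 0 by (intro mod_homI) auto
  have i: "(\<lambda>x. x) \<in> mod_hom R ?H N" using sub by (rule N.mod_hom_incl)
  have "exact_at ?Z (\<lambda>x. x) ?H (\<lambda>x. x) N"
    using 0 by (auto simp: exact_at_def)
  then have ex: "exact_at (bc ?Z) (base_change_map R T f ?H (\<lambda>x. x)) (bc ?H) (base_change_map R T f N (\<lambda>x. x)) (bc N)"
    using flat_exact[OF \<kappa> _ _ _ Z H' N z i] sub by simp
  have "u = \<zero>\<^bsub>bc ?Z\<^esub>" if "u \<in> carrier (bc ?Z)" for u
    using Z that
  proof (induction rule: bc_induct)
    case (tens t m)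
    then have "m = \<zero>\<^bsub>R\<^esub> \<odot>\<^bsub>?Z\<^esub> m" by simp
    then have "tens ?Z t m = tens ?Z (t \<otimes>\<^bsub>T\<^esub> f \<zero>\<^bsub>R\<^esub>) m"
      using tens tens_balanced[OF Z tens(1) R.zero_closed tens(2)] by simp
    then show ?case using tens tens_zero_left[OF Z tens(2)] by simp
  next
    case (add x y)
    interpret bZ: module T "bc ?Z" by (rule module_bc[OF Z])
    show ?case using add by simp
  qed simp
  moreover have "y \<in> base_change_map R T f ?H (\<lambda>x. x) ` carrier (bc ?Z)"
    using ex y unfolding exact_at_def by blast
  ultimately show ?thesis
    using mod_hom_zero[OF module_bc[OF Z] module_bc[OF H'] base_change_map_hom[OF Z H' z]] by auto
qed

text \<open>H = N is exactness at N of the inclusion of H followed by the zero map of N into itself,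
  and faithfulness carries exactness back from T. Taking N as the third module keeps all carriers
  inside the domain of \<open>\<kappa>\<close>.\<close>

lemma faithful_surj:
  fixes N :: "('r, 'a, 'x) module_scheme" and \<kappa> :: "'a \<Rightarrow> (nat \<Rightarrow> 'r) set"
  assumes \<kappa>: "inj_on \<kappa> (carrier N)" and N: "module R N" and H: "submodule H R N"
    and surj: "carrier (bc N) \<subseteq> base_change_map R T f N (\<lambda>x. x) ` carrier (bc (N\<lparr>carrier := H\<rparr>))"
  shows "H = carrier N"
proof -
  interpret N: module R N by fact
  let ?H = "N\<lparr>carrier := H\<rparr>"
  have H': "module R ?H" by (rule submodule.submodule_is_module[OF H N])
  have sub: "H \<subseteq> carrier N" using N.submoduleE(1)[OF H] .
  have i: "(\<lambda>x. x) \<in> mod_hom R ?H N" using sub by (rule N.mod_hom_incl)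
  note z = mod_hom_const_zero[OF N N]
  interpret bN: module T "bc N" by (rule module_bc[OF N])
  \<comment> \<open>The zero map is multiplication by 0, so its base change is multiplication by the
    image of 0 under \<open>f\<close>.\<close>
  have "base_change_map R T f N (\<lambda>x. \<zero>\<^bsub>N\<^esub>) y = \<zero>\<^bsub>bc N\<^esub>" if "y \<in> carrier (bc N)" for y
    using base_change_map_smult[OF N R.zero_closed that, of "\<lambda>x. \<zero>\<^bsub>N\<^esub>"] that by simp
  then have "exact_at (bc ?H) (base_change_map R T f N (\<lambda>x. x)) (bc N) (base_change_map R T f N (\<lambda>x. \<zero>\<^bsub>N\<^esub>)) (bc N)"
    using surj mod_hom_closed[OF base_change_map_hom[OF H' N i]] unfolding exact_at_def by auto
  then have "exact_at ?H (\<lambda>x. x) N (\<lambda>x. \<zero>\<^bsub>N\<^esub>) N"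
    using flat_exact[OF \<kappa> _ _ _ H' N N i z] sub by simp
  then show ?thesis by (auto simp: exact_at_def)
qed

end

lemma (in abelian_group) eq_if_minus_eq_zero:
  assumes "x \<ominus> y = \<zero>" "x \<in> carrier G" "y \<in> carrier G"
  shows "x = y"
proof -
  have "(x \<ominus> y) \<oplus> y = x"
    using assms(2,3) by (simp add: minus_eq a_assoc l_neg)
  then show ?thesis using assms by simp
qed

section \<open>Linear systems under faithfully flat base change\<close>

context flat_change
begin

text \<open>Let K be the module of solutions inside \<open>pow_module M q\<close>. Flatness keeps
  the sequence of K and the two powers of M exact. The element of T \<otimes>
  \<open>pow_module M q\<close> that encodes x is killed by the matrix, so it comes from T \<otimes>
  K, and expanding it there by \<open>bc_span\<close> yields the solutions
  \<open>w l\<close>.\<close>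

lemma flat_kernel:
  fixes M :: "('r, 'm, 'y) module_scheme" and \<kappa> :: "(nat \<Rightarrow> 'm) \<Rightarrow> (nat \<Rightarrow> 'r) set" and q r :: nat
  assumes M: "module R M" and \<kappa>: "inj_on \<kappa> {x. \<forall>k. x k \<in> carrier M}"
    and B: "\<And>j k. j < r \<Longrightarrow> k < q \<Longrightarrow> B j k \<in> carrier R"
    and x: "\<And>k. k < q \<Longrightarrow> x k \<in> carrier (bc M)"
    and eq: "\<And>j. j < r \<Longrightarrow> lincomb (bc M) q (\<lambda>k. f (B j k)) x = \<zero>\<^bsub>bc M\<^esub>"
  shows "\<exists>s t w. (\<forall>l<s. t l \<in> carrier T) \<and> (\<forall>l<s. \<forall>k<q. w l k \<in> carrier M) \<and>
    (\<forall>l<s. \<forall>j<r. lincomb M q (B j) (w l) = \<zero>\<^bsub>M\<^esub>) \<and>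
    (\<forall>k<q. x k = lincomb (bc M) s t (\<lambda>l. tens M \<one>\<^bsub>T\<^esub> (w l k)))"
proof -
  interpret M: module R M by fact
  let ?Q = "pow_module M q" and ?S = "pow_module M r"
  note Q = M.module_pow_module[of q] and S = M.module_pow_module[of r]
  let ?h = "M.matrix_map B r q"
  have h: "?h \<in> mod_hom R ?Q ?S" using B by (rule M.matrix_map_hom)
  have sub: "submodule {y \<in> carrier ?Q. ?h y = \<zero>\<^bsub>?S\<^esub>} R ?Q"
    by (rule module.submodule_kernel[OF Q S h])
  let ?K = "?Q\<lparr>carrier := {y \<in> carrier ?Q. ?h y = \<zero>\<^bsub>?S\<^esub>}\<rparr>"
  have K: "module R ?K" by (rule submodule.submodule_is_module[OF sub Q])
  have i: "(\<lambda>y. y) \<in> mod_hom R ?K ?Q" by (rule module.mod_hom_incl[OF Q]) auto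
  have "exact_at ?K (\<lambda>y. y) ?Q ?h ?S"
    by (simp add: exact_at_def)
  moreover have "carrier (pow_module M b) \<subseteq> {x. \<forall>k. x k \<in> carrier M}" for b
    using M.pow_module_nth by blast
  ultimately have ex: "exact_at (bc ?K) (base_change_map R T f ?Q (\<lambda>y. y)) (bc ?Q)
      (base_change_map R T f ?S ?h) (bc ?S)"
    using flat_exact[OF \<kappa> _ _ _ K Q S i h] by auto
  note H = base_change_map_hom[OF Q S h]
  define \<zeta> where "\<zeta> = bc_vec M q x"
  have \<zeta>: "\<zeta> \<in> carrier (bc ?Q)" unfolding \<zeta>_def by (rule bc_vec_closed[OF M x])
  interpret bS: module T "bc ?S" by (rule module_bc[OF S])
  interpret bM: module T "bc M" by (rule module_bc[OF M])
  \<comment> \<open>Vanishing is tested coordinate by coordinate; coordinate j is the j-th equation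
    of the system.\<close>
  have "base_change_map R T f ?S ?h \<zeta> = \<zero>\<^bsub>bc ?S\<^esub>"
  proof (rule bc_pow_eqI[OF M mod_hom_closed[OF H \<zeta>] bS.zero_closed])
    fix j assume j: "j < r"
    have hj: "(\<lambda>y. ?h y j) \<in> mod_hom R ?Q M"
      by (rule mod_hom_comp[OF h M.pow_nth_hom])
    have "base_change_map R T f M (\<lambda>x. x j) (base_change_map R T f ?S ?h \<zeta>) =
        base_change_map R T f M (\<lambda>y. ?h y j) \<zeta>"
      by (rule base_change_map_comp[OF Q S M h M.pow_nth_hom \<zeta>]) simp
    also have "\<dots> = lincomb (bc M) q (\<lambda>k. f (B j k)) x"
      unfolding \<zeta>_def
      by (rule base_change_map_vec_matrix[OF M x B[OF j] hj]) (simp_all add: M.matrix_map_def j)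
    also have "\<dots> = \<zero>\<^bsub>bc M\<^esub>" by (rule eq[OF j])
    also have "\<dots> = base_change_map R T f M (\<lambda>x. x j) \<zero>\<^bsub>bc ?S\<^esub>"
      using mod_hom_zero[OF bS.module_axioms bM.module_axioms base_change_map_hom[OF S M M.pow_nth_hom]] by simp
    finally show "base_change_map R T f M (\<lambda>x. x j) (base_change_map R T f ?S ?h \<zeta>) =
        base_change_map R T f M (\<lambda>x. x j) \<zero>\<^bsub>bc ?S\<^esub>" .
  qed
  then have "\<zeta> \<in> base_change_map R T f ?Q (\<lambda>y. y) ` carrier (bc ?K)"
    using ex \<zeta> unfolding exact_at_def by simp
  then obtain z where z: "z \<in> carrier (bc ?K)" "\<zeta> = base_change_map R T f ?Q (\<lambda>y. y) z"
    by (rule imageE)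
  obtain s t w where stw: "\<forall>l<s. t l \<in> carrier T" "\<forall>l<s. w l \<in> carrier ?K"
      "z = lincomb (bc ?K) s t (\<lambda>l. tens ?K \<one>\<^bsub>T\<^esub> (w l))"
    using bc_span[OF K z(1)] by blast
  have "x k = lincomb (bc M) s t (\<lambda>l. tens M \<one>\<^bsub>T\<^esub> (w l k))" if k: "k < q" for k
  proof -
    have p: "(\<lambda>y. y k) \<in> mod_hom R ?K M" by (rule mod_hom_comp[OF i M.pow_nth_hom])
    have "x k = base_change_map R T f M (\<lambda>y. y k) \<zeta>"
      unfolding \<zeta>_def by (rule base_change_map_vec_nth[OF M x k, symmetric])
    also have "\<dots> = base_change_map R T f M (\<lambda>y. y k) z"
      unfolding z(2) by (rule base_change_map_comp[OF K Q M i M.pow_nth_hom z(1)]) simp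
    also have "\<dots> = lincomb (bc M) s t (\<lambda>l. base_change_map R T f M (\<lambda>y. y k) (tens ?K \<one>\<^bsub>T\<^esub> (w l)))"
      unfolding stw(3) using stw(1,2)
      by (intro mod_hom_lincomb[OF module_bc[OF K] module_bc[OF M] base_change_map_hom[OF K M p]]) auto
    also have "\<dots> = lincomb (bc M) s t (\<lambda>l. tens M \<one>\<^bsub>T\<^esub> (w l k))"
      by (simp only: base_change_map_tens[OF K M p])
    finally show ?thesis .
  qed
  moreover have "w l k \<in> carrier M" if "l < s" for l k
    using stw(2) that by (auto intro: M.pow_module_nth)
  moreover have "lincomb M q (B j) (w l) = \<zero>\<^bsub>M\<^esub>" if "l < s" "j < r" for l j
  proof -
    have "?h (w l) = \<zero>\<^bsub>?S\<^esub>" using stw(2) that(1) by simp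
    then have "?h (w l) j = \<zero>\<^bsub>M\<^esub>" by simp
    then show ?thesis using that(2) by (simp add: M.matrix_map_def)
  qed
  ultimately show ?thesis using stw(1) by (intro exI[of _ s] exI[of _ t] exI[of _ w]) simp
qed

text \<open>Let \<open>H\<close> be the image of \<open>A\<close> and \<open>N = H + R z\<close>. A solution over \<open>T\<close> makes the base change of
  the inclusion of \<open>H\<close> into \<open>N\<close> surjective, so \<open>H = N\<close>.\<close>

lemma faithful_solve:
  fixes M :: "('r, 'm, 'y) module_scheme" and \<kappa> :: "(nat \<Rightarrow> 'm) \<Rightarrow> (nat \<Rightarrow> 'r) set" and p q :: nat
  assumes M: "module R M" and \<kappa>: "inj_on \<kappa> {x. \<forall>k. x k \<in> carrier M}"
    and A: "\<And>k j. k < q \<Longrightarrow> j < p \<Longrightarrow> A k j \<in> carrier R"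
    and z: "\<And>k. k < q \<Longrightarrow> z k \<in> carrier M" and y: "\<And>j. j < p \<Longrightarrow> y j \<in> carrier (bc M)"
    and eq: "\<And>k. k < q \<Longrightarrow> tens M \<one>\<^bsub>T\<^esub> (z k) = lincomb (bc M) p (\<lambda>j. f (A k j)) y"
  shows "\<exists>u. (\<forall>j<p. u j \<in> carrier M) \<and> (\<forall>k<q. z k = lincomb M p (A k) u)"
proof -
  interpret M: module R M by fact
  let ?Q = "pow_module M q" and ?P = "pow_module M p"
  note Q = M.module_pow_module[of q] and P = M.module_pow_module[of p]
  interpret Q: module R ?Q by (rule Q)
  interpret P: module R ?P by (rule P)
  define a where "a = M.matrix_map A q p"
  have a: "a \<in> mod_hom R ?P ?Q" unfolding a_def using A by (rule M.matrix_map_hom)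
  note a_cl = mod_hom_closed[OF a]
  \<comment> \<open>Padding with zeros makes the right-hand side an element of the power of
    M.\<close>
  define z' where "z' = (\<lambda>k. if k < q then z k else \<zero>\<^bsub>M\<^esub>)"
  have z': "z' \<in> carrier ?Q" using z by (simp add: z'_def carrier_pow_module)
  define H where "H = a ` carrier ?P"
  define N where "N = {h \<oplus>\<^bsub>?Q\<^esub> r \<odot>\<^bsub>?Q\<^esub> z' | h r. h \<in> H \<and> r \<in> carrier R}"
  have H: "submodule H R ?Q" unfolding H_def by (rule P.submodule_image[OF Q a])
  note H' = Q.submoduleE[OF H]
  have zH: "\<zero>\<^bsub>?Q\<^esub> \<in> H" using subgroup.one_closed[OF submodule.axioms(1)[OF H]] by simp
  have HN: "H \<subseteq> N"
  proof
    fix h assume h: "h \<in> H"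
    then have "h = h \<oplus>\<^bsub>?Q\<^esub> \<zero>\<^bsub>R\<^esub> \<odot>\<^bsub>?Q\<^esub> z'"
      using H'(1) z' by (simp add: subset_iff del: pow_module_simps)
    then show "h \<in> N" using h unfolding N_def by blast
  qed
  have Nsub: "N \<subseteq> carrier ?Q"
    using H'(1) z' unfolding N_def by (auto simp: subset_iff simp del: pow_module_simps)
  have Ns: "submodule N R ?Q"
  proof (rule Q.submoduleI[OF Nsub])
    show "\<zero>\<^bsub>?Q\<^esub> \<in> N" using zH HN by blast
  next
    fix x y assume "x \<in> N" "y \<in> N"
    then obtain h r h' r' where *: "x = h \<oplus>\<^bsub>?Q\<^esub> r \<odot>\<^bsub>?Q\<^esub> z'" "h \<in> H" "r \<in> carrier R"
      "y = h' \<oplus>\<^bsub>?Q\<^esub> r' \<odot>\<^bsub>?Q\<^esub> z'" "h' \<in> H" "r' \<in> carrier R" unfolding N_def by blast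
    then have "h \<in> carrier ?Q" "h' \<in> carrier ?Q" using H'(1) by auto
    with * z' have "x \<oplus>\<^bsub>?Q\<^esub> y = (h \<oplus>\<^bsub>?Q\<^esub> h') \<oplus>\<^bsub>?Q\<^esub> (r \<oplus>\<^bsub>R\<^esub> r') \<odot>\<^bsub>?Q\<^esub> z'"
      by (simp add: Q.smult_l_distr Q.a_ac del: pow_module_simps)
    then show "x \<oplus>\<^bsub>?Q\<^esub> y \<in> N" unfolding N_def using H'(5) * by blast
  next
    fix x s assume s: "s \<in> carrier R" and "x \<in> N"
    then obtain h r where *: "x = h \<oplus>\<^bsub>?Q\<^esub> r \<odot>\<^bsub>?Q\<^esub> z'" "h \<in> H" "r \<in> carrier R" unfolding N_def by blast
    then have "h \<in> carrier ?Q" using H'(1) by auto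
    with * s z' have "s \<odot>\<^bsub>?Q\<^esub> x = (s \<odot>\<^bsub>?Q\<^esub> h) \<oplus>\<^bsub>?Q\<^esub> (s \<otimes>\<^bsub>R\<^esub> r) \<odot>\<^bsub>?Q\<^esub> z'"
      by (simp add: Q.smult_r_distr Q.smult_assoc1 del: pow_module_simps)
    then show "s \<odot>\<^bsub>?Q\<^esub> x \<in> N" unfolding N_def using H'(4) * s by blast
  next
    fix x assume "x \<in> N"
    then obtain h r where *: "x = h \<oplus>\<^bsub>?Q\<^esub> r \<odot>\<^bsub>?Q\<^esub> z'" "h \<in> H" "r \<in> carrier R" unfolding N_def by blast
    then have "h \<in> carrier ?Q" using H'(1) by auto
    with * z' have "\<ominus>\<^bsub>?Q\<^esub> x = (\<ominus>\<^bsub>?Q\<^esub> h) \<oplus>\<^bsub>?Q\<^esub> (\<ominus>\<^bsub>R\<^esub> r) \<odot>\<^bsub>?Q\<^esub> z'"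
      by (simp add: Q.minus_add Q.smult_l_minus del: pow_module_simps)
    then show "\<ominus>\<^bsub>?Q\<^esub> x \<in> N" unfolding N_def using H'(3) * by blast
  qed
  let ?N = "?Q\<lparr>carrier := N\<rparr>" and ?H = "?Q\<lparr>carrier := H\<rparr>"
  have N': "module R ?N" by (rule submodule.submodule_is_module[OF Ns Q])
  have Hm: "module R ?H" by (rule submodule.submodule_is_module[OF H Q])
  interpret N: module R ?N by (rule N')
  have HinN: "submodule H R ?N"
    using N.module_incl_imp_submodule[of H] HN Hm by simp
  have iN: "(\<lambda>y. y) \<in> mod_hom R ?N ?Q" by (rule Q.mod_hom_incl[OF Nsub])
  have iH: "(\<lambda>y. y) \<in> mod_hom R ?H ?N" using HN by (intro mod_homI) auto
  have aH: "a \<in> mod_hom R ?P ?H"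
    using a unfolding mod_hom_def H_def by auto
  have aN: "a \<in> mod_hom R ?P ?N"
    using mod_hom_comp[OF aH iH] .
  have powsub: "carrier (pow_module M b) \<subseteq> {x. \<forall>k. x k \<in> carrier M}" for b
    using M.pow_module_nth by blast
  have \<kappa>Q: "inj_on \<kappa> (carrier ?Q)" by (rule inj_on_subset[OF \<kappa> powsub])
  have \<kappa>N: "inj_on \<kappa> (carrier ?N)" using inj_on_subset[OF \<kappa>Q Nsub] by simp
  have z'N: "z' \<in> N"
  proof -
    have "z' = \<zero>\<^bsub>?Q\<^esub> \<oplus>\<^bsub>?Q\<^esub> \<one>\<^bsub>R\<^esub> \<odot>\<^bsub>?Q\<^esub> z'" using z' by (simp del: pow_module_simps)
    then show ?thesis using zH unfolding N_def by blast
  qed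
  interpret bQ: module T "bc ?Q" by (rule module_bc[OF Q])
  interpret bN: module T "bc ?N" by (rule module_bc[OF N'])
  interpret bH: module T "bc ?H" by (rule module_bc[OF Hm])
  let ?m = "base_change_map R T f"
  define \<eta> where "\<eta> = bc_vec M p y"
  have \<eta>: "\<eta> \<in> carrier (bc ?P)" unfolding \<eta>_def by (rule bc_vec_closed[OF M y])
  \<comment> \<open>The q equations collected into one in T \<otimes> \<open>?Q\<close>: the base
    change of the matrix sends the encoded solution to 1 \<otimes> z'.\<close>
  have z_eq: "tens ?Q \<one>\<^bsub>T\<^esub> z' = ?m ?Q a \<eta>"
  proof (rule bc_pow_eqI[OF M _ mod_hom_closed[OF base_change_map_hom[OF P Q a] \<eta>]])
    show "tens ?Q \<one>\<^bsub>T\<^esub> z' \<in> carrier (bc ?Q)" using z' by simp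
    fix k assume k: "k < q"
    have ak: "(\<lambda>y. a y k) \<in> mod_hom R ?P M" by (rule mod_hom_comp[OF a M.pow_nth_hom])
    have "?m M (\<lambda>x. x k) (?m ?Q a \<eta>) = ?m M (\<lambda>y. a y k) \<eta>"
      by (rule base_change_map_comp[OF P Q M a M.pow_nth_hom \<eta>]) simp
    also have "\<dots> = lincomb (bc M) p (\<lambda>j. f (A k j)) y"
      unfolding \<eta>_def
      by (rule base_change_map_vec_matrix[OF M y A[OF k] ak]) (simp_all add: a_def M.matrix_map_def k)
    also have "\<dots> = tens M \<one>\<^bsub>T\<^esub> (z k)" by (rule eq[OF k, symmetric])
    also have "\<dots> = ?m M (\<lambda>x. x k) (tens ?Q \<one>\<^bsub>T\<^esub> z')"
      using k by (simp add: base_change_map_tens[OF Q M M.pow_nth_hom] z'_def)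
    finally show "?m M (\<lambda>x. x k) (tens ?Q \<one>\<^bsub>T\<^esub> z') = ?m M (\<lambda>x. x k) (?m ?Q a \<eta>)" ..
  qed
  \<comment> \<open>Read as a map onto H, \<open>a\<close> turns the solution over T into an element
    of T \<otimes> H; it will be a preimage of 1 \<otimes> z'.\<close>
  define \<theta> where "\<theta> = ?m ?H a \<eta>"
  have \<theta>: "\<theta> \<in> carrier (bc ?H)" unfolding \<theta>_def
    by (rule mod_hom_closed[OF base_change_map_hom[OF P Hm aH] \<eta>])
  note iN' = base_change_map_hom[OF N' Q iN] and iH' = base_change_map_hom[OF Hm N' iH]
  have cl: "tens ?N \<one>\<^bsub>T\<^esub> z' \<in> carrier (bc ?N)" "?m ?N (\<lambda>y. y) \<theta> \<in> carrier (bc ?N)"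
    using z'N mod_hom_closed[OF iH' \<theta>] by simp_all
  \<comment> \<open>In T \<otimes> \<open>?Q\<close> the two elements agree by \<open>z_eq\<close>.
    Flatness makes T \<otimes> N embed there, so they already agree in T \<otimes> N.\<close>
  have "tens ?N \<one>\<^bsub>T\<^esub> z' \<ominus>\<^bsub>bc ?N\<^esub> ?m ?N (\<lambda>y. y) \<theta> = \<zero>\<^bsub>bc ?N\<^esub>"
  proof (rule flat_inj[OF \<kappa>Q Q Ns])
    show "tens ?N \<one>\<^bsub>T\<^esub> z' \<ominus>\<^bsub>bc ?N\<^esub> ?m ?N (\<lambda>y. y) \<theta> \<in> carrier (bc ?N)"
      by (rule bN.minus_closed[OF cl])
    have "?m ?N (\<lambda>y. y) \<theta> = ?m ?N a \<eta>"
      unfolding \<theta>_def by (rule base_change_map_comp[OF P Hm N' aH iH \<eta>]) simp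
    then have "?m ?Q (\<lambda>y. y) (?m ?N (\<lambda>y. y) \<theta>) = ?m ?Q a \<eta>"
      using base_change_map_comp[OF P N' Q aN iN \<eta>, of a] by simp
    moreover have "?m ?Q (\<lambda>y. y) (tens ?N \<one>\<^bsub>T\<^esub> z') = tens ?Q \<one>\<^bsub>T\<^esub> z'"
      by (rule base_change_map_tens[OF N' Q iN])
    ultimately show "?m ?Q (\<lambda>y. y) (tens ?N \<one>\<^bsub>T\<^esub> z' \<ominus>\<^bsub>bc ?N\<^esub> ?m ?N (\<lambda>y. y) \<theta>) = \<zero>\<^bsub>bc ?Q\<^esub>"
      using mod_hom_minus[OF bN.module_axioms bQ.module_axioms iN' cl] z_eq
        mod_hom_closed[OF base_change_map_hom[OF P Q a] \<eta>] by (simp add: a_minus_def bQ.r_neg)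
  qed
  from bN.eq_if_minus_eq_zero[OF this cl]
  have tz: "tens ?N \<one>\<^bsub>T\<^esub> z' = ?m ?N (\<lambda>y. y) \<theta>" .
  have "carrier (bc ?N) \<subseteq> ?m ?N (\<lambda>y. y) ` carrier (bc (?N\<lparr>carrier := H\<rparr>))"
  proof
    fix v assume "v \<in> carrier (bc ?N)"
    with N' have "v \<in> ?m ?N (\<lambda>y. y) ` carrier (bc ?H)"
    proof (induction rule: bc_induct)
      case zero
      show ?case using mod_hom_zero[OF bH.module_axioms bN.module_axioms iH'] bH.zero_closed by (intro image_eqI) auto
    next
      case (add x y)
      then show ?case by (auto simp flip: mod_hom_add[OF iH'])
    next
      case (tens t n)
      \<comment> \<open>For n = h + r z' the tensor t \<otimes> n is t \<otimes> h plus the multiple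
        of 1 \<otimes> z' by t and \<open>f r\<close>; both summands come from T \<otimes>
        H.\<close>
      then obtain h r where n: "n = h \<oplus>\<^bsub>?Q\<^esub> r \<odot>\<^bsub>?Q\<^esub> z'" "h \<in> H" "r \<in> carrier R" unfolding N_def by auto
      have hN: "h \<in> carrier ?N" "z' \<in> carrier ?N" using HN n z'N by auto
      have c: "tens ?H t h \<in> carrier (bc ?H)" "(t \<otimes>\<^bsub>T\<^esub> f r) \<odot>\<^bsub>bc ?H\<^esub> \<theta> \<in> carrier (bc ?H)"
        using tens(1) n(2,3) \<theta> by simp_all
      have "tens ?N t n = tens ?N t h \<oplus>\<^bsub>bc ?N\<^esub> tens ?N t (r \<odot>\<^bsub>?N\<^esub> z')"
        using tens_add_right[OF N' tens(1) hN(1) N.smult_closed[OF n(3) hN(2)]] n(1) by simp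
      also have "tens ?N t (r \<odot>\<^bsub>?N\<^esub> z') = (t \<otimes>\<^bsub>T\<^esub> f r) \<odot>\<^bsub>bc ?N\<^esub> tens ?N \<one>\<^bsub>T\<^esub> z'"
        unfolding tens_balanced[OF N' tens(1) n(3) hN(2)] using tens(1) n(3) by (simp add: smult_tens[OF N'])
      also have "\<dots> = ?m ?N (\<lambda>y. y) ((t \<otimes>\<^bsub>T\<^esub> f r) \<odot>\<^bsub>bc ?H\<^esub> \<theta>)"
        unfolding tz using tens(1) n(3) \<theta> by (simp add: mod_hom_smult[OF iH'])
      also have "tens ?N t h = ?m ?N (\<lambda>y. y) (tens ?H t h)"
        by (simp add: base_change_map_tens[OF Hm N' iH])
      also have "?m ?N (\<lambda>y. y) (tens ?H t h) \<oplus>\<^bsub>bc ?N\<^esub> ?m ?N (\<lambda>y. y) ((t \<otimes>\<^bsub>T\<^esub> f r) \<odot>\<^bsub>bc ?H\<^esub> \<theta>) =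
          ?m ?N (\<lambda>y. y) (tens ?H t h \<oplus>\<^bsub>bc ?H\<^esub> (t \<otimes>\<^bsub>T\<^esub> f r) \<odot>\<^bsub>bc ?H\<^esub> \<theta>)"
        by (rule mod_hom_add[OF iH' c, symmetric])
      finally show ?case using bH.a_closed[OF c] by (rule image_eqI)
    qed
    then show "v \<in> ?m ?N (\<lambda>y. y) ` carrier (bc (?N\<lparr>carrier := H\<rparr>))" by simp
  qed
  then have "H = carrier ?N" by (rule faithful_surj[OF \<kappa>N N' HinN])
  then have "z' \<in> H" using z'N by simp
  then obtain u where u: "u \<in> carrier ?P" "z' = a u" unfolding H_def by blast
  have "z k = lincomb M p (A k) u" if "k < q" for k
    using fun_cong[OF u(2), of k] that by (simp add: z'_def a_def M.matrix_map_def)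
  then show ?thesis using u(1) by (intro exI[of _ u]) (auto simp: carrier_pow_module)
qed

end

section \<open>The base change of the ring itself\<close>

context ring_change
begin

text \<open>The inverse sends t to t \<otimes> 1: since r can be moved across the tensor sign, t
  \<otimes> r is the product of t and \<open>f r\<close>, tensored with 1.\<close>

lemma bc_ring_module:
  obtains \<phi> where "\<phi> \<in> mod_hom T (bc (ring_module R)) (ring_module T)"
    and "bij_betw \<phi> (carrier (bc (ring_module R))) (carrier T)"
    and "\<And>t r. t \<in> carrier T \<Longrightarrow> r \<in> carrier R \<Longrightarrow> \<phi> (tens (ring_module R) t r) = t \<otimes>\<^bsub>T\<^esub> f r"
proof -
  let ?R = "ring_module R"
  note M = R.module_ring_module and N = T.module_ring_module
  interpret M: module R ?R by (rule M)
  interpret N: module T "ring_module T" by (rule N)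
  interpret B: module T "bc ?R" by (rule module_bc[OF M])
  have N': "abelian_group (ring_module T)" by unfold_locales
  obtain \<phi> where \<phi>: "\<And>x. x \<in> carrier (bc ?R) \<Longrightarrow> \<phi> x \<in> carrier (ring_module T)"
    "\<And>x y. x \<in> carrier (bc ?R) \<Longrightarrow> y \<in> carrier (bc ?R) \<Longrightarrow> \<phi> (x \<oplus>\<^bsub>bc ?R\<^esub> y) = \<phi> x \<oplus>\<^bsub>ring_module T\<^esub> \<phi> y"
    "\<And>t m. t \<in> carrier T \<Longrightarrow> m \<in> carrier ?R \<Longrightarrow> \<phi> (tens ?R t m) = t \<otimes>\<^bsub>T\<^esub> f m"
    by (rule bc_universal[OF M N', of "\<lambda>t r. t \<otimes>\<^bsub>T\<^esub> f r"])
      (auto simp: T.l_distr T.r_distr f_add f_mult T.m_assoc)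
  have zero: "\<phi> \<zero>\<^bsub>bc ?R\<^esub> = \<zero>\<^bsub>T\<^esub>"
    using \<phi>(2)[OF B.zero_closed B.zero_closed] \<phi>(1)[OF B.zero_closed] by simp
  have hom: "\<phi> \<in> mod_hom T (bc ?R) (ring_module T)"
  proof (rule mod_homI)
    fix s x assume s: "s \<in> carrier T" and x: "x \<in> carrier (bc ?R)"
    from M x show "\<phi> (s \<odot>\<^bsub>bc ?R\<^esub> x) = s \<odot>\<^bsub>ring_module T\<^esub> \<phi> x"
    proof (induction rule: bc_induct)
      case zero
      then show ?case using s by (simp add: \<open>\<phi> \<zero>\<^bsub>bc ?R\<^esub> = \<zero>\<^bsub>T\<^esub>\<close>)
    next
      case (tens t m)
      then show ?case using s \<phi>(3) by (simp add: smult_tens[OF M] T.m_assoc)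
    next
      case (add x y)
      then show ?case using s \<phi>(1,2) by (simp add: B.smult_r_distr T.r_distr)
    qed
  qed (use \<phi> in auto)
  have "tens ?R (\<phi> x) \<one>\<^bsub>R\<^esub> = x" if "x \<in> carrier (bc ?R)" for x
    using M that
  proof (induction rule: bc_induct)
    case zero
    then show ?case using zero tens_zero_left[OF M, of "\<one>\<^bsub>R\<^esub>"] by (simp add: \<open>\<phi> \<zero>\<^bsub>bc ?R\<^esub> = \<zero>\<^bsub>T\<^esub>\<close>)
  next
    case (tens t r)
    then show ?case using \<phi>(3) tens_balanced[OF M tens(1), of r "\<one>\<^bsub>R\<^esub>"] by simp
  next
    case (add x y)
    then show ?case using \<phi>(1,2) by (simp add: tens_add_left[OF M])
  qed
  moreover have "\<phi> (tens ?R t \<one>\<^bsub>R\<^esub>) = t" if "t \<in> carrier T" for t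
    using \<phi>(3)[OF that, of "\<one>\<^bsub>R\<^esub>"] that by simp
  ultimately have "bij_betw \<phi> (carrier (bc ?R)) (carrier T)"
    using \<phi>(1) by (intro bij_betw_byWitness[where f' = "\<lambda>t. tens ?R t \<one>\<^bsub>R\<^esub>"]) auto
  then show thesis using hom \<phi>(3) by (intro that) auto
qed

end

section \<open>Comparison of free resolutions\<close>

lemma (in cring) module_res_mod: "module R (res_mod R P i)"
  unfolding res_mod_def by (rule module_free_module)

lemma free_resolutionD:
  assumes "is_free_resolution R A P"
  shows "res_diff P i \<in> mod_hom R (res_mod R P (Suc i)) (res_mod R P i)"
    and "res_aug P \<in> mod_hom R (res_mod R P 0) A"
    and "x \<in> carrier (res_mod R P (Suc i)) \<Longrightarrow> res_diff P i x = \<zero>\<^bsub>res_mod R P i\<^esub> \<longleftrightarrow>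
      x \<in> res_diff P (Suc i) ` carrier (res_mod R P (Suc (Suc i)))"
    and "x \<in> carrier (res_mod R P 0) \<Longrightarrow> res_aug P x = \<zero>\<^bsub>A\<^esub> \<longleftrightarrow>
      x \<in> res_diff P 0 ` carrier (res_mod R P (Suc 0))"
    and "res_aug P ` carrier (res_mod R P 0) = carrier A"
  using assms unfolding is_free_resolution_def exact_at_def by (blast, blast, blast, blast, blast)

lemma free_resolution_diff_diff:
  assumes "is_free_resolution R A P" "x \<in> carrier (res_mod R P (Suc (Suc i)))"
  shows "res_diff P i (res_diff P (Suc i) x) = \<zero>\<^bsub>res_mod R P i\<^esub>"
  using free_resolutionD(3)[OF assms(1)] mod_hom_closed[OF free_resolutionD(1)[OF assms(1)]] assms(2)
  by blast

lemma free_resolution_aug_diff: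
  assumes "is_free_resolution R A P" "x \<in> carrier (res_mod R P (Suc 0))"
  shows "res_aug P (res_diff P 0 x) = \<zero>\<^bsub>A\<^esub>"
  using free_resolutionD(4)[OF assms(1)] mod_hom_closed[OF free_resolutionD(1)[OF assms(1)]] assms(2)
  by blast

lemma is_liftD:
  assumes "is_lift R Q P u \<phi>"
  shows "\<phi> i \<in> mod_hom R (res_mod R Q i) (res_mod R P i)"
    and "x \<in> carrier (res_mod R Q 0) \<Longrightarrow> res_aug P (\<phi> 0 x) = u (res_aug Q x)"
    and "x \<in> carrier (res_mod R Q (Suc i)) \<Longrightarrow> res_diff P i (\<phi> (Suc i) x) = \<phi> i (res_diff Q i x)"
  using assms unfolding is_lift_def by auto

lemma res_lift:
  assumes B: "module R B" and C: "module R C" and g: "g \<in> mod_hom R B C"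
    and h: "h \<in> mod_hom R (res_mod R Q i) C"
    and im: "\<And>x. x \<in> carrier (res_mod R Q i) \<Longrightarrow> h x \<in> g ` carrier B"
  shows "\<exists>k \<in> mod_hom R (res_mod R Q i) B. \<forall>v\<in>carrier (res_mod R Q i). g (k v) = h v"
proof -
  interpret B: module R B by fact
  show ?thesis
    using h im unfolding res_mod_def
    by (intro free_lift[OF B C g]) (simp_all add: B.R.unit_vec_closed)
qed

text \<open>The comparison theorem: the lift is built degree by degree, since the terms of Q are
  free and P is exact.\<close>

lemma lift_exists:
  assumes A: "module R A" and B: "module R B" and P: "is_free_resolution R A P"
    and Q: "is_free_resolution R B Q" and u: "u \<in> mod_hom R B A"
  shows "\<exists>\<phi>. is_lift R Q P u \<phi>"
proof -
  interpret A: module R A by fact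
  note m = A.R.module_res_mod
  note p = free_resolutionD[OF P] and q = free_resolutionD[OF Q]
  \<comment> \<open>What the next component needs to know about the present one: in degree 0 it
    covers \<open>u\<close>, in degree j + 1 it sends cycles to cycles. The latter follows from the
    chain map equation but mentions no earlier component, as \<open>dependent_nat_choice\<close>
    demands.\<close>
  define good where "good i g \<longleftrightarrow> g \<in> mod_hom R (res_mod R Q i) (res_mod R P i) \<and>
    (case i of 0 \<Rightarrow> \<forall>x\<in>carrier (res_mod R Q 0). res_aug P (g x) = u (res_aug Q x)
      | Suc j \<Rightarrow> \<forall>x\<in>carrier (res_mod R Q (Suc j)).
          res_diff Q j x = \<zero>\<^bsub>res_mod R Q j\<^esub> \<longrightarrow> res_diff P j (g x) = \<zero>\<^bsub>res_mod R P j\<^esub>)" for i g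
  have "\<exists>\<phi>. \<forall>i. good i (\<phi> i) \<and>
    (\<forall>x\<in>carrier (res_mod R Q (Suc i)). res_diff P i (\<phi> (Suc i) x) = \<phi> i (res_diff Q i x))"
  proof (rule dependent_nat_choice)
    have "(\<lambda>x. u (res_aug Q x)) \<in> mod_hom R (res_mod R Q 0) A"
      by (rule mod_hom_comp[OF q(2) u])
    then have "\<exists>k\<in>mod_hom R (res_mod R Q 0) (res_mod R P 0). \<forall>v\<in>carrier (res_mod R Q 0). res_aug P (k v) = u (res_aug Q v)"
      using mod_hom_closed[OF u mod_hom_closed[OF q(2)]] unfolding p(5)[symmetric]
      by (rule res_lift[OF m A p(2)])
    then show "\<exists>g. good 0 g" by (auto simp: good_def)
  next
    fix g i assume g: "good i g"
    then have gh: "g \<in> mod_hom R (res_mod R Q i) (res_mod R P i)" by (simp add: good_def)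
    have h: "(\<lambda>x. g (res_diff Q i x)) \<in> mod_hom R (res_mod R Q (Suc i)) (res_mod R P i)"
      by (rule mod_hom_comp[OF q(1) gh])
    have im: "g (res_diff Q i x) \<in> res_diff P i ` carrier (res_mod R P (Suc i))"
      if x: "x \<in> carrier (res_mod R Q (Suc i))" for x
    proof (cases i)
      case 0
      have "res_aug P (g (res_diff Q 0 x)) = u (res_aug Q (res_diff Q 0 x))"
        using g mod_hom_closed[OF q(1) x] 0 by (simp add: good_def)
      also have "\<dots> = \<zero>\<^bsub>A\<^esub>"
        using free_resolution_aug_diff[OF Q] x 0 mod_hom_zero[OF B A u] by simp
      finally show ?thesis using p(4) mod_hom_closed[OF h x] 0 by simp
    next
      case (Suc j)
      have "res_diff P j (g (res_diff Q i x)) = \<zero>\<^bsub>res_mod R P j\<^esub>"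
        using g mod_hom_closed[OF q(1) x] free_resolution_diff_diff[OF Q] x Suc by (simp add: good_def)
      then show ?thesis using p(3) mod_hom_closed[OF h x] Suc by simp
    qed
    have "\<exists>k\<in>mod_hom R (res_mod R Q (Suc i)) (res_mod R P (Suc i)).
        \<forall>v\<in>carrier (res_mod R Q (Suc i)). res_diff P i (k v) = g (res_diff Q i v)"
      by (rule res_lift[OF m m p(1) h im])
    then obtain k where k: "k \<in> mod_hom R (res_mod R Q (Suc i)) (res_mod R P (Suc i))"
      "\<And>v. v \<in> carrier (res_mod R Q (Suc i)) \<Longrightarrow> res_diff P i (k v) = g (res_diff Q i v)" by blast
    then have "good (Suc i) k"
      using mod_hom_zero[OF m m gh] by (simp add: good_def)
    then show "\<exists>k. good (Suc i) k \<and> (\<forall>x\<in>carrier (res_mod R Q (Suc i)). res_diff P i (k x) = g (res_diff Q i x))"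
      using k(2) by blast
  qed
  then obtain \<phi> where \<phi>: "\<And>i. good i (\<phi> i)"
    "\<And>i x. x \<in> carrier (res_mod R Q (Suc i)) \<Longrightarrow> res_diff P i (\<phi> (Suc i) x) = \<phi> i (res_diff Q i x)"
    by blast
  have "is_lift R Q P u \<phi>"
    unfolding is_lift_def using \<phi>(1)[unfolded good_def] \<phi>(1)[of 0, unfolded good_def] \<phi>(2) by simp
  then show ?thesis by blast
qed

lemma lift_id: "is_lift R P P (\<lambda>x. x) (\<lambda>i x. x)"
  by (auto simp: is_lift_def mod_hom_def)

lemma lift_comp:
  assumes "is_lift R Q P u \<phi>" "is_lift R S Q v \<psi>"
    and "\<And>x. x \<in> carrier (res_mod R S 0) \<Longrightarrow> w (res_aug S x) = u (v (res_aug S x))"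
  shows "is_lift R S P w (\<lambda>i x. \<phi> i (\<psi> i x))"
proof -
  note l = is_liftD[OF assms(1)] and k = is_liftD[OF assms(2)]
  show ?thesis
    unfolding is_lift_def
  proof (intro conjI allI ballI)
    show "(\<lambda>x. \<phi> i (\<psi> i x)) \<in> mod_hom R (res_mod R S i) (res_mod R P i)" for i
      by (rule mod_hom_comp[OF k(1) l(1)])
    show "res_aug P (\<phi> 0 (\<psi> 0 x)) = w (res_aug S x)" if "x \<in> carrier (res_mod R S 0)" for x
      using l(2)[OF mod_hom_closed[OF k(1) that]] k(2)[OF that] assms(3)[OF that] by simp
    show "res_diff P i (\<phi> (Suc i) (\<psi> (Suc i) x)) = \<phi> i (\<psi> i (res_diff S i x))"
      if "x \<in> carrier (res_mod R S (Suc i))" for i x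
      using l(3)[OF mod_hom_closed[OF k(1) that]] k(3)[OF that] by simp
  qed
qed

section \<open>Cocycles and coboundaries of Hom(P, M), and homotopy invariance\<close>

definition ext_cocycle :: "('r, 'p) ring_scheme \<Rightarrow> ('r, 'a) free_res \<Rightarrow> nat \<Rightarrow> ('r, 'n, 'y) module_scheme
    \<Rightarrow> ((nat \<Rightarrow> 'r) \<Rightarrow> 'n) \<Rightarrow> bool"
  where "ext_cocycle R P i N h \<longleftrightarrow> h \<in> mod_hom R (res_mod R P i) N \<and>
    (\<forall>x\<in>carrier (res_mod R P (Suc i)). h (res_diff P i x) = \<zero>\<^bsub>N\<^esub>)"

text \<open>In contrast to \<open>cocycles\<close> and \<open>coboundaries\<close>, this predicate
  and \<open>ext_cocycle\<close> do not ask for extensional functions, so that composites and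
  differences can be written as plain abstractions. No differential leads into degree 0 of Hom(P,
  M), so a coboundary there is a map that vanishes on the carrier.\<close>

definition ext_coboundary :: "('r, 'p) ring_scheme \<Rightarrow> ('r, 'a) free_res \<Rightarrow> nat \<Rightarrow> ('r, 'n, 'y) module_scheme
    \<Rightarrow> ((nat \<Rightarrow> 'r) \<Rightarrow> 'n) \<Rightarrow> bool"
  where "ext_coboundary R P i N h \<longleftrightarrow>
    (case i of 0 \<Rightarrow> \<forall>x\<in>carrier (res_mod R P 0). h x = \<zero>\<^bsub>N\<^esub>
      | Suc j \<Rightarrow> \<exists>g\<in>mod_hom R (res_mod R P j) N. \<forall>x\<in>carrier (res_mod R P (Suc j)). h x = g (res_diff P j x))"

lemma ext_coboundary_cong:
  "(\<And>x. x \<in> carrier (res_mod R P i) \<Longrightarrow> h x = h' x) \<Longrightarrow>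
    ext_coboundary R P i N h \<longleftrightarrow> ext_coboundary R P i N h'"
  by (auto simp: ext_coboundary_def split: nat.split)

context module
begin

lemma ext_cocycle_zero: "ext_cocycle R P i M (\<lambda>_. \<zero>\<^bsub>M\<^esub>)"
  using mod_hom_const_zero[OF R.module_res_mod module_axioms] by (simp add: ext_cocycle_def)

lemma ext_coboundary_zero: "ext_coboundary R P i M (\<lambda>_. \<zero>\<^bsub>M\<^esub>)"
  using mod_hom_const_zero[OF R.module_res_mod module_axioms]
  by (cases i) (auto simp: ext_coboundary_def intro!: bexI[of _ "\<lambda>_. \<zero>\<^bsub>M\<^esub>"])

lemma ext_coboundary_diff:
  assumes "ext_coboundary R P i M h" "ext_coboundary R P i M h'"
  shows "ext_coboundary R P i M (\<lambda>x. h x \<ominus>\<^bsub>M\<^esub> h' x)"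
proof (cases i)
  case 0
  then show ?thesis using assms by (simp add: ext_coboundary_def a_minus_def)
next
  case (Suc j)
  from assms obtain g g' where g: "g \<in> mod_hom R (res_mod R P j) M" "g' \<in> mod_hom R (res_mod R P j) M"
    "\<forall>x\<in>carrier (res_mod R P (Suc j)). h x = g (res_diff P j x)"
    "\<forall>x\<in>carrier (res_mod R P (Suc j)). h' x = g' (res_diff P j x)"
    unfolding ext_coboundary_def Suc by auto
  then show ?thesis unfolding ext_coboundary_def Suc
    using mod_hom_diff[OF R.module_res_mod module_axioms g(1,2)] by (auto intro!: bexI)
qed

lemma ext_coboundary_trans:
  assumes "ext_coboundary R P i M (\<lambda>x. h x \<ominus>\<^bsub>M\<^esub> h' x)" "ext_coboundary R P i M h'"
    and "h \<in> mod_hom R (res_mod R P i) M" "h' \<in> mod_hom R (res_mod R P i) M"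
  shows "ext_coboundary R P i M h"
proof -
  \<comment> \<open>Closure under differences is used twice: h is (h - h') - (0 - h').\<close>
  have 1: "ext_coboundary R P i M (\<lambda>x. (h x \<ominus>\<^bsub>M\<^esub> h' x) \<ominus>\<^bsub>M\<^esub> (\<zero>\<^bsub>M\<^esub> \<ominus>\<^bsub>M\<^esub> h' x))"
    by (rule ext_coboundary_diff[OF assms(1) ext_coboundary_diff[OF ext_coboundary_zero assms(2)]])
  have *: "(h x \<ominus>\<^bsub>M\<^esub> h' x) \<ominus>\<^bsub>M\<^esub> (\<zero>\<^bsub>M\<^esub> \<ominus>\<^bsub>M\<^esub> h' x) = h x" if "x \<in> carrier (res_mod R P i)" for x
    using mod_hom_closed[OF assms(3) that] mod_hom_closed[OF assms(4) that]
    by (simp add: a_minus_def M.a_assoc M.l_neg)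
  have "ext_coboundary R P i M (\<lambda>x. (h x \<ominus>\<^bsub>M\<^esub> h' x) \<ominus>\<^bsub>M\<^esub> (\<zero>\<^bsub>M\<^esub> \<ominus>\<^bsub>M\<^esub> h' x)) \<longleftrightarrow>
      ext_coboundary R P i M h"
    by (rule ext_coboundary_cong) (rule *)
  with 1 show ?thesis by blast
qed

lemma ext_cocycle_pullback:
  assumes "is_lift R Q P u \<phi>" "ext_cocycle R P i M h"
    and "is_free_resolution R B Q"
  shows "ext_cocycle R Q i M (\<lambda>x. h (\<phi> i x))"
proof -
  note l = is_liftD[OF assms(1)]
  have "h (\<phi> i (res_diff Q i x)) = \<zero>\<^bsub>M\<^esub>" if "x \<in> carrier (res_mod R Q (Suc i))" for x
    using l(3)[OF that] mod_hom_closed[OF l(1) that] assms(2) by (simp add: ext_cocycle_def flip: l(3)[OF that])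
  moreover have "h \<in> mod_hom R (res_mod R P i) M" using assms(2) by (simp add: ext_cocycle_def)
  ultimately show ?thesis
    using mod_hom_comp[OF l(1)] unfolding ext_cocycle_def by blast
qed

lemma ext_coboundary_pullback:
  assumes "is_lift R Q P u \<phi>" "ext_coboundary R P i M h"
    and "is_free_resolution R B Q"
  shows "ext_coboundary R Q i M (\<lambda>x. h (\<phi> i x))"
proof (cases i)
  case 0
  then show ?thesis
    using assms mod_hom_closed[OF is_liftD(1)[OF assms(1)]] by (simp add: ext_coboundary_def)
next
  case (Suc j)
  note l = is_liftD[OF assms(1)]
  from assms obtain g where g: "g \<in> mod_hom R (res_mod R P j) M"
    "\<forall>x\<in>carrier (res_mod R P (Suc j)). h x = g (res_diff P j x)"
    unfolding ext_coboundary_def Suc by auto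
  have "h (\<phi> i x) = g (\<phi> j (res_diff Q j x))" if "x \<in> carrier (res_mod R Q (Suc j))" for x
    using g(2) mod_hom_closed[OF l(1) that] l(3)[OF that] Suc by simp
  then show ?thesis
    unfolding ext_coboundary_def Suc using mod_hom_comp[OF l(1) g(1)] by (auto intro!: bexI)
qed

text \<open>Two lifts of the same map are homotopic; only the effect on cocycles is needed, so the
  homotopy is constructed just up to the degree at hand.\<close>

lemma lift_homotopic:
  assumes A: "module R A" and P: "is_free_resolution R A P" and Q: "is_free_resolution R B Q"
    and \<phi>: "is_lift R Q P u \<phi>" and \<psi>: "is_lift R Q P u \<psi>" and h: "ext_cocycle R P i M h"
  shows "ext_coboundary R Q i M (\<lambda>x. h (\<phi> i x) \<ominus>\<^bsub>M\<^esub> h (\<psi> i x))"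
proof -
  interpret A: module R A by fact
  note m = R.module_res_mod
  note p = free_resolutionD[OF P] and q = free_resolutionD[OF Q]
  note l = is_liftD[OF \<phi>] and k = is_liftD[OF \<psi>]
  \<comment> \<open>The difference of the two lifts is a chain map over the zero map; the homotopy
    contracts it.\<close>
  define \<theta> where "\<theta> i x = \<phi> i x \<ominus>\<^bsub>res_mod R P i\<^esub> \<psi> i x" for i x
  have \<theta>: "\<theta> i \<in> mod_hom R (res_mod R Q i) (res_mod R P i)" for i
    unfolding \<theta>_def by (rule mod_hom_diff[OF m m l(1) k(1)])
  have d\<theta>: "res_diff P i (\<theta> (Suc i) x) = \<theta> i (res_diff Q i x)" if "x \<in> carrier (res_mod R Q (Suc i))" for i x
    unfolding \<theta>_def using l(3) k(3) mod_hom_closed[OF l(1) that] mod_hom_closed[OF k(1) that] that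
    by (simp add: mod_hom_minus[OF m m p(1)])
  have a\<theta>: "res_aug P (\<theta> 0 x) = \<zero>\<^bsub>A\<^esub>" if "x \<in> carrier (res_mod R Q 0)" for x
    unfolding \<theta>_def mod_hom_minus[OF m A p(2) mod_hom_closed[OF l(1) that] mod_hom_closed[OF k(1) that]]
    using l(2)[OF that] k(2)[OF that] mod_hom_closed[OF p(2) mod_hom_closed[OF l(1) that]]
    by (simp add: a_minus_def A.r_neg)
  have dd: "res_diff P i (res_diff P (Suc i) x) = \<zero>\<^bsub>res_mod R P i\<^esub>" if "x \<in> carrier (res_mod R P (Suc (Suc i)))" for i x
    by (rule free_resolution_diff_diff[OF P that])
  have base: "\<exists>s\<in>mod_hom R (res_mod R Q 0) (res_mod R P (Suc 0)).
      \<forall>x\<in>carrier (res_mod R Q 0). res_diff P 0 (s x) = \<theta> 0 x"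
    using p(4)[OF mod_hom_closed[OF \<theta>]] a\<theta> by (intro res_lift[OF m m p(1) \<theta>]) blast
  have step: "\<exists>s\<in>mod_hom R (res_mod R Q (Suc j)) (res_mod R P (Suc (Suc j))).
      \<forall>x\<in>carrier (res_mod R Q (Suc j)). res_diff P (Suc j) (s x) = \<theta> (Suc j) x \<ominus>\<^bsub>res_mod R P (Suc j)\<^esub> t (res_diff Q j x)"
    if t: "t \<in> mod_hom R (res_mod R Q j) (res_mod R P (Suc j))"
      and tt: "\<And>x. x \<in> carrier (res_mod R Q (Suc j)) \<Longrightarrow>
        res_diff P j (t (res_diff Q j x)) = \<theta> j (res_diff Q j x)" for j t
  proof -
    have g: "(\<lambda>x. \<theta> (Suc j) x \<ominus>\<^bsub>res_mod R P (Suc j)\<^esub> t (res_diff Q j x)) \<in> mod_hom R (res_mod R Q (Suc j)) (res_mod R P (Suc j))"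
      using mod_hom_diff[OF m m \<theta> mod_hom_comp[OF q(1) t]] .
    have "\<theta> (Suc j) x \<ominus>\<^bsub>res_mod R P (Suc j)\<^esub> t (res_diff Q j x) \<in> res_diff P (Suc j) ` carrier (res_mod R P (Suc (Suc j)))"
      if x: "x \<in> carrier (res_mod R Q (Suc j))" for x
    proof -
      interpret Pj: module R "res_mod R P j" by (rule m)
      have "res_diff P j (\<theta> (Suc j) x \<ominus>\<^bsub>res_mod R P (Suc j)\<^esub> t (res_diff Q j x)) =
          \<theta> j (res_diff Q j x) \<ominus>\<^bsub>res_mod R P j\<^esub> \<theta> j (res_diff Q j x)"
        using x tt[OF x] d\<theta>[of x j] mod_hom_closed[OF \<theta> x] mod_hom_closed[OF t mod_hom_closed[OF q(1)], of x]
        by (simp add: mod_hom_minus[OF m m p(1)])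
      also have "\<dots> = \<zero>\<^bsub>res_mod R P j\<^esub>"
        using mod_hom_closed[OF \<theta> mod_hom_closed[OF q(1)], of x j] x by (simp add: a_minus_def Pj.r_neg)
      finally show ?thesis using p(3)[of _ j] mod_hom_closed[OF g x] by simp
    qed
    then show ?thesis by (rule res_lift[OF m m p(1) g])
  qed
  \<comment> \<open>Only two consecutive components of the homotopy are remembered: s is built from
    the preceding t, and both occur in the homotopy equation of the degree at hand.\<close>
  have homotopy: "\<exists>s t. s \<in> mod_hom R (res_mod R Q (Suc j)) (res_mod R P (Suc (Suc j))) \<and>
      t \<in> mod_hom R (res_mod R Q j) (res_mod R P (Suc j)) \<and>
      (\<forall>x\<in>carrier (res_mod R Q (Suc j)). res_diff P (Suc j) (s x) = \<theta> (Suc j) x \<ominus>\<^bsub>res_mod R P (Suc j)\<^esub> t (res_diff Q j x))" for j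
  proof (induction j)
    case 0
    obtain t where t: "t \<in> mod_hom R (res_mod R Q 0) (res_mod R P (Suc 0))"
      "\<And>x. x \<in> carrier (res_mod R Q 0) \<Longrightarrow> res_diff P 0 (t x) = \<theta> 0 x" using base by blast
    have "\<And>x. x \<in> carrier (res_mod R Q (Suc 0)) \<Longrightarrow> res_diff P 0 (t (res_diff Q 0 x)) = \<theta> 0 (res_diff Q 0 x)"
      using t(2) mod_hom_closed[OF q(1)] by blast
    from step[OF t(1) this] show ?case using t(1) by blast
  next
    case (Suc j)
    then obtain s t where st: "s \<in> mod_hom R (res_mod R Q (Suc j)) (res_mod R P (Suc (Suc j)))"
      "t \<in> mod_hom R (res_mod R Q j) (res_mod R P (Suc j))"
      "\<And>x. x \<in> carrier (res_mod R Q (Suc j)) \<Longrightarrow>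
        res_diff P (Suc j) (s x) = \<theta> (Suc j) x \<ominus>\<^bsub>res_mod R P (Suc j)\<^esub> t (res_diff Q j x)" by blast
    have "res_diff P (Suc j) (s (res_diff Q (Suc j) x)) = \<theta> (Suc j) (res_diff Q (Suc j) x)"
      if x: "x \<in> carrier (res_mod R Q (Suc (Suc j)))" for x
    proof -
      interpret Pj: module R "res_mod R P (Suc j)" by (rule m)
      have dx: "res_diff Q (Suc j) x \<in> carrier (res_mod R Q (Suc j))" by (rule mod_hom_closed[OF q(1) x])
      have "t (res_diff Q j (res_diff Q (Suc j) x)) = \<zero>\<^bsub>res_mod R P (Suc j)\<^esub>"
        unfolding free_resolution_diff_diff[OF Q x] by (rule mod_hom_zero[OF m m st(2)])
      then show ?thesis using st(3)[OF dx] mod_hom_closed[OF \<theta> dx] by (simp add: a_minus_def)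
    qed
    from step[OF st(1) this] show ?case using st(1) by blast
  qed
  have hd: "h (res_diff P i x) = \<zero>\<^bsub>M\<^esub>" if "x \<in> carrier (res_mod R P (Suc i))" for x
    using h that by (simp add: ext_cocycle_def)
  have hh: "h \<in> mod_hom R (res_mod R P i) M" using h by (simp add: ext_cocycle_def)
  have h\<theta>: "h (\<phi> i x) \<ominus>\<^bsub>M\<^esub> h (\<psi> i x) = h (\<theta> i x)" if "x \<in> carrier (res_mod R Q i)" for x
    unfolding \<theta>_def using mod_hom_closed[OF l(1) that] mod_hom_closed[OF k(1) that]
    by (simp add: mod_hom_minus[OF m module_axioms hh])
  show ?thesis
  proof (cases i)
    case 0
    obtain s where s: "s \<in> mod_hom R (res_mod R Q 0) (res_mod R P (Suc 0))"
      "\<And>x. x \<in> carrier (res_mod R Q 0) \<Longrightarrow> res_diff P 0 (s x) = \<theta> 0 x" using base by blast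
    have "h (\<phi> i x) \<ominus>\<^bsub>M\<^esub> h (\<psi> i x) = \<zero>\<^bsub>M\<^esub>" if "x \<in> carrier (res_mod R Q 0)" for x
      using h\<theta>[of x] hd[of "s x"] mod_hom_closed[OF s(1) that] s(2)[OF that] that 0 by simp
    then show ?thesis using 0 by (simp add: ext_coboundary_def)
  next
    case (Suc j)
    obtain s t where st: "s \<in> mod_hom R (res_mod R Q (Suc j)) (res_mod R P (Suc (Suc j)))"
      "t \<in> mod_hom R (res_mod R Q j) (res_mod R P (Suc j))"
      "\<And>x. x \<in> carrier (res_mod R Q (Suc j)) \<Longrightarrow>
        res_diff P (Suc j) (s x) = \<theta> (Suc j) x \<ominus>\<^bsub>res_mod R P (Suc j)\<^esub> t (res_diff Q j x)"
      using homotopy by blast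
    have ht: "(\<lambda>x. h (t x)) \<in> mod_hom R (res_mod R Q j) M"
      using mod_hom_comp[OF st(2)] hh Suc by simp
    have "h (\<phi> i x) \<ominus>\<^bsub>M\<^esub> h (\<psi> i x) = h (t (res_diff Q j x))" if x: "x \<in> carrier (res_mod R Q (Suc j))" for x
    proof -
      have tx: "t (res_diff Q j x) \<in> carrier (res_mod R P (Suc j))"
        by (rule mod_hom_closed[OF st(2) mod_hom_closed[OF q(1) x]])
      have "\<zero>\<^bsub>M\<^esub> = h (\<theta> i x \<ominus>\<^bsub>res_mod R P i\<^esub> t (res_diff Q j x))"
        using hd[of "s x"] st(3)[OF x] mod_hom_closed[OF st(1) x] Suc by simp
      also have "\<dots> = h (\<theta> i x) \<ominus>\<^bsub>M\<^esub> h (t (res_diff Q j x))"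
        using tx mod_hom_closed[OF \<theta>, of x i] x Suc
        by (simp add: mod_hom_minus[OF m module_axioms hh[unfolded Suc]])
      finally have 1: "h (\<theta> i x) \<ominus>\<^bsub>M\<^esub> h (t (res_diff Q j x)) = \<zero>\<^bsub>M\<^esub>" ..
      \<comment> \<open>A cocycle vanishes on the image of the next differential, so the homotopy
        equation leaves h \<theta> = h t d, and h t is the required primitive.\<close>
      have "h (\<theta> i x) = h (t (res_diff Q j x))"
        using M.eq_if_minus_eq_zero[OF 1] mod_hom_closed[OF hh] tx mod_hom_closed[OF \<theta>, of x i] x Suc by simp
      then show ?thesis using h\<theta>[of x] x Suc by simp
    qed
    then show ?thesis using ht Suc by (auto simp: ext_coboundary_def intro!: bexI)
  qed
qed

end

section \<open>Ext as a set of classes of cocycles, and its induced maps\<close>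

lemma restrict_hom_module:
  assumes "module R A" "h \<in> mod_hom R A N"
  shows "restrict h (carrier A) \<in> carrier (hom_module R A N)"
proof -
  interpret A: module R A by fact
  have "restrict h (carrier A) \<in> mod_hom R A N"
    using mod_hom_closed[OF assms(2)] mod_hom_add[OF assms(2)] mod_hom_smult[OF assms(2)]
    by (intro mod_homI) auto
  then show ?thesis by (simp add: hom_module_def)
qed

lemma carrier_hom_module:
  "h \<in> carrier (hom_module R A N) \<longleftrightarrow> h \<in> mod_hom R A N \<and> h \<in> extensional (carrier A)"
  by (simp add: hom_module_def)

text \<open>The class of z in Ext. Its members are extensional as in \<open>hom_module\<close>,
  while z itself may take any values outside the carrier.\<close>

definition ext_coset :: "('r, 'p) ring_scheme \<Rightarrow> ('r, 'a) free_res \<Rightarrow> nat \<Rightarrow> ('r, 'n, 'y) module_scheme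
    \<Rightarrow> ((nat \<Rightarrow> 'r) \<Rightarrow> 'n) \<Rightarrow> ((nat \<Rightarrow> 'r) \<Rightarrow> 'n) set"
  where "ext_coset R P i N z =
    {h \<in> carrier (hom_module R (res_mod R P i) N). ext_coboundary R P i N (\<lambda>x. h x \<ominus>\<^bsub>N\<^esub> z x)}"

lemma (in abelian_group) diff_diff_same:
  assumes "a \<in> carrier G" "b \<in> carrier G" "c \<in> carrier G"
  shows "(a \<ominus> c) \<ominus> (a \<ominus> b) = b \<ominus> c"
proof -
  have "(a \<ominus> c) \<ominus> (a \<ominus> b) = (\<ominus> a \<oplus> a) \<oplus> (b \<ominus> c)"
    using assms by (simp add: minus_eq minus_add a_ac)
  then show ?thesis using assms by (simp add: l_neg)
qed

context module
begin

lemma mem_coboundaries: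
  assumes P: "is_free_resolution R A P"
  shows "h \<in> coboundaries R P i M \<longleftrightarrow>
    h \<in> carrier (hom_module R (res_mod R P i) M) \<and> ext_coboundary R P i M h"
proof (cases i)
  case 0
  have "restrict (\<lambda>_. \<zero>\<^bsub>M\<^esub>) (carrier (res_mod R P 0)) \<in> carrier (hom_module R (res_mod R P 0) M)"
    by (rule restrict_hom_module[OF R.module_res_mod mod_hom_const_zero[OF R.module_res_mod module_axioms]])
  moreover have "h = restrict (\<lambda>_. \<zero>\<^bsub>M\<^esub>) (carrier (res_mod R P 0)) \<longleftrightarrow>
      h \<in> extensional (carrier (res_mod R P 0)) \<and> (\<forall>x\<in>carrier (res_mod R P 0). h x = \<zero>\<^bsub>M\<^esub>)"
    by (auto simp: fun_eq_iff extensional_def restrict_def)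
  ultimately show ?thesis using 0
    by (auto simp: coboundaries_def ext_coboundary_def carrier_hom_module) (auto simp: hom_module_def)
next
  case (Suc j)
  note d = free_resolutionD(1)[OF P]
  show ?thesis
  proof
    assume "h \<in> coboundaries R P i M"
    then obtain g where g: "g \<in> mod_hom R (res_mod R P j) M"
      "h = (\<lambda>x\<in>carrier (res_mod R P (Suc j)). g (res_diff P j x))"
      unfolding coboundaries_def Suc by (auto simp: carrier_hom_module)
    then show "h \<in> carrier (hom_module R (res_mod R P i) M) \<and> ext_coboundary R P i M h"
      using restrict_hom_module[OF R.module_res_mod mod_hom_comp[OF d g(1)]] Suc
      by (auto simp: ext_coboundary_def)
  next
    assume h: "h \<in> carrier (hom_module R (res_mod R P i) M) \<and> ext_coboundary R P i M h"
    then obtain g where g: "g \<in> mod_hom R (res_mod R P j) M"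
      "\<forall>x\<in>carrier (res_mod R P (Suc j)). h x = g (res_diff P j x)"
      unfolding ext_coboundary_def Suc by auto
    have "h = (\<lambda>x\<in>carrier (res_mod R P (Suc j)). restrict g (carrier (res_mod R P j)) (res_diff P j x))"
      using h g(2) mod_hom_closed[OF d] Suc
      by (intro extensionalityI[of _ "carrier (res_mod R P (Suc j))"]) (auto simp: carrier_hom_module)
    then show "h \<in> coboundaries R P i M"
      using restrict_hom_module[OF R.module_res_mod g(1)] unfolding coboundaries_def Suc nat.case
      by (rule image_eqI)
  qed
qed

text \<open>Identifies the additive coset formed in \<open>hom_module\<close> with the class of z.
  The representative \<open>w\<close> is free outside the carrier, so the lemma applies to a map and
  to its restriction alike.\<close>

lemma ext_coset_eq:
  assumes P: "is_free_resolution R A P" and z: "z \<in> mod_hom R (res_mod R P i) M"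
    and w: "\<And>x. x \<in> carrier (res_mod R P i) \<Longrightarrow> w x = z x"
  shows "coboundaries R P i M +>\<^bsub>hom_module R (res_mod R P i) M\<^esub> w = ext_coset R P i M z"
proof -
  let ?X = "carrier (res_mod R P i)"
  note zc = mod_hom_closed[OF z]
  have cos: "coboundaries R P i M +>\<^bsub>hom_module R (res_mod R P i) M\<^esub> w =
      {(\<lambda>x\<in>?X. b x \<oplus>\<^bsub>M\<^esub> w x) | b. b \<in> coboundaries R P i M}"
    by (auto simp: a_r_coset_def' hom_module_def)
  show ?thesis
    unfolding cos
  proof (intro equalityI subsetI)
    fix h assume "h \<in> {(\<lambda>x\<in>?X. b x \<oplus>\<^bsub>M\<^esub> w x) | b. b \<in> coboundaries R P i M}"
    then obtain b where b: "h = (\<lambda>x\<in>?X. b x \<oplus>\<^bsub>M\<^esub> w x)" "b \<in> mod_hom R (res_mod R P i) M"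
      "ext_coboundary R P i M b"
      by (auto simp: mem_coboundaries[OF P] carrier_hom_module)
    note bc = mod_hom_closed[OF b(2)]
    have "h x = b x \<ominus>\<^bsub>M\<^esub> (\<zero>\<^bsub>M\<^esub> \<ominus>\<^bsub>M\<^esub> z x)" if "x \<in> ?X" for x
      using that bc zc by (simp add: b(1) a_minus_def w)
    then have "h = restrict (\<lambda>x. b x \<ominus>\<^bsub>M\<^esub> (\<zero>\<^bsub>M\<^esub> \<ominus>\<^bsub>M\<^esub> z x)) ?X"
      using b(1) by (intro extensionalityI[of _ ?X]) auto
    then have "h \<in> carrier (hom_module R (res_mod R P i) M)"
      using mod_hom_diff[OF R.module_res_mod module_axioms b(2) mod_hom_diff[OF R.module_res_mod module_axioms
            mod_hom_const_zero[OF R.module_res_mod module_axioms] z]]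
      by (simp add: restrict_hom_module[OF R.module_res_mod])
    moreover have "ext_coboundary R P i M (\<lambda>x. h x \<ominus>\<^bsub>M\<^esub> z x) \<longleftrightarrow> ext_coboundary R P i M b"
      using bc zc by (intro ext_coboundary_cong) (simp add: b(1) w a_minus_def M.a_assoc M.r_neg)
    ultimately show "h \<in> ext_coset R P i M z" using b(3) by (simp add: ext_coset_def)
  next
    fix h assume "h \<in> ext_coset R P i M z"
    then have h: "h \<in> mod_hom R (res_mod R P i) M" "h \<in> extensional ?X"
      "ext_coboundary R P i M (\<lambda>x. h x \<ominus>\<^bsub>M\<^esub> z x)"
      by (auto simp: ext_coset_def carrier_hom_module)
    define b where "b = restrict (\<lambda>x. h x \<ominus>\<^bsub>M\<^esub> z x) ?X"
    have "ext_coboundary R P i M b"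
      using h(3) by (subst ext_coboundary_cong[of R P i _ "\<lambda>x. h x \<ominus>\<^bsub>M\<^esub> z x"]) (simp_all add: b_def)
    then have "b \<in> coboundaries R P i M"
      unfolding mem_coboundaries[OF P] b_def
      using restrict_hom_module[OF R.module_res_mod mod_hom_diff[OF R.module_res_mod module_axioms h(1) z]] by simp
    moreover have "h = (\<lambda>x\<in>?X. b x \<oplus>\<^bsub>M\<^esub> w x)"
      using h(2) mod_hom_closed[OF h(1)] zc
      by (intro extensionalityI[of _ ?X]) (simp_all add: b_def w a_minus_def M.a_assoc M.l_neg)
    ultimately show "h \<in> {(\<lambda>x\<in>?X. b x \<oplus>\<^bsub>M\<^esub> w x) | b. b \<in> coboundaries R P i M}" by blast
  qed
qed

lemma ext_coset_eq_iff:
  assumes z: "z \<in> mod_hom R (res_mod R P i) M" and w: "w \<in> mod_hom R (res_mod R P i) M"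
  shows "ext_coset R P i M z = ext_coset R P i M w \<longleftrightarrow> ext_coboundary R P i M (\<lambda>x. z x \<ominus>\<^bsub>M\<^esub> w x)"
proof
  let ?X = "carrier (res_mod R P i)"
  have "ext_coboundary R P i M (\<lambda>x. restrict z ?X x \<ominus>\<^bsub>M\<^esub> z x) \<longleftrightarrow> ext_coboundary R P i M (\<lambda>_. \<zero>\<^bsub>M\<^esub>)"
    using mod_hom_closed[OF z] by (intro ext_coboundary_cong) (simp add: a_minus_def M.r_neg)
  then have "restrict z ?X \<in> ext_coset R P i M z"
    using restrict_hom_module[OF R.module_res_mod z] ext_coboundary_zero by (simp add: ext_coset_def)
  moreover assume "ext_coset R P i M z = ext_coset R P i M w"
  ultimately have "restrict z ?X \<in> ext_coset R P i M w" by blast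
  then have "ext_coboundary R P i M (\<lambda>x. restrict z ?X x \<ominus>\<^bsub>M\<^esub> w x)"
    unfolding ext_coset_def by blast
  then show "ext_coboundary R P i M (\<lambda>x. z x \<ominus>\<^bsub>M\<^esub> w x)"
    by (subst ext_coboundary_cong[of R P i _ "\<lambda>x. restrict z ?X x \<ominus>\<^bsub>M\<^esub> w x"]) simp_all
next
  have sub: "ext_coset R P i M z \<subseteq> ext_coset R P i M w"
    if z: "z \<in> mod_hom R (res_mod R P i) M" and w: "w \<in> mod_hom R (res_mod R P i) M"
      and zw: "ext_coboundary R P i M (\<lambda>x. z x \<ominus>\<^bsub>M\<^esub> w x)" for z w
  proof
    fix h assume "h \<in> ext_coset R P i M z"
    then have h: "h \<in> carrier (hom_module R (res_mod R P i) M)"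
      "ext_coboundary R P i M (\<lambda>x. h x \<ominus>\<^bsub>M\<^esub> z x)"
      by (auto simp: ext_coset_def)
    then have h': "h \<in> mod_hom R (res_mod R P i) M" by (simp add: carrier_hom_module)
    have "ext_coboundary R P i M (\<lambda>x. (h x \<ominus>\<^bsub>M\<^esub> w x) \<ominus>\<^bsub>M\<^esub> (h x \<ominus>\<^bsub>M\<^esub> z x)) \<longleftrightarrow>
        ext_coboundary R P i M (\<lambda>x. z x \<ominus>\<^bsub>M\<^esub> w x)"
      by (rule ext_coboundary_cong)
        (simp add: M.diff_diff_same mod_hom_closed[OF h'] mod_hom_closed[OF w] mod_hom_closed[OF z])
    then have "ext_coboundary R P i M (\<lambda>x. h x \<ominus>\<^bsub>M\<^esub> w x)"
      using ext_coboundary_trans[OF _ h(2) mod_hom_diff[OF R.module_res_mod module_axioms h' w]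
          mod_hom_diff[OF R.module_res_mod module_axioms h' z]] zw by simp
    then show "h \<in> ext_coset R P i M w" using h(1) by (simp add: ext_coset_def)
  qed
  assume zw: "ext_coboundary R P i M (\<lambda>x. z x \<ominus>\<^bsub>M\<^esub> w x)"
  have "ext_coboundary R P i M (\<lambda>x. \<zero>\<^bsub>M\<^esub> \<ominus>\<^bsub>M\<^esub> (z x \<ominus>\<^bsub>M\<^esub> w x)) \<longleftrightarrow>
      ext_coboundary R P i M (\<lambda>x. w x \<ominus>\<^bsub>M\<^esub> z x)"
    by (rule ext_coboundary_cong)
      (simp add: a_minus_def M.minus_add M.a_comm mod_hom_closed[OF w] mod_hom_closed[OF z])
  then have "ext_coboundary R P i M (\<lambda>x. w x \<ominus>\<^bsub>M\<^esub> z x)"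
    using ext_coboundary_diff[OF ext_coboundary_zero zw] by simp
  then show "ext_coset R P i M z = ext_coset R P i M w"
    using sub[OF z w zw] sub[OF w z] by blast
qed

lemma ext_coset_zero_iff:
  assumes "z \<in> mod_hom R (res_mod R P i) M"
  shows "ext_coset R P i M z = ext_coset R P i M (\<lambda>_. \<zero>\<^bsub>M\<^esub>) \<longleftrightarrow> ext_coboundary R P i M z"
proof -
  have "ext_coboundary R P i M (\<lambda>x. z x \<ominus>\<^bsub>M\<^esub> \<zero>\<^bsub>M\<^esub>) \<longleftrightarrow> ext_coboundary R P i M z"
    by (rule ext_coboundary_cong) (simp add: a_minus_def mod_hom_closed[OF assms])
  then show ?thesis
    using ext_coset_eq_iff[OF assms mod_hom_const_zero[OF R.module_res_mod module_axioms]] by simp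
qed

context
  fixes A :: "('a, 'e, 'f) module_scheme"
  assumes res: "is_free_resolution R A (resolution R A)"
begin

text \<open>\<open>resolution\<close> is a genuine resolution as soon as one exists; this is the
  assumption of the surrounding context. For cyclic modules over a Noetherian ring it is discharged
  by \<open>resolution_cyclic_module\<close>.\<close>

lemma Ext_module_carrier:
  "carrier (Ext_module R A i M) =
    ext_coset R (resolution R A) i M ` {z. ext_cocycle R (resolution R A) i M z}"
proof -
  let ?P = "resolution R A"
  let ?H = "hom_module R (res_mod R ?P i) M"
  have "carrier (Ext_module R A i M) = (\<lambda>z. coboundaries R ?P i M +>\<^bsub>?H\<^esub> z) ` cocycles R ?P i M"
    by (auto simp: Ext_module_def Let_def quot_module_def A_RCOSETS_def' a_r_coset_def')
  also have "\<dots> = ext_coset R ?P i M ` {z. ext_cocycle R ?P i M z}"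
  proof (intro equalityI subsetI)
    fix u assume "u \<in> (\<lambda>z. coboundaries R ?P i M +>\<^bsub>?H\<^esub> z) ` cocycles R ?P i M"
    then obtain z where z: "z \<in> cocycles R ?P i M" "u = coboundaries R ?P i M +>\<^bsub>?H\<^esub> z" by blast
    then have "ext_cocycle R ?P i M z" by (auto simp: cocycles_def ext_cocycle_def carrier_hom_module)
    then show "u \<in> ext_coset R ?P i M ` {z. ext_cocycle R ?P i M z}"
      using ext_coset_eq[OF res, of z i z] z(2) by (auto simp: ext_cocycle_def)
  next
    fix u assume "u \<in> ext_coset R ?P i M ` {z. ext_cocycle R ?P i M z}"
    then obtain z where z: "ext_cocycle R ?P i M z" "u = ext_coset R ?P i M z" by blast
    let ?z = "restrict z (carrier (res_mod R ?P i))"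
    have zh: "z \<in> mod_hom R (res_mod R ?P i) M" using z(1) by (simp add: ext_cocycle_def)
    have "?z \<in> cocycles R ?P i M"
      using z(1) restrict_hom_module[OF R.module_res_mod zh] mod_hom_closed[OF free_resolutionD(1)[OF res]]
      by (simp add: cocycles_def ext_cocycle_def)
    moreover have "u = coboundaries R ?P i M +>\<^bsub>?H\<^esub> ?z"
      using ext_coset_eq[OF res zh, of ?z] z(2) by simp
    ultimately show "u \<in> (\<lambda>z. coboundaries R ?P i M +>\<^bsub>?H\<^esub> z) ` cocycles R ?P i M" by blast
  qed
  finally show ?thesis .
qed

lemma Ext_module_zero: "\<zero>\<^bsub>Ext_module R A i M\<^esub> = ext_coset R (resolution R A) i M (\<lambda>_. \<zero>\<^bsub>M\<^esub>)"
proof -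
  let ?P = "resolution R A"
  have "h \<in> coboundaries R ?P i M \<longleftrightarrow> h \<in> ext_coset R ?P i M (\<lambda>_. \<zero>\<^bsub>M\<^esub>)" for h
  proof (cases "h \<in> carrier (hom_module R (res_mod R ?P i) M)")
    case True
    then have "ext_coboundary R ?P i M (\<lambda>x. h x \<ominus>\<^bsub>M\<^esub> \<zero>\<^bsub>M\<^esub>) \<longleftrightarrow> ext_coboundary R ?P i M h"
      by (intro ext_coboundary_cong) (auto simp: a_minus_def carrier_hom_module mod_hom_closed)
    then show ?thesis by (simp add: mem_coboundaries[OF res] ext_coset_def)
  qed (simp add: mem_coboundaries[OF res] ext_coset_def)
  then have "coboundaries R ?P i M = ext_coset R ?P i M (\<lambda>_. \<zero>\<^bsub>M\<^esub>)" by blast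
  then show ?thesis by (simp add: Ext_module_def Let_def quot_module_def)
qed

lemma zero_Ext_module_iff:
  "zero_module (Ext_module R A i M) \<longleftrightarrow>
    (\<forall>z. ext_cocycle R (resolution R A) i M z \<longrightarrow> ext_coboundary R (resolution R A) i M z)"
proof -
  let ?P = "resolution R A"
  have sing: "f ` Z = {f a} \<longleftrightarrow> (\<forall>z\<in>Z. f z = f a)" if "a \<in> Z" for f :: "'x \<Rightarrow> 'y" and Z a
    using that by auto
  have eq: "ext_coset R ?P i M z = ext_coset R ?P i M (\<lambda>_. \<zero>\<^bsub>M\<^esub>) \<longleftrightarrow> ext_coboundary R ?P i M z"
    if "ext_cocycle R ?P i M z" for z
    using that by (intro ext_coset_zero_iff) (simp add: ext_cocycle_def)
  show ?thesis
    unfolding zero_module_def Ext_module_carrier Ext_module_zero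
    using sing[of "\<lambda>_. \<zero>\<^bsub>M\<^esub>" "{z. ext_cocycle R ?P i M z}" "ext_coset R ?P i M"] ext_cocycle_zero[of ?P i]
    by (simp add: eq)
qed

end

text \<open>\<open>Ext_map\<close> is a union over all representatives of a class. Pulling back
  along a chain map preserves coboundaries, so each of them contributes the same coset.\<close>

lemma Ext_map_coset:
  assumes P: "is_free_resolution R A (resolution R A)" and Q: "is_free_resolution R B (resolution R B)"
    and lift: "is_lift R (resolution R B) (resolution R A) u (SOME \<phi>. is_lift R (resolution R B) (resolution R A) u \<phi>)"
    and z: "ext_cocycle R (resolution R A) i M z"
  shows "Ext_map R B A u i M (ext_coset R (resolution R A) i M z) =
    ext_coset R (resolution R B) i M (\<lambda>x. z ((SOME \<phi>. is_lift R (resolution R B) (resolution R A) u \<phi>) i x))"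
proof -
  let ?P = "resolution R A" and ?Q = "resolution R B"
  define \<phi> where "\<phi> = (SOME \<phi>. is_lift R ?Q ?P u \<phi>)"
  note l = lift[folded \<phi>_def]
  note lh = is_liftD(1)[OF l]
  have zh: "z \<in> mod_hom R (res_mod R ?P i) M" using z by (simp add: ext_cocycle_def)
  have *: "coboundaries R ?Q i M +>\<^bsub>hom_module R (res_mod R ?Q i) M\<^esub> (\<lambda>x\<in>carrier (res_mod R ?Q i). h (\<phi> i x)) =
      ext_coset R ?Q i M (\<lambda>x. z (\<phi> i x))" if "h \<in> ext_coset R ?P i M z" for h
  proof -
    from that have h: "h \<in> mod_hom R (res_mod R ?P i) M" "ext_coboundary R ?P i M (\<lambda>x. h x \<ominus>\<^bsub>M\<^esub> z x)"
      by (auto simp: ext_coset_def carrier_hom_module)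
    have "ext_coboundary R ?Q i M (\<lambda>x. h (\<phi> i x) \<ominus>\<^bsub>M\<^esub> z (\<phi> i x))"
      by (rule ext_coboundary_pullback[OF l h(2) Q])
    then have "ext_coset R ?Q i M (\<lambda>x. h (\<phi> i x)) = ext_coset R ?Q i M (\<lambda>x. z (\<phi> i x))"
      by (subst ext_coset_eq_iff[OF mod_hom_comp[OF lh h(1)] mod_hom_comp[OF lh zh]])
    then show ?thesis
      using ext_coset_eq[OF Q mod_hom_comp[OF lh h(1)]] by simp
  qed
  have "restrict z (carrier (res_mod R ?P i)) \<in> ext_coset R ?P i M z"
  proof -
    have "ext_coboundary R ?P i M (\<lambda>x. restrict z (carrier (res_mod R ?P i)) x \<ominus>\<^bsub>M\<^esub> z x) \<longleftrightarrow>
        ext_coboundary R ?P i M (\<lambda>_. \<zero>\<^bsub>M\<^esub>)"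
      using mod_hom_closed[OF zh] by (intro ext_coboundary_cong) (simp add: a_minus_def M.r_neg)
    then show ?thesis
      using restrict_hom_module[OF R.module_res_mod zh] ext_coboundary_zero by (simp add: ext_coset_def)
  qed
  then have "(\<Union>h\<in>ext_coset R ?P i M z. coboundaries R ?Q i M +>\<^bsub>hom_module R (res_mod R ?Q i) M\<^esub>
      (\<lambda>x\<in>carrier (res_mod R ?Q i). h (\<phi> i x))) = ext_coset R ?Q i M (\<lambda>x. z (\<phi> i x))"
    using * by blast
  then show ?thesis unfolding \<phi>_def by (simp add: Ext_map_def Let_def)
qed

end

section \<open>Vanishing of a direct limit of Ext, and independence of resolutions and lifts\<close>

definition lc_vanishes :: "('r, 'p) ring_scheme \<Rightarrow> (nat \<Rightarrow> ('r, 'a) free_res) \<Rightarrow> nat \<Rightarrow>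
    ('r, 'n, 'y) module_scheme \<Rightarrow> (nat \<Rightarrow> nat \<Rightarrow> nat \<Rightarrow> (nat \<Rightarrow> 'r) \<Rightarrow> (nat \<Rightarrow> 'r)) \<Rightarrow> bool"
  where "lc_vanishes R P i N \<phi> \<longleftrightarrow> (\<forall>n z. ext_cocycle R (P n) i N z \<longrightarrow>
    (\<exists>k\<ge>n. ext_coboundary R (P k) i N (\<lambda>x. z (\<phi> n k i x))))"

context module
begin

text \<open>A class that has died stays dead: the map \<open>\<gamma>\<close> and the composite of
  \<open>\<alpha>\<close> and \<open>\<beta>\<close> lift the same map, hence are homotopic, and the
  composite sends the cocycle to a coboundary.\<close>

lemma ext_coboundary_persists:
  assumes A: "module R A" and P: "is_free_resolution R A P" and P': "is_free_resolution R A' P'"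
    and P'': "is_free_resolution R A'' P''"
    and \<alpha>: "is_lift R P' P u \<alpha>" and \<beta>: "is_lift R P'' P' v \<beta>" and \<gamma>: "is_lift R P'' P w \<gamma>"
    and uv: "\<And>x. x \<in> carrier A'' \<Longrightarrow> w x = u (v x)"
    and z: "ext_cocycle R P i M z" and cob: "ext_coboundary R P' i M (\<lambda>x. z (\<alpha> i x))"
  shows "ext_coboundary R P'' i M (\<lambda>x. z (\<gamma> i x))"
proof -
  have l: "is_lift R P'' P w (\<lambda>i x. \<alpha> i (\<beta> i x))"
    using uv mod_hom_closed[OF free_resolutionD(2)[OF P'']] by (intro lift_comp[OF \<alpha> \<beta>]) blast
  have zh: "z \<in> mod_hom R (res_mod R P i) M" using z by (simp add: ext_cocycle_def)
  show ?thesis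
    by (rule ext_coboundary_trans[OF lift_homotopic[OF A P P'' \<gamma> l z] ext_coboundary_pullback[OF \<beta> cob P'']
          mod_hom_comp[OF is_liftD(1)[OF \<gamma>] zh] mod_hom_comp[OF is_liftD(1)[OF l] zh]])
qed

text \<open>A direct limit is zero when every element of every stage becomes zero at some later
  stage; \<open>lc_vanishes\<close> says this in terms of cocycles, for arbitrary resolutions and
  lifts. The existential hides the lifts chosen inside \<open>Ext_map\<close>, which
  \<open>lc_vanishes_indep\<close> then replaces by any others.\<close>

lemma zero_direct_limit_Ext_iff:
  fixes A :: "nat \<Rightarrow> ('a, 'e, 'f) module_scheme"
  assumes A: "\<And>n. module R (A n)" and res: "\<And>n. is_free_resolution R (A n) (resolution R (A n))"
    and u: "\<And>n k. n \<le> k \<Longrightarrow> u n k \<in> mod_hom R (A k) (A n)"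
    and uu: "\<And>n m k x. n \<le> m \<Longrightarrow> m \<le> k \<Longrightarrow> x \<in> carrier (A k) \<Longrightarrow> u n m (u m k x) = u n k x"
  shows "\<exists>\<phi>. (\<forall>n k. n \<le> k \<longrightarrow> is_lift R (resolution R (A k)) (resolution R (A n)) (u n k) (\<phi> n k)) \<and>
    (zero_module (direct_limit (\<lambda>n. Ext_module R (A n) i M) (\<lambda>n k. Ext_map R (A k) (A n) (u n k) i M))
      \<longleftrightarrow> lc_vanishes R (\<lambda>n. resolution R (A n)) i M \<phi>)"
proof -
  define P where "P n = resolution R (A n)" for n
  define \<phi> where "\<phi> n k = (SOME \<phi>. is_lift R (P k) (P n) (u n k) \<phi>)" for n k
  note P = res[folded P_def]
  have lift: "is_lift R (P k) (P n) (u n k) (\<phi> n k)" if "n \<le> k" for n k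
    unfolding \<phi>_def by (rule someI_ex[OF lift_exists[OF A A P P u[OF that]]])
  let ?E = "\<lambda>n. Ext_module R (A n) i M"
  let ?\<tau> = "\<lambda>n k. Ext_map R (A k) (A n) (u n k) i M"
  let ?c = "\<lambda>n. ext_coset R (P n) i M"
  have tau: "?\<tau> n k (?c n z) = ?c k (\<lambda>x. z (\<phi> n k i x))" if "n \<le> k" "ext_cocycle R (P n) i M z" for n k z
    using Ext_map_coset[OF res[of n] res[of k], of "u n k" i z] lift[OF that(1)] that(2) unfolding P_def \<phi>_def by simp
  have carr: "carrier (?E n) = ?c n ` {z. ext_cocycle R (P n) i M z}" for n
    using Ext_module_carrier[OF res] by (simp add: P_def)
  have zero: "\<zero>\<^bsub>?E n\<^esub> = ?c n (\<lambda>_. \<zero>\<^bsub>M\<^esub>)" for n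
    using Ext_module_zero[OF res] by (simp add: P_def)
  have hom: "z \<in> mod_hom R (res_mod R (P n) i) M" if "ext_cocycle R (P n) i M z" for n z
    using that by (simp add: ext_cocycle_def)
  have cob: "?c k (\<lambda>x. z (\<phi> n k i x)) = ?c k (\<lambda>_. \<zero>\<^bsub>M\<^esub>) \<longleftrightarrow>
      ext_coboundary R (P k) i M (\<lambda>x. z (\<phi> n k i x))" if "n \<le> k" "ext_cocycle R (P n) i M z" for n k z
    by (rule ext_coset_zero_iff[OF mod_hom_comp[OF is_liftD(1)[OF lift[OF that(1)]] hom[OF that(2)]]])
  have persist: "ext_coboundary R (P j) i M (\<lambda>x. z (\<phi> n j i x))"
    if "n \<le> k" "k \<le> j" and z: "ext_cocycle R (P n) i M z"
      and "ext_coboundary R (P k) i M (\<lambda>x. z (\<phi> n k i x))" for n k j z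
  proof -
    have nj: "n \<le> j" using that by simp
    show ?thesis
      using uu[OF that(1,2)]
      by (intro ext_coboundary_persists[OF A P P P lift[OF that(1)] lift[OF that(2)] lift[OF nj] _ z that(4)]) simp
  qed
  let ?r = "dirlim_rel ?E ?\<tau>"
  let ?\<Sigma> = "SIGMA n:UNIV. carrier (?E n)"
  have zc: "ext_cocycle R (P n) i M (\<lambda>_. \<zero>\<^bsub>M\<^esub>)" for n by (rule ext_cocycle_zero)
  have "zero_module (direct_limit ?E ?\<tau>) \<longleftrightarrow> ?\<Sigma> // ?r = {?r `` {(0, \<zero>\<^bsub>?E 0\<^esub>)}}"
    by (simp add: zero_module_def direct_limit_def)
  also have "\<dots> \<longleftrightarrow> lc_vanishes R P i M \<phi>"
  proof
    assume *: "?\<Sigma> // ?r = {?r `` {(0, \<zero>\<^bsub>?E 0\<^esub>)}}"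
    show "lc_vanishes R P i M \<phi>"
      unfolding lc_vanishes_def
    proof (intro allI impI)
      fix n z assume z: "ext_cocycle R (P n) i M z"
      then have x: "?c n z \<in> carrier (?E n)" by (simp add: carr)
      then have "?r `` {(n, ?c n z)} \<in> ?\<Sigma> // ?r" by (intro quotientI) simp
      then have "?r `` {(n, ?c n z)} = ?r `` {(0, \<zero>\<^bsub>?E 0\<^esub>)}" using * by simp
      moreover have "(n, ?c n z) \<in> ?r `` {(n, ?c n z)}" using x by (auto simp: dirlim_rel_def)
      ultimately have "((0, \<zero>\<^bsub>?E 0\<^esub>), (n, ?c n z)) \<in> ?r" by simp
      then obtain k where k: "n \<le> k" "?\<tau> 0 k \<zero>\<^bsub>?E 0\<^esub> = ?\<tau> n k (?c n z)" by (auto simp: dirlim_rel_def)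
      have "?c k (\<lambda>_. \<zero>\<^bsub>M\<^esub>) = ?c k (\<lambda>x. z (\<phi> n k i x))"
        using k(2) tau[OF k(1) z] tau[OF le0 zc, of k] by (simp add: zero)
      then show "\<exists>k\<ge>n. ext_coboundary R (P k) i M (\<lambda>x. z (\<phi> n k i x))"
        using cob[OF k(1) z] k(1) by auto
    qed
  next
    assume lc: "lc_vanishes R P i M \<phi>"
    \<comment> \<open>Both elements die, and vanishing persists, so they agree at the larger of the
      two stages. Hence all pairs are related and the quotient has a single class.\<close>
    have rel: "((n, x), (m, y)) \<in> ?r" if xy: "x \<in> carrier (?E n)" "y \<in> carrier (?E m)" for n x m y
    proof -
      obtain z w where z: "ext_cocycle R (P n) i M z" "x = ?c n z" and w: "ext_cocycle R (P m) i M w" "y = ?c m w"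
        using xy by (auto simp: carr)
      obtain k l where k: "n \<le> k" "ext_coboundary R (P k) i M (\<lambda>x. z (\<phi> n k i x))"
        and l: "m \<le> l" "ext_coboundary R (P l) i M (\<lambda>x. w (\<phi> m l i x))"
        using lc z(1) w(1) unfolding lc_vanishes_def by blast
      let ?j = "max k l"
      have j: "n \<le> ?j" "m \<le> ?j" using k(1) l(1) by auto
      have "?\<tau> n ?j x = ?\<tau> m ?j y"
        unfolding z(2) w(2) tau[OF j(1) z(1)] tau[OF j(2) w(1)]
        using cob[OF j(1) z(1)] cob[OF j(2) w(1)] persist[OF k(1) _ z(1) k(2), of ?j]
          persist[OF l(1) _ w(1) l(2), of ?j] by simp
      then show ?thesis using xy j by (auto simp: dirlim_rel_def)
    qed
    have eq: "?r `` {p} = ?\<Sigma>" if "p \<in> ?\<Sigma>" for p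
      using that rel by (auto simp: dirlim_rel_def)
    have "(0, \<zero>\<^bsub>?E 0\<^esub>) \<in> ?\<Sigma>" using zc by (auto simp: carr zero)
    then show "?\<Sigma> // ?r = {?r `` {(0, \<zero>\<^bsub>?E 0\<^esub>)}}"
      using eq unfolding quotient_def by blast
  qed
  finally have "zero_module (direct_limit ?E ?\<tau>) \<longleftrightarrow> lc_vanishes R P i M \<phi>" .
  then show ?thesis using lift unfolding P_def by (intro exI[of _ \<phi>] conjI allI impI) simp_all
qed

text \<open>Move the cocycle to P, where it is a coboundary, and return: the round trip from Q
  through P to Q lifts the identity, so it is homotopic to the identity of Q.\<close>

lemma Ext_vanishing_indep:
  assumes A: "module R A" and P: "is_free_resolution R A P" and Q: "is_free_resolution R A Q"
    and van: "\<And>z. ext_cocycle R P i M z \<Longrightarrow> ext_coboundary R P i M z"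
    and z: "ext_cocycle R Q i M z"
  shows "ext_coboundary R Q i M z"
proof -
  have id: "(\<lambda>x. x) \<in> mod_hom R A A" by (simp add: mod_hom_def)
  obtain \<alpha> \<beta> where \<alpha>: "is_lift R Q P (\<lambda>x. x) \<alpha>" and \<beta>: "is_lift R P Q (\<lambda>x. x) \<beta>"
    using lift_exists[OF A A P Q id] lift_exists[OF A A Q P id] by blast
  have l: "is_lift R Q Q (\<lambda>x. x) (\<lambda>i x. \<beta> i (\<alpha> i x))"
    by (rule lift_comp[OF \<beta> \<alpha>]) simp
  have zh: "z \<in> mod_hom R (res_mod R Q i) M" using z by (simp add: ext_cocycle_def)
  have "ext_coboundary R Q i M (\<lambda>x. z (\<beta> i (\<alpha> i x)))"
    by (rule ext_coboundary_pullback[OF \<alpha> van[OF ext_cocycle_pullback[OF \<beta> z P]] Q])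
  from ext_coboundary_trans[OF lift_homotopic[OF A Q Q lift_id l z] this zh
      mod_hom_comp[OF is_liftD(1)[OF l] zh]]
  show ?thesis .
qed

text \<open>The systems are compared through lifts of the identity at both ends: the composite from
  \<open>Q k\<close> through \<open>P k\<close> and \<open>P n\<close> to \<open>Q n\<close> lifts
  the same transition map as \<open>\<psi> n k\<close>, so the two are homotopic.\<close>

lemma lc_vanishes_indep:
  assumes A: "\<And>n. module R (A n)"
    and P: "\<And>n. is_free_resolution R (A n) (P n)" and Q: "\<And>n. is_free_resolution R (A n) (Q n)"
    and \<phi>: "\<And>n k. n \<le> k \<Longrightarrow> is_lift R (P k) (P n) (u n k) (\<phi> n k)"
    and \<psi>: "\<And>n k. n \<le> k \<Longrightarrow> is_lift R (Q k) (Q n) (u n k) (\<psi> n k)"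
    and van: "lc_vanishes R P i M \<phi>"
  shows "lc_vanishes R Q i M \<psi>"
  unfolding lc_vanishes_def
proof (intro allI impI)
  fix n z assume z: "ext_cocycle R (Q n) i M z"
  have id: "(\<lambda>x. x) \<in> mod_hom R (A n) (A n)" for n by (simp add: mod_hom_def)
  obtain \<beta> where \<beta>: "is_lift R (P n) (Q n) (\<lambda>x. x) \<beta>"
    using lift_exists[OF A A Q P id] by blast
  obtain k where k: "n \<le> k" "ext_coboundary R (P k) i M (\<lambda>x. z (\<beta> i (\<phi> n k i x)))"
    using van ext_cocycle_pullback[OF \<beta> z P] unfolding lc_vanishes_def by blast
  obtain \<alpha> where \<alpha>: "is_lift R (Q k) (P k) (\<lambda>x. x) \<alpha>"
    using lift_exists[OF A A P Q id] by blast
  have l: "is_lift R (Q k) (Q n) (u n k) (\<lambda>i x. \<beta> i (\<phi> n k i (\<alpha> i x)))"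
    by (rule lift_comp[OF \<beta> lift_comp[OF \<phi>[OF k(1)] \<alpha>, of "u n k"], of "u n k"]) simp_all
  have zh: "z \<in> mod_hom R (res_mod R (Q n) i) M" using z by (simp add: ext_cocycle_def)
  have "ext_coboundary R (Q k) i M (\<lambda>x. z (\<beta> i (\<phi> n k i (\<alpha> i x))))"
    by (rule ext_coboundary_pullback[OF \<alpha> k(2) Q])
  from ext_coboundary_trans[OF lift_homotopic[OF A Q Q \<psi>[OF k(1)] l z] this
      mod_hom_comp[OF is_liftD(1)[OF \<psi>[OF k(1)]] zh] mod_hom_comp[OF is_liftD(1)[OF l] zh]]
  show "\<exists>k\<ge>n. ext_coboundary R (Q k) i M (\<lambda>x. z (\<psi> n k i x))" using k(1) by blast
qed

end

section \<open>Cyclic modules and their resolutions\<close>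

lemma (in abelian_group) add_minus_cancel:
  "x \<in> carrier G \<Longrightarrow> y \<in> carrier G \<Longrightarrow> y \<oplus> (x \<ominus> y) = x"
  using a_lcomm[of y x "\<ominus> y"] by (simp add: minus_eq r_neg)

context cring
begin

lemma cyclic_module_simps:
  "carrier (cyclic_module R I) = (\<lambda>x. I +> x) ` carrier R"
  "\<zero>\<^bsub>cyclic_module R I\<^esub> = I"
  "U \<oplus>\<^bsub>cyclic_module R I\<^esub> V = U <+> V"
  "r \<odot>\<^bsub>cyclic_module R I\<^esub> U = (\<Union>x\<in>U. I +> (r \<otimes> x))"
  by (auto simp: cyclic_module_def quot_module_def A_RCOSETS_def' a_r_coset_def' set_add_def')

lemma coset_eq_iff:
  "ideal I R \<Longrightarrow> x \<in> carrier R \<Longrightarrow> y \<in> carrier R \<Longrightarrow> I +> x = I +> y \<longleftrightarrow> x \<ominus> y \<in> I"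
  using quotient_eq_iff_same_a_r_cos by blast

lemma coset_zero_iff:
  assumes "ideal I R" "x \<in> carrier R"
  shows "I +> x = I \<longleftrightarrow> x \<in> I"
proof -
  have "I +> \<zero> = I"
    using ideal.axioms(1)[OF assms(1)] by (simp add: a_coset_add_zero additive_subgroup.a_subset)
  then show ?thesis
    using coset_eq_iff[OF assms zero_closed] assms(2) by (simp add: minus_eq)
qed

text \<open>Covers scalar multiplication on R/I (with J = I) and the projection from R/I to R/J
  (with r = 1), both of which are defined as unions over a coset.\<close>

lemma coset_Union:
  assumes I: "ideal I R" and J: "ideal J R" and x: "x \<in> carrier R" and r: "r \<in> carrier R"
    and IJ: "\<And>i. i \<in> I \<Longrightarrow> r \<otimes> i \<in> J"
  shows "(\<Union>y\<in>I +> x. J +> (r \<otimes> y)) = J +> (r \<otimes> x)"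
proof -
  have eq: "J +> (r \<otimes> (i \<oplus> x)) = J +> (r \<otimes> x)" if i: "i \<in> I" for i
  proof -
    have ic: "i \<in> carrier R" using ideal.Icarr[OF I i] .
    have "r \<otimes> (i \<oplus> x) \<ominus> r \<otimes> x = r \<otimes> i"
      using ic x r by (simp add: r_distr minus_eq a_assoc r_neg)
    then show ?thesis using IJ[OF i] ic x r by (subst coset_eq_iff[OF J]) simp_all
  qed
  moreover have "\<zero> \<in> I" using additive_subgroup.zero_closed[OF ideal.axioms(1)[OF I]] .
  ultimately show ?thesis by (auto simp: a_r_coset_def'[of R I])
qed

lemma cyclic_module_add:
  assumes "ideal I R" "x \<in> carrier R" "y \<in> carrier R"
  shows "(I +> x) \<oplus>\<^bsub>cyclic_module R I\<^esub> (I +> y) = I +> (x \<oplus> y)"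
  using ideal.a_rcos_sum[OF assms] by (simp add: cyclic_module_simps)

lemma cyclic_module_smult:
  assumes "ideal I R" "r \<in> carrier R" "x \<in> carrier R"
  shows "r \<odot>\<^bsub>cyclic_module R I\<^esub> (I +> x) = I +> (r \<otimes> x)"
  unfolding cyclic_module_simps
  by (rule coset_Union[OF assms(1,1,3,2)]) (rule ideal.I_l_closed[OF assms(1) _ assms(2)])

lemma module_cyclic_module:
  assumes I: "ideal I R"
  shows "module R (cyclic_module R I)"
proof (rule moduleI)
  note simps = cyclic_module_simps(1) cyclic_module_add[OF I] cyclic_module_smult[OF I]
  have z: "I +> \<zero> = \<zero>\<^bsub>cyclic_module R I\<^esub>"
    using coset_zero_iff[OF I zero_closed] additive_subgroup.zero_closed[OF ideal.axioms(1)[OF I]]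
    by (simp add: cyclic_module_simps(2))
  show "abelian_group (cyclic_module R I)"
  proof (rule abelian_groupI)
    fix U assume "U \<in> carrier (cyclic_module R I)"
    then obtain x where x: "U = I +> x" "x \<in> carrier R" by (auto simp: simps)
    then have "(I +> \<ominus> x) \<oplus>\<^bsub>cyclic_module R I\<^esub> U = \<zero>\<^bsub>cyclic_module R I\<^esub>"
      using z by (simp add: simps l_neg)
    then show "\<exists>V\<in>carrier (cyclic_module R I). V \<oplus>\<^bsub>cyclic_module R I\<^esub> U = \<zero>\<^bsub>cyclic_module R I\<^esub>"
      using x by (auto simp: cyclic_module_simps(1))
  qed (auto simp: simps a_ac simp flip: z)
qed (auto simp: simps is_cring l_distr r_distr m_assoc cyclic_module_simps(1) cyclic_module_add[OF I] cyclic_module_smult[OF I])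

lemma cyclic_proj_coset:
  assumes "ideal I R" "ideal J R" "I \<subseteq> J" "x \<in> carrier R"
  shows "cyclic_proj R J (I +> x) = J +> x"
proof -
  have "(\<Union>y\<in>I +> x. J +> (\<one> \<otimes> y)) = J +> (\<one> \<otimes> x)"
    using assms ideal.Icarr[OF assms(1)] by (intro coset_Union) auto
  moreover have "I +> x \<subseteq> carrier R"
    using assms by (intro a_r_coset_subset_G) (auto simp: ideal.Icarr)
  ultimately show ?thesis using assms(4) by (auto simp: cyclic_proj_def subset_iff)
qed

lemma cyclic_proj_hom:
  assumes I: "ideal I R" and J: "ideal J R" and IJ: "I \<subseteq> J"
  shows "cyclic_proj R J \<in> mod_hom R (cyclic_module R I) (cyclic_module R J)"
  by (rule mod_homI)
    (auto simp: cyclic_module_simps(1) cyclic_proj_coset[OF assms] cyclic_module_add[OF I]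
      cyclic_module_add[OF J] cyclic_module_smult[OF I] cyclic_module_smult[OF J])

section \<open>Powers of an ideal\<close>

lemma ideal_power_0: "ideal_power R I 0 = carrier R"
  and ideal_power_Suc: "ideal_power R I (Suc n) = ideal_prod R (ideal_power R I n) I"
  by (simp_all add: ideal_power_def nat_pow_def ideals_set_def)

lemma ideal_power_ideal: "ideal I R \<Longrightarrow> ideal (ideal_power R I n) R"
  by (induction n) (simp_all add: ideal_power_0 ideal_power_Suc oneideal ideal_prod_is_ideal)

lemma ideal_power_mono:
  assumes "ideal I R" "n \<le> k"
  shows "ideal_power R I k \<subseteq> ideal_power R I n"
  using assms(2)
proof (induction k rule: dec_induct)
  case (step k)
  then show ?case
    using ideal_prod_inter[OF ideal_power_ideal[OF assms(1), of k] assms(1)] by (auto simp: ideal_power_Suc)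
qed simp

section \<open>Noetherian rings: submodules of free modules, and free resolutions of cyclic
  modules\<close>

lemma lincomb_free_module_rank: "lincomb (free_module R b) s c g = lincomb (free_module R b') s c g"
  by (induction s) simp_all

lemma ideal_lincomb_generators:
  assumes "noetherian_ring R" and I: "ideal I R"
  shows "\<exists>s g. (\<forall>l<s. g l \<in> I) \<and>
    (\<forall>x\<in>I. \<exists>c. (\<forall>l<s. c l \<in> carrier R) \<and> x = lincomb (ring_module R) s c g)"
proof -
  obtain S where S: "S \<subseteq> carrier R" "finite S" "I = Idl S"
    using noetherian_ring.finetely_gen[OF assms] by blast
  interpret RM: module R "ring_module R" by (rule module_ring_module)
  obtain g where g: "bij_betw g {0..<card S} S" using ex_bij_betw_nat_finite[OF S(2)] by blast
  let ?s = "card S"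
  have gS: "g l \<in> S" if "l < ?s" for l using g that by (auto simp: bij_betw_def)
  have gc: "g l \<in> carrier R" if "l < ?s" for l using gS[OF that] S(1) by blast
  \<comment> \<open>The combinations of the generators form an ideal, as the image of a free module;
    it contains S and therefore I.\<close>
  define J where "J = (\<lambda>v. lincomb (ring_module R) ?s v g) ` carrier (free_module R ?s)"
  have J: "ideal J R"
    unfolding J_def using gc by (intro mod_hom_image_ideal[OF module_free_module RM.lincomb_mod_hom]) simp
  have "S \<subseteq> J"
  proof
    fix a assume "a \<in> S"
    then have "a \<in> g ` {0..<?s}" using g by (simp add: bij_betw_def)
    then obtain k where k: "k < ?s" "a = g k" by auto
    have "a = lincomb (ring_module R) ?s (unit_vec R k) g"
      using RM.lincomb_unit_vec[of ?s g k] gc k by simp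
    then show "a \<in> J" unfolding J_def by (intro image_eqI[of _ _ "unit_vec R k"] unit_vec_closed[OF k(1)])
  qed
  then have IJ: "I \<subseteq> J" using genideal_minimal[OF J] S(3) by simp
  have "\<exists>c. (\<forall>l<?s. c l \<in> carrier R) \<and> x = lincomb (ring_module R) ?s c g" if xI: "x \<in> I" for x
  proof -
    obtain c where "c \<in> carrier (free_module R ?s)" "x = lincomb (ring_module R) ?s c g"
      using subsetD[OF IJ xI] unfolding J_def by (rule imageE) blast
    then show ?thesis by (intro exI[of _ c]) (simp add: carrier_free_module)
  qed
  moreover have "g l \<in> I" if "l < ?s" for l
    using genideal_self[OF S(1)] gS[OF that] S(3) by blast
  ultimately show ?thesis by (intro exI[of _ ?s] exI[of _ g]) simp
qed

text \<open>Hilbert's argument: the last coordinates of a submodule of \<open>R\<^sup>b\<^sup>+\<^sup>1\<close> form a finitely generated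
  ideal, and the elements with vanishing last coordinate form a submodule of \<open>R\<^sup>b\<close>.\<close>

lemma submodule_free_module_generators:
  assumes noeth: "noetherian_ring R" and "submodule H R (free_module R b)"
  shows "\<exists>s g. (\<forall>l<s. g l \<in> H) \<and>
    (\<forall>x\<in>H. \<exists>c. (\<forall>l<s. c l \<in> carrier R) \<and> x = lincomb (free_module R b) s c g)"
  using assms(2)
proof (induction b arbitrary: H)
  case 0
  interpret F: module R "free_module R 0" by (rule module_free_module)
  have "x = \<zero>\<^bsub>free_module R 0\<^esub>" if "x \<in> H" for x
    using F.submoduleE(1)[OF 0] that by (auto simp: carrier_free_module subset_iff)
  then show ?case by (intro exI[of _ 0]) simp
next
  case (Suc b)
  interpret F: module R "free_module R (Suc b)" by (rule module_free_module)
  interpret F': module R "free_module R b" by (rule module_free_module)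
  interpret RM: module R "ring_module R" by (rule module_ring_module)
  note H = F.submoduleE[OF Suc.prems]
  have Hc: "x k \<in> carrier R" if "x \<in> H" for x k using free_module_nth H(1) that by blast
  have zero: "\<zero>\<^bsub>free_module R (Suc b)\<^esub> \<in> H"
    using H(2) H(4)[OF zero_closed] F.smult_l_null H(1) by (metis ex_in_conv subsetD)
  define I where "I = (\<lambda>x. x b) ` H"
  \<comment> \<open>The record fixes negation only through the group laws; written as the scalar - 1
    it can be evaluated at a coordinate.\<close>
  have nth: "(\<ominus>\<^bsub>free_module R (Suc b)\<^esub> x) k = \<ominus> x k" if "x \<in> carrier (free_module R (Suc b))" for x k
  proof -
    have "\<ominus>\<^bsub>free_module R (Suc b)\<^esub> x = (\<ominus> \<one>) \<odot>\<^bsub>free_module R (Suc b)\<^esub> x"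
      using that by (simp add: F.smult_l_minus del: free_module_simps)
    then show ?thesis using free_module_nth[OF that] by (simp add: l_minus)
  qed
  have HM: "module R (free_module R (Suc b)\<lparr>carrier := H\<rparr>)"
    by (rule submodule.submodule_is_module[OF Suc.prems F.module_axioms])
  have last: "(\<lambda>x. x b) \<in> mod_hom R (free_module R (Suc b)\<lparr>carrier := H\<rparr>) (ring_module R)"
    by (rule mod_homI) (simp_all add: Hc)
  have I: "ideal I R" using mod_hom_image_ideal[OF HM last] by (simp add: I_def)
  obtain s g where g: "\<And>l. l < s \<Longrightarrow> g l \<in> I"
    "\<And>x. x \<in> I \<Longrightarrow> \<exists>c. (\<forall>l<s. c l \<in> carrier R) \<and> x = lincomb (ring_module R) s c g"
    using ideal_lincomb_generators[OF noeth I] by blast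
  have "\<forall>l. \<exists>h. l < s \<longrightarrow> h \<in> H \<and> g l = h b" using g(1) by (auto simp: I_def)
  from choice[OF this] obtain h where h: "\<And>l. l < s \<Longrightarrow> h l \<in> H" "\<And>l. l < s \<Longrightarrow> g l = h l b" by blast
  define H' where "H' = {x \<in> H. x b = \<zero>}"
  have H'sub: "H' \<subseteq> carrier (free_module R b)"
    using H(1) by (auto simp: H'_def carrier_free_module subset_iff not_less) (metis Suc_leI le_neq_implies_less)
  \<comment> \<open>The two free modules have different carriers, but in each of them negation is
    the scalar - 1, whose action does not see the rank.\<close>
  have inv_eq: "\<ominus>\<^bsub>free_module R b\<^esub> x = \<ominus>\<^bsub>free_module R (Suc b)\<^esub> x" if "x \<in> H'" for x
  proof -
    have "\<ominus>\<^bsub>free_module R b\<^esub> x = (\<ominus> \<one>) \<odot>\<^bsub>free_module R b\<^esub> x"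
      using that H'sub by (simp add: F'.smult_l_minus subset_iff del: free_module_simps)
    also have "\<dots> = (\<ominus> \<one>) \<odot>\<^bsub>free_module R (Suc b)\<^esub> x" by simp
    also have "\<dots> = \<ominus>\<^bsub>free_module R (Suc b)\<^esub> x"
      using that H(1) by (simp add: F.smult_l_minus subset_iff H'_def del: free_module_simps)
    finally show ?thesis .
  qed
  have "submodule H' R (free_module R b)"
  proof (rule F'.submoduleI[OF H'sub])
    show "\<zero>\<^bsub>free_module R b\<^esub> \<in> H'" using zero by (simp add: H'_def)
    show "\<ominus>\<^bsub>free_module R b\<^esub> x \<in> H'" if "x \<in> H'" for x
      using that H(1) H(3)[of x] nth[of x b] unfolding inv_eq[OF that] by (auto simp: H'_def)
    show "x \<oplus>\<^bsub>free_module R b\<^esub> y \<in> H'" if "x \<in> H'" "y \<in> H'" for x y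
      using that H(5)[of x y] by (simp add: H'_def)
    show "r \<odot>\<^bsub>free_module R b\<^esub> x \<in> H'" if "r \<in> carrier R" "x \<in> H'" for r x
      using that H(4)[of r x] by (simp add: H'_def)
  qed
  from Suc.IH[OF this] obtain s' g' where g': "\<And>l. l < s' \<Longrightarrow> g' l \<in> H'"
    "\<And>x. x \<in> H' \<Longrightarrow> \<exists>c. (\<forall>l<s'. c l \<in> carrier R) \<and> x = lincomb (free_module R b) s' c g'" by blast
  let ?F = "free_module R (Suc b)"
  let ?g = "\<lambda>l. if l < s then h l else g' (l - s)"
  have g'H: "g' l \<in> H" if "l < s'" for l using g'(1)[OF that] by (simp add: H'_def)
  have lcH: "lincomb ?F n c w \<in> H" if "\<forall>l<n. c l \<in> carrier R" "\<forall>l<n. w l \<in> H" for n c w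
    using that zero H(4,5) by (induction n) (auto simp del: free_module_simps)
  show ?case
  proof (intro exI[of _ "s + s'"] exI[of _ ?g] conjI allI impI ballI)
    fix l assume "l < s + s'"
    then show "?g l \<in> H" using h(1) g'H by simp
  next
    fix x assume x: "x \<in> H"
    then obtain c where c: "\<forall>l<s. c l \<in> carrier R" "x b = lincomb (ring_module R) s c g"
      using g(2) by (auto simp: I_def)
    \<comment> \<open>Elements of H whose last coordinates generate I are combined so as to
      reproduce the last coordinate of x; the difference then lies in H'.\<close>
    let ?y = "lincomb ?F s c h"
    have y: "?y \<in> H" using c(1) h(1) by (intro lcH) auto
    have xy: "x \<in> carrier ?F" "?y \<in> carrier ?F" using x y H(1) by auto
    have yb: "?y b = x b"
      unfolding lincomb_free_module_nth c(2) using h(2) by (intro lincomb_cong) auto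
    have "x \<ominus>\<^bsub>?F\<^esub> ?y \<in> H" unfolding a_minus_def using H(3,5) x y by blast
    moreover have "(x \<ominus>\<^bsub>?F\<^esub> ?y) b = \<zero>"
      using nth[OF xy(2)] yb Hc[OF x] by (simp add: a_minus_def r_neg)
    ultimately have "x \<ominus>\<^bsub>?F\<^esub> ?y \<in> H'" by (simp add: H'_def)
    \<comment> \<open>Because of the zero padding, the combination found in rank b is literally a
      combination in rank b + 1.\<close>
    then obtain c' where c': "\<forall>l<s'. c' l \<in> carrier R" "x \<ominus>\<^bsub>?F\<^esub> ?y = lincomb ?F s' c' g'"
      using g'(2) lincomb_free_module_rank by metis
    have "lincomb ?F (s + s') (\<lambda>l. if l < s then c l else c' (l - s)) ?g = ?y \<oplus>\<^bsub>?F\<^esub> (x \<ominus>\<^bsub>?F\<^esub> ?y)"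
      unfolding c'(2) using c(1) c'(1) h(1) g'H H(1) by (intro F.lincomb_append) auto
    also have "\<dots> = x"
      by (rule F.add_minus_cancel[OF xy])
    finally show "\<exists>c. (\<forall>l<s + s'. c l \<in> carrier R) \<and> x = lincomb ?F (s + s') c ?g"
      using c(1) c'(1) by (intro exI[of _ "\<lambda>l. if l < s then c l else c' (l - s)"]) auto
  qed
qed

text \<open>A finite generating family amounts to a map from a free module with image H. In this
  form a kernel is covered by the next term of a resolution.\<close>

lemma submodule_free_image:
  assumes "noetherian_ring R" "submodule H R (free_module R b)"
  shows "\<exists>n d. d \<in> mod_hom R (free_module R n) (free_module R b) \<and> d ` carrier (free_module R n) = H"
proof -
  interpret F: module R "free_module R b" by (rule module_free_module)
  obtain s g where g: "\<And>l. l < s \<Longrightarrow> g l \<in> H"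
    "\<And>x. x \<in> H \<Longrightarrow> \<exists>c. (\<forall>l<s. c l \<in> carrier R) \<and> x = lincomb (free_module R b) s c g"
    using submodule_free_module_generators[OF assms] by blast
  note H = F.submoduleE[OF assms(2)]
  have zero: "\<zero>\<^bsub>free_module R b\<^esub> \<in> H"
    using H(2) H(4)[OF zero_closed] F.smult_l_null H(1) by (metis ex_in_conv subsetD)
  let ?d = "\<lambda>v. lincomb (free_module R b) s v g"
  have lcH: "lincomb (free_module R b) n c g \<in> H" if "\<forall>l<n. c l \<in> carrier R" "n \<le> s" for n c
    using that zero g(1) H(4,5) by (induction n) (auto simp del: free_module_simps)
  have "?d \<in> mod_hom R (free_module R s) (free_module R b)"
    using g(1) H(1) by (intro F.lincomb_mod_hom) auto
  moreover have "?d ` carrier (free_module R s) = H"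
  proof (intro equalityI subsetI)
    fix x assume "x \<in> ?d ` carrier (free_module R s)"
    then show "x \<in> H" using lcH by (auto simp: carrier_free_module)
  next
    fix x assume "x \<in> H"
    then obtain c where c: "\<forall>l<s. c l \<in> carrier R" "x = ?d c" using g(2) by blast
    have "x = ?d (\<lambda>l. if l < s then c l else \<zero>)"
      unfolding c(2) by (rule lincomb_cong) auto
    moreover have "(\<lambda>l. if l < s then c l else \<zero>) \<in> carrier (free_module R s)"
      using c(1) by (simp add: carrier_free_module)
    ultimately show "x \<in> ?d ` carrier (free_module R s)" by blast
  qed
  ultimately show ?thesis by blast
qed

lemma cyclic_aug_hom:
  assumes I: "ideal I R"
  shows "(\<lambda>v. I +> v 0) \<in> mod_hom R (free_module R 1) (cyclic_module R I)"
  by (rule mod_homI) (auto simp: cyclic_module_simps(1) cyclic_module_add[OF I] cyclic_module_smult[OF I]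
      free_module_nth)

lemma cyclic_aug_surj: "(\<lambda>v. I +> v 0) ` carrier (free_module R 1) = carrier (cyclic_module R I)"
proof (intro equalityI subsetI)
  fix U assume "U \<in> (\<lambda>v. I +> v 0) ` carrier (free_module R 1)"
  then show "U \<in> carrier (cyclic_module R I)" using free_module_nth by (auto simp: cyclic_module_simps(1))
next
  fix U assume "U \<in> carrier (cyclic_module R I)"
  then obtain x where x: "x \<in> carrier R" "U = I +> x" by (auto simp: cyclic_module_simps(1))
  define v where "v = (\<lambda>j :: nat. if j = 0 then x else \<zero>)"
  have "U = I +> v 0" using x(2) by (simp add: v_def)
  moreover have "v \<in> carrier (free_module R 1)"
    using x(1) by (simp add: v_def carrier_free_module)
  ultimately show "U \<in> (\<lambda>v. I +> v 0) ` carrier (free_module R 1)" by blast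
qed

text \<open>Kernels are covered by free modules one after the other. The first term is normalized to
  rank 1 with the canonical augmentation, so that over T the projection onto the cyclic module can
  take its place in \<open>base_change_res\<close>.\<close>

lemma cyclic_resolution_exists:
  assumes noeth: "noetherian_ring R" and I: "ideal I R"
  shows "\<exists>P. is_free_resolution R (cyclic_module R I) P \<and> res_rank P 0 = 1 \<and> res_aug P = (\<lambda>v. I +> v 0)"
proof -
  note F = module_free_module
  let ?F = "free_module R" and ?C = "cyclic_module R I"
  let ?aug = "\<lambda>v :: nat \<Rightarrow> 'a. I +> v 0"
  note aug = cyclic_aug_hom[OF I] and aug_surj = cyclic_aug_surj[of I]
  \<comment> \<open>The state of the construction consists of two consecutive ranks and the
    differential between them; \<open>step\<close> demands that the image of the next differential
    is the kernel of the present one.\<close>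
  define good where "good s \<longleftrightarrow> snd (snd s) \<in> mod_hom R (?F (fst (snd s))) (?F (fst s))"
    for s :: "nat \<times> nat \<times> ((nat \<Rightarrow> 'a) \<Rightarrow> (nat \<Rightarrow> 'a))"
  define start where "start s \<longleftrightarrow> fst s = 1 \<and>
      snd (snd s) ` carrier (?F (fst (snd s))) = {v \<in> carrier (?F 1). ?aug v = \<zero>\<^bsub>?C\<^esub>}"
    for s :: "nat \<times> nat \<times> ((nat \<Rightarrow> 'a) \<Rightarrow> (nat \<Rightarrow> 'a))"
  define step where "step s s' \<longleftrightarrow> fst s' = fst (snd s) \<and>
      snd (snd s') ` carrier (?F (fst (snd s'))) =
        {v \<in> carrier (?F (fst (snd s))). snd (snd s) v = \<zero>\<^bsub>?F (fst s)\<^esub>}"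
    for s s' :: "nat \<times> nat \<times> ((nat \<Rightarrow> 'a) \<Rightarrow> (nat \<Rightarrow> 'a))"
  have "\<exists>S. \<forall>n. (good (S n) \<and> (n = 0 \<longrightarrow> start (S n))) \<and> step (S n) (S (Suc n))"
  proof (rule dependent_nat_choice)
    obtain n d where "d \<in> mod_hom R (?F n) (?F 1)" "d ` carrier (?F n) = {v \<in> carrier (?F 1). ?aug v = \<zero>\<^bsub>?C\<^esub>}"
      using submodule_free_image[OF noeth module.submodule_kernel[OF F module_cyclic_module[OF I] aug]] by blast
    then show "\<exists>s. good s \<and> ((0::nat) = 0 \<longrightarrow> start s)"
      by (intro exI[of _ "(1, n, d)"]) (simp add: good_def start_def)
  next
    fix s :: "nat \<times> nat \<times> ((nat \<Rightarrow> 'a) \<Rightarrow> (nat \<Rightarrow> 'a))" and k :: nat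
    obtain b c d where s: "s = (b, c, d)" by (cases s)
    assume "good s \<and> (k = 0 \<longrightarrow> start s)"
    then have d: "d \<in> mod_hom R (?F c) (?F b)" by (simp add: good_def s)
    obtain n e where "e \<in> mod_hom R (?F n) (?F c)" "e ` carrier (?F n) = {v \<in> carrier (?F c). d v = \<zero>\<^bsub>?F b\<^esub>}"
      using submodule_free_image[OF noeth module.submodule_kernel[OF F F d]] by blast
    then show "\<exists>s'. (good s' \<and> (Suc k = 0 \<longrightarrow> start s')) \<and> step s s'"
      by (intro exI[of _ "(c, n, e)"]) (simp add: good_def step_def s)
  qed
  then obtain S where S': "\<And>n. good (S n)" "start (S 0)" "\<And>n. step (S n) (S (Suc n))" by blast
  note S = S'(1) S'(2)[unfolded start_def, THEN conjunct1] S'(2)[unfolded start_def, THEN conjunct2]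
    S'(3)[unfolded step_def, THEN conjunct1] S'(3)[unfolded step_def, THEN conjunct2]
  define P where "P = \<lparr>res_rank = (\<lambda>n. fst (S n)), res_diff = (\<lambda>n. snd (snd (S n))), res_aug = ?aug\<rparr>"
  have "is_free_resolution R ?C P"
    unfolding is_free_resolution_def exact_at_def res_mod_def
  proof (intro conjI allI)
    show "res_diff P i \<in> mod_hom R (?F (res_rank P (Suc i))) (?F (res_rank P i))" for i
      using S(1)[of i] by (simp add: P_def good_def S(4))
    show "res_aug P \<in> mod_hom R (?F (res_rank P 0)) ?C" using aug by (simp add: P_def S(2))
    show "res_diff P (Suc i) ` carrier (?F (res_rank P (Suc (Suc i)))) =
        {y \<in> carrier (?F (res_rank P (Suc i))). res_diff P i y = \<zero>\<^bsub>?F (res_rank P i)\<^esub>}" for i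
      using S(5)[of i] by (simp add: P_def S(4))
    show "res_diff P 0 ` carrier (?F (res_rank P (Suc 0))) =
        {y \<in> carrier (?F (res_rank P 0)). res_aug P y = \<zero>\<^bsub>?C\<^esub>}"
      using S(3) by (simp add: P_def S(4) S(2))
    show "res_aug P ` carrier (?F (res_rank P 0)) = carrier ?C" using aug_surj by (simp add: P_def S(2))
  qed
  then show ?thesis by (intro exI[of _ P]) (simp add: P_def S(2))
qed

lemma resolution_cyclic_module:
  "noetherian_ring R \<Longrightarrow> ideal I R \<Longrightarrow>
    is_free_resolution R (cyclic_module R I) (resolution R (cyclic_module R I))"
  using cyclic_resolution_exists unfolding resolution_def by (metis someI_ex)

end

section \<open>Ext and local cohomology computed from given resolutions\<close>

context module
begin

text \<open>Exchanges the resolution chosen in the definition of Ext for a given one.\<close>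

theorem zero_Ext_cyclic_iff:
  assumes "noetherian_ring R" "ideal I R" and P: "is_free_resolution R (cyclic_module R I) P"
  shows "zero_module (Ext_module R (cyclic_module R I) i M) \<longleftrightarrow>
    (\<forall>z. ext_cocycle R P i M z \<longrightarrow> ext_coboundary R P i M z)"
proof -
  note res = R.resolution_cyclic_module[OF assms(1,2)] and C = R.module_cyclic_module[OF assms(2)]
  show ?thesis
    unfolding zero_Ext_module_iff[OF res]
    using Ext_vanishing_indep[OF C res P] Ext_vanishing_indep[OF C P res] by blast
qed

text \<open>Exchanges both kinds of choices at once, the resolutions of the quotients by all powers
  of I and the lifts of the projections between them, for given ones.\<close>

theorem zero_local_cohomology_iff:
  assumes "noetherian_ring R" "ideal I R"
    and P: "\<And>n. is_free_resolution R (cyclic_module R (ideal_power R I n)) (P n)"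
    and \<phi>: "\<And>n k. n \<le> k \<Longrightarrow> is_lift R (P k) (P n) (cyclic_proj R (ideal_power R I n)) (\<phi> n k)"
  shows "zero_module (local_cohomology R I i M) \<longleftrightarrow> lc_vanishes R P i M \<phi>"
proof -
  let ?A = "\<lambda>n. cyclic_module R (ideal_power R I n)" and ?u = "\<lambda>n k :: nat. cyclic_proj R (ideal_power R I n)"
  have J: "ideal (ideal_power R I n) R" for n by (rule R.ideal_power_ideal[OF assms(2)])
  note C = R.module_cyclic_module[OF J] and res = R.resolution_cyclic_module[OF assms(1) J]
  have u: "?u n k \<in> mod_hom R (?A k) (?A n)" if "n \<le> k" for n k
    by (rule R.cyclic_proj_hom[OF J J R.ideal_power_mono[OF assms(2) that]])
  have uu: "?u n m (?u m k x) = ?u n k x" if "n \<le> m" "m \<le> k" "x \<in> carrier (?A k)" for n m k x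
  proof -
    have nk: "n \<le> k" using that by simp
    show ?thesis
      using that(3) R.cyclic_proj_coset[OF J J R.ideal_power_mono[OF assms(2) that(1)]]
        R.cyclic_proj_coset[OF J J R.ideal_power_mono[OF assms(2) that(2)]]
        R.cyclic_proj_coset[OF J J R.ideal_power_mono[OF assms(2) nk]]
      by (auto simp: R.cyclic_module_simps(1))
  qed
  have "\<exists>\<psi>. (\<forall>n k. n \<le> k \<longrightarrow> is_lift R (resolution R (?A k)) (resolution R (?A n)) (?u n k) (\<psi> n k)) \<and>
      (zero_module (local_cohomology R I i M) \<longleftrightarrow> lc_vanishes R (\<lambda>n. resolution R (?A n)) i M \<psi>)"
    unfolding local_cohomology_def
  proof (rule zero_direct_limit_Ext_iff[where A = ?A and u = ?u])
    show "module R (?A n)" "is_free_resolution R (?A n) (resolution R (?A n))" for n by (rule C, rule res)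
    show "?u n k \<in> mod_hom R (?A k) (?A n)" if "n \<le> k" for n k by (rule u[OF that])
    show "?u n m (?u m k x) = ?u n k x" if "n \<le> m" "m \<le> k" "x \<in> carrier (?A k)" for n m k x
      by (rule uu[OF that])
  qed
  then obtain \<psi> where \<psi>: "\<And>n k. n \<le> k \<Longrightarrow> is_lift R (resolution R (?A k)) (resolution R (?A n)) (?u n k) (\<psi> n k)"
    "zero_module (local_cohomology R I i M) \<longleftrightarrow> lc_vanishes R (\<lambda>n. resolution R (?A n)) i M \<psi>"
    by blast
  show ?thesis
    unfolding \<psi>(2)
  proof
    assume van: "lc_vanishes R (\<lambda>n. resolution R (?A n)) i M \<psi>"
    show "lc_vanishes R P i M \<phi>"
      by (rule lc_vanishes_indep[where u = ?u, OF C res P _ _ van]) (erule \<psi>(1), erule \<phi>)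
  next
    assume van: "lc_vanishes R P i M \<phi>"
    show "lc_vanishes R (\<lambda>n. resolution R (?A n)) i M \<psi>"
      by (rule lc_vanishes_indep[where u = ?u, OF C P res _ _ van]) (erule \<phi>, erule \<psi>(1))
  qed
qed

end

section \<open>Cocycles as vectors\<close>

text \<open>Row j of the matrix of the differential. A linear map z, composed with the differential,
  takes at the j-th basis vector the combination of its own values with these coefficients; cocycles
  are therefore the solutions of the homogeneous system with this matrix.\<close>

definition diff_vec :: "('r, 'p) ring_scheme \<Rightarrow> ('r, 'a) free_res \<Rightarrow> nat \<Rightarrow> nat \<Rightarrow> nat \<Rightarrow> 'r"
  where "diff_vec R P i j = res_diff P i (unit_vec R j)"

text \<open>Rank 0 in front of degree 0 lets one formula describe coboundaries in all degrees: in
  degree 0 the combination is empty, hence zero, and the truncated index \<open>i - 1\<close> does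
  no harm.\<close>

definition prev_rank :: "('r, 'a) free_res \<Rightarrow> nat \<Rightarrow> nat"
  where "prev_rank P i = (case i of 0 \<Rightarrow> 0 | Suc j \<Rightarrow> res_rank P j)"

definition vec_cocycle :: "('r, 'p) ring_scheme \<Rightarrow> ('r, 'a) free_res \<Rightarrow> nat \<Rightarrow> ('r, 'n, 'y) module_scheme
    \<Rightarrow> (nat \<Rightarrow> 'n) \<Rightarrow> bool"
  where "vec_cocycle R P i N x \<longleftrightarrow> (\<forall>k<res_rank P i. x k \<in> carrier N) \<and>
    (\<forall>j<res_rank P (Suc i). lincomb N (res_rank P i) (diff_vec R P i j) x = \<zero>\<^bsub>N\<^esub>)"

definition vec_coboundary :: "('r, 'p) ring_scheme \<Rightarrow> ('r, 'a) free_res \<Rightarrow> nat \<Rightarrow> ('r, 'n, 'y) module_scheme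
    \<Rightarrow> (nat \<Rightarrow> 'n) \<Rightarrow> bool"
  where "vec_coboundary R P i N x \<longleftrightarrow> (\<exists>y. (\<forall>l<prev_rank P i. y l \<in> carrier N) \<and>
    (\<forall>k<res_rank P i. x k = lincomb N (prev_rank P i) (diff_vec R P (i - 1) k) y))"

lemma vec_coboundary_cong:
  "(\<And>k. k < res_rank P i \<Longrightarrow> x k = x' k) \<Longrightarrow> vec_coboundary R P i N x \<longleftrightarrow> vec_coboundary R P i N x'"
  by (simp add: vec_coboundary_def)

lemma diff_vec_closed:
  assumes "cring R" "is_free_resolution R A P" "j < res_rank P (Suc i)"
  shows "diff_vec R P i j \<in> carrier (free_module R (res_rank P i))"
proof -
  interpret cring R by fact
  show ?thesis
    unfolding diff_vec_def using mod_hom_closed[OF free_resolutionD(1)[OF assms(2)]] unit_vec_closed[OF assms(3)]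
    by (simp add: res_mod_def)
qed

context module
begin

lemma ext_cocycle_iff_vec:
  assumes P: "is_free_resolution R A P" and z: "z \<in> mod_hom R (res_mod R P i) M"
  shows "ext_cocycle R P i M z \<longleftrightarrow> vec_cocycle R P i M (\<lambda>k. z (unit_vec R k))"
proof -
  note d = free_resolutionD(1)[OF P, unfolded res_mod_def]
  note zh = z[unfolded res_mod_def]
  have cl: "z (unit_vec R k) \<in> carrier M" if "k < res_rank P i" for k
    using mod_hom_closed[OF zh R.unit_vec_closed[OF that]] .
  have zd: "z (res_diff P i (unit_vec R j)) = lincomb M (res_rank P i) (diff_vec R P i j) (\<lambda>k. z (unit_vec R k))"
    if "j < res_rank P (Suc i)" for j
    using free_hom_expand[OF zh diff_vec_closed[OF R.is_cring P that]] by (simp add: diff_vec_def)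
  have "(\<forall>x\<in>carrier (res_mod R P (Suc i)). z (res_diff P i x) = \<zero>\<^bsub>M\<^esub>) \<longleftrightarrow>
      (\<forall>j<res_rank P (Suc i). z (res_diff P i (unit_vec R j)) = \<zero>\<^bsub>M\<^esub>)"
  proof
    assume *: "\<forall>j<res_rank P (Suc i). z (res_diff P i (unit_vec R j)) = \<zero>\<^bsub>M\<^esub>"
    show "\<forall>x\<in>carrier (res_mod R P (Suc i)). z (res_diff P i x) = \<zero>\<^bsub>M\<^esub>"
      unfolding res_mod_def
      using free_hom_eqI[OF module_axioms mod_hom_comp[OF d zh]
          mod_hom_const_zero[OF R.module_free_module module_axioms]] * by blast
  qed (simp add: res_mod_def)
  then show ?thesis using z cl zd by (simp add: ext_cocycle_def vec_cocycle_def)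
qed

lemma ext_coboundary_iff_vec:
  assumes P: "is_free_resolution R A P" and z: "z \<in> mod_hom R (res_mod R P i) M"
  shows "ext_coboundary R P i M z \<longleftrightarrow> vec_coboundary R P i M (\<lambda>k. z (unit_vec R k))"
proof (cases i)
  case 0
  note zh = z[unfolded res_mod_def 0]
  have "(\<forall>x\<in>carrier (free_module R (res_rank P 0)). z x = \<zero>\<^bsub>M\<^esub>) \<longleftrightarrow>
      (\<forall>j<res_rank P 0. z (unit_vec R j) = \<zero>\<^bsub>M\<^esub>)"
    using free_hom_eqI[OF module_axioms zh mod_hom_const_zero[OF R.module_free_module module_axioms]]
      R.unit_vec_closed by blast
  then show ?thesis using 0 by (simp add: ext_coboundary_def vec_coboundary_def prev_rank_def res_mod_def)
next
  case (Suc j)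
  note d = free_resolutionD(1)[OF P, unfolded res_mod_def]
  note zh = z[unfolded res_mod_def Suc]
  have gd: "g (res_diff P j (unit_vec R k)) = lincomb M (res_rank P j) (diff_vec R P j k) (\<lambda>l. g (unit_vec R l))"
    if "g \<in> mod_hom R (free_module R (res_rank P j)) M" "k < res_rank P (Suc j)" for g k
    using free_hom_expand[OF that(1) diff_vec_closed[OF R.is_cring P that(2)]] by (simp add: diff_vec_def)
  show ?thesis
  proof
    assume "ext_coboundary R P i M z"
    then obtain g where g: "g \<in> mod_hom R (free_module R (res_rank P j)) M"
      "\<forall>x\<in>carrier (free_module R (res_rank P (Suc j))). z x = g (res_diff P j x)"
      by (auto simp: ext_coboundary_def Suc res_mod_def)
    then show "vec_coboundary R P i M (\<lambda>k. z (unit_vec R k))"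
      unfolding vec_coboundary_def using mod_hom_closed[OF g(1)] gd[OF g(1)]
      by (intro exI[of _ "\<lambda>l. g (unit_vec R l)"]) (simp add: Suc prev_rank_def)
  next
    assume "vec_coboundary R P i M (\<lambda>k. z (unit_vec R k))"
    then obtain y where y: "\<And>l. l < res_rank P j \<Longrightarrow> y l \<in> carrier M"
      "\<And>k. k < res_rank P (Suc j) \<Longrightarrow> z (unit_vec R k) = lincomb M (res_rank P j) (diff_vec R P j k) y"
      by (auto simp: vec_coboundary_def Suc prev_rank_def)
    define g where "g = (\<lambda>v. lincomb M (res_rank P j) v y)"
    have g: "g \<in> mod_hom R (free_module R (res_rank P j)) M"
      unfolding g_def by (rule lincomb_mod_hom[OF y(1)])
    have "z x = g (res_diff P j x)" if "x \<in> carrier (free_module R (res_rank P (Suc j)))" for x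
      by (rule free_hom_eqI[OF module_axioms zh mod_hom_comp[OF d g] _ that])
        (simp add: y(2) g_def diff_vec_def)
    then show "ext_coboundary R P i M z"
      using g by (auto simp: ext_coboundary_def Suc res_mod_def)
  qed
qed

text \<open>A map from a free module is the vector of its values on the basis, and every vector
  occurs, so the vanishing of Ext becomes a statement on linear systems in M.\<close>

lemma ext_vanishing_iff_vec:
  assumes P: "is_free_resolution R A P"
  shows "(\<forall>z. ext_cocycle R P i M z \<longrightarrow> ext_coboundary R P i M z) \<longleftrightarrow>
    (\<forall>x. vec_cocycle R P i M x \<longrightarrow> vec_coboundary R P i M x)"
proof (intro iffI allI impI)
  fix x assume *: "\<forall>z. ext_cocycle R P i M z \<longrightarrow> ext_coboundary R P i M z" and x: "vec_cocycle R P i M x"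
  define z where "z = (\<lambda>v. lincomb M (res_rank P i) v x)"
  have xc: "x k \<in> carrier M" if "k < res_rank P i" for k using x that by (simp add: vec_cocycle_def)
  have z: "z \<in> mod_hom R (res_mod R P i) M"
    unfolding z_def res_mod_def by (rule lincomb_mod_hom[OF xc])
  have zx: "z (unit_vec R k) = x k" if "k < res_rank P i" for k
    unfolding z_def by (rule lincomb_unit_vec[OF xc that])
  have "lincomb M (res_rank P i) (diff_vec R P i j) (\<lambda>k. z (unit_vec R k)) =
      lincomb M (res_rank P i) (diff_vec R P i j) x" for j
    by (rule lincomb_cong) (simp_all add: zx)
  then have "vec_cocycle R P i M (\<lambda>k. z (unit_vec R k))"
    using x by (simp add: vec_cocycle_def zx)
  then have "vec_coboundary R P i M (\<lambda>k. z (unit_vec R k))"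
    using * ext_cocycle_iff_vec[OF P z] ext_coboundary_iff_vec[OF P z] by blast
  then show "vec_coboundary R P i M x" using vec_coboundary_cong[of P i _ x, OF zx] by blast
next
  fix z assume "\<forall>x. vec_cocycle R P i M x \<longrightarrow> vec_coboundary R P i M x" and z: "ext_cocycle R P i M z"
  then show "ext_coboundary R P i M z"
    using ext_cocycle_iff_vec[OF P, of z i] ext_coboundary_iff_vec[OF P, of z i] by (simp add: ext_cocycle_def)
qed

lemma vec_cocycle_hom:
  assumes P: "is_free_resolution R A P" and x: "vec_cocycle R P i M x"
  shows "ext_cocycle R P i M (\<lambda>v. lincomb M (res_rank P i) v x)"
proof -
  have xc: "x k \<in> carrier M" if "k < res_rank P i" for k using x that by (simp add: vec_cocycle_def)
  have z: "(\<lambda>v. lincomb M (res_rank P i) v x) \<in> mod_hom R (res_mod R P i) M"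
    unfolding res_mod_def by (rule lincomb_mod_hom[OF xc])
  have "lincomb M (res_rank P i) (diff_vec R P i j) (\<lambda>k. lincomb M (res_rank P i) (unit_vec R k) x) =
      lincomb M (res_rank P i) (diff_vec R P i j) x" for j
    by (rule lincomb_cong) (simp_all add: lincomb_unit_vec[OF xc])
  then show ?thesis
    using x unfolding ext_cocycle_iff_vec[OF P z] by (simp add: vec_cocycle_def lincomb_unit_vec[OF xc])
qed

lemma ext_coboundary_hom_iff_vec:
  assumes P: "is_free_resolution R A P" and Q: "is_free_resolution R B Q"
    and g: "g \<in> mod_hom R (res_mod R Q i) (res_mod R P i)"
    and xc: "\<And>k. k < res_rank P i \<Longrightarrow> x k \<in> carrier M"
  shows "ext_coboundary R Q i M (\<lambda>v. lincomb M (res_rank P i) (g v) x) \<longleftrightarrow>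
    vec_coboundary R Q i M (\<lambda>j. lincomb M (res_rank P i) (g (unit_vec R j)) x)"
  by (rule ext_coboundary_iff_vec[OF Q mod_hom_comp[OF g]])
    (use lincomb_mod_hom[OF xc] in \<open>simp add: res_mod_def\<close>)

text \<open>On vectors of values the transition map is again a matrix: its rows are the images of
  the basis vectors under the lift.\<close>

lemma lc_vanishes_iff_vec:
  assumes P: "\<And>n. is_free_resolution R (A n) (P n)"
    and \<phi>: "\<And>n k. n \<le> k \<Longrightarrow> is_lift R (P k) (P n) (u n k) (\<phi> n k)"
  shows "lc_vanishes R P i M \<phi> \<longleftrightarrow>
    (\<forall>n x. vec_cocycle R (P n) i M x \<longrightarrow> (\<exists>k\<ge>n. vec_coboundary R (P k) i M
      (\<lambda>j. lincomb M (res_rank (P n) i) (\<phi> n k i (unit_vec R j)) x)))"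
proof -
  have vc: "ext_coboundary R (P k) i M (\<lambda>v. lincomb M (res_rank (P n) i) (\<phi> n k i v) x) \<longleftrightarrow>
      vec_coboundary R (P k) i M (\<lambda>j. lincomb M (res_rank (P n) i) (\<phi> n k i (unit_vec R j)) x)"
    if "n \<le> k" "vec_cocycle R (P n) i M x" for n k x
    by (rule ext_coboundary_hom_iff_vec[OF P P is_liftD(1)[OF \<phi>[OF that(1)]]])
      (use that(2) in \<open>simp add: vec_cocycle_def\<close>)
  show ?thesis
  proof (intro iffI allI impI)
    fix n x assume lc: "lc_vanishes R P i M \<phi>" and x: "vec_cocycle R (P n) i M x"
    show "\<exists>k\<ge>n. vec_coboundary R (P k) i M (\<lambda>j. lincomb M (res_rank (P n) i) (\<phi> n k i (unit_vec R j)) x)"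
      using lc vec_cocycle_hom[OF P x] vc[OF _ x] unfolding lc_vanishes_def by blast
  next
    assume *: "\<forall>n x. vec_cocycle R (P n) i M x \<longrightarrow> (\<exists>k\<ge>n. vec_coboundary R (P k) i M
      (\<lambda>j. lincomb M (res_rank (P n) i) (\<phi> n k i (unit_vec R j)) x))"
    show "lc_vanishes R P i M \<phi>"
      unfolding lc_vanishes_def
    proof (intro allI impI)
      fix n z assume z: "ext_cocycle R (P n) i M z"
      define x where "x = (\<lambda>k. z (unit_vec R k))"
      have zh: "z \<in> mod_hom R (res_mod R (P n) i) M" using z by (simp add: ext_cocycle_def)
      have x: "vec_cocycle R (P n) i M x"
        using ext_cocycle_iff_vec[OF P zh] z by (simp add: x_def)
      obtain k where k: "n \<le> k" "ext_coboundary R (P k) i M (\<lambda>v. lincomb M (res_rank (P n) i) (\<phi> n k i v) x)"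
        using * x vc by blast
      have "z (\<phi> n k i v) = lincomb M (res_rank (P n) i) (\<phi> n k i v) x" if "v \<in> carrier (res_mod R (P k) i)" for v
        unfolding x_def using zh mod_hom_closed[OF is_liftD(1)[OF \<phi>[OF k(1)]] that]
        by (intro free_hom_expand) (simp_all add: res_mod_def)
      then have "ext_coboundary R (P k) i M (\<lambda>v. z (\<phi> n k i v)) \<longleftrightarrow>
          ext_coboundary R (P k) i M (\<lambda>v. lincomb M (res_rank (P n) i) (\<phi> n k i v) x)"
        by (intro ext_coboundary_cong)
      then show "\<exists>k\<ge>n. ext_coboundary R (P k) i M (\<lambda>x. z (\<phi> n k i x))"
        using k by blast
    qed
  qed
qed

end

text \<open>Composition with \<open>h\<close> moves a cocycle to N', where it dies at some stage;
  composition with \<open>g\<close> turns a primitive found there into one over N.\<close>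

lemma lc_vanishes_retract:
  assumes N: "module R N" and N': "module R N'"
    and P: "\<And>n. is_free_resolution R (A n) (P n)"
    and \<phi>: "\<And>n k. n \<le> k \<Longrightarrow> is_lift R (P k) (P n) (u n k) (\<phi> n k)"
    and h: "h \<in> mod_hom R N N'" and g: "g \<in> mod_hom R N' N"
    and gh: "\<And>x. x \<in> carrier N \<Longrightarrow> g (h x) = x" and lc: "lc_vanishes R P i N' \<phi>"
  shows "lc_vanishes R P i N \<phi>"
  unfolding lc_vanishes_def
proof (intro allI impI)
  fix n z assume z: "ext_cocycle R (P n) i N z"
  then have zh: "z \<in> mod_hom R (res_mod R (P n) i) N" by (simp add: ext_cocycle_def)
  have "ext_cocycle R (P n) i N' (\<lambda>x. h (z x))"
    using z mod_hom_comp[OF zh h] mod_hom_zero[OF N N' h] by (simp add: ext_cocycle_def)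
  then obtain k where k: "n \<le> k" "ext_coboundary R (P k) i N' (\<lambda>x. h (z (\<phi> n k i x)))"
    using lc unfolding lc_vanishes_def by blast
  have zz: "g (h (z (\<phi> n k i x))) = z (\<phi> n k i x)" if "x \<in> carrier (res_mod R (P k) i)" for x
    by (rule gh[OF mod_hom_closed[OF zh mod_hom_closed[OF is_liftD(1)[OF \<phi>[OF k(1)]] that]]])
  have "ext_coboundary R (P k) i N (\<lambda>x. z (\<phi> n k i x))"
  proof (cases i)
    case 0
    have "z (\<phi> n k i x) = \<zero>\<^bsub>N\<^esub>" if "x \<in> carrier (res_mod R (P k) 0)" for x
      using k(2) zz[of x] mod_hom_zero[OF N' N g] that 0 by (simp add: ext_coboundary_def)
    then show ?thesis using 0 by (simp add: ext_coboundary_def)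
  next
    case (Suc j)
    then obtain e where e: "e \<in> mod_hom R (res_mod R (P k) j) N'"
      "\<forall>x\<in>carrier (res_mod R (P k) (Suc j)). h (z (\<phi> n k i x)) = e (res_diff (P k) j x)"
      using k(2) by (auto simp: ext_coboundary_def)
    have "z (\<phi> n k i x) = g (e (res_diff (P k) j x))" if "x \<in> carrier (res_mod R (P k) (Suc j))" for x
      using e(2) zz[of x] that Suc by simp
    then show ?thesis using mod_hom_comp[OF e(1) g] Suc by (auto simp: ext_coboundary_def)
  qed
  then show "\<exists>k\<ge>n. ext_coboundary R (P k) i N (\<lambda>x. z (\<phi> n k i x))" using k(1) by blast
qed

lemma lc_vanishes_iso:
  assumes N: "module R N" and N': "module R N'"
    and P: "\<And>n. is_free_resolution R (A n) (P n)"
    and \<phi>: "\<And>n k. n \<le> k \<Longrightarrow> is_lift R (P k) (P n) (u n k) (\<phi> n k)"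
    and h: "h \<in> mod_hom R N N'" and bij: "bij_betw h (carrier N) (carrier N')"
  shows "lc_vanishes R P i N \<phi> \<longleftrightarrow> lc_vanishes R P i N' \<phi>"
proof -
  let ?g = "inv_into (carrier N) h"
  interpret N: module R N by fact
  have inj: "inj_on h (carrier N)" and img: "h ` carrier N = carrier N'"
    using bij by (auto simp: bij_betw_def)
  have gh: "?g (h x) = x" if "x \<in> carrier N" for x using inj that by simp
  have hg: "h (?g y) = y" "?g y \<in> carrier N" if "y \<in> carrier N'" for y
    using that unfolding img[symmetric] by (auto intro: f_inv_into_f inv_into_into)
  have g: "?g \<in> mod_hom R N' N"
  proof (rule mod_homI)
    fix x y assume xy: "x \<in> carrier N'" "y \<in> carrier N'"
    have "?g (h (?g x \<oplus>\<^bsub>N\<^esub> ?g y)) = ?g x \<oplus>\<^bsub>N\<^esub> ?g y" using hg(2)[OF xy(1)] hg(2)[OF xy(2)] by (intro gh) simp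
    then show "?g (x \<oplus>\<^bsub>N'\<^esub> y) = ?g x \<oplus>\<^bsub>N\<^esub> ?g y"
      using mod_hom_add[OF h hg(2)[OF xy(1)] hg(2)[OF xy(2)]] hg(1) xy by simp
  next
    fix r x assume rx: "r \<in> carrier R" "x \<in> carrier N'"
    have "?g (h (r \<odot>\<^bsub>N\<^esub> ?g x)) = r \<odot>\<^bsub>N\<^esub> ?g x" using hg(2)[OF rx(2)] rx(1) by (intro gh) simp
    then show "?g (r \<odot>\<^bsub>N'\<^esub> x) = r \<odot>\<^bsub>N\<^esub> ?g x"
      using mod_hom_smult[OF h rx(1) hg(2)[OF rx(2)]] hg(1) rx by simp
  qed (rule hg(2))
  show ?thesis
  proof
    assume lc: "lc_vanishes R P i N \<phi>"
    show "lc_vanishes R P i N' \<phi>"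
      by (rule lc_vanishes_retract[where u = u, OF N' N P _ g h _ lc]) (erule \<phi>, rule hg(1))
  next
    assume lc: "lc_vanishes R P i N' \<phi>"
    show "lc_vanishes R P i N \<phi>"
      by (rule lc_vanishes_retract[where u = u, OF N N' P _ h g _ lc]) (erule \<phi>, rule gh)
  qed
qed

section \<open>Base change of resolutions\<close>

context ring_change
begin

text \<open>The map over T whose matrix is that of \<open>g\<close> with \<open>f\<close> applied to
  every entry; v is a row vector multiplied by it.\<close>

definition base_change_hom :: "nat \<Rightarrow> nat \<Rightarrow> ((nat \<Rightarrow> 'r) \<Rightarrow> (nat \<Rightarrow> 'r)) \<Rightarrow> (nat \<Rightarrow> 't) \<Rightarrow> (nat \<Rightarrow> 't)"
  where "base_change_hom b c g v = lincomb (free_module T c) b v (\<lambda>j k. f (g (unit_vec R j) k))"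

lemma f_lincomb:
  assumes "\<And>k. k < b \<Longrightarrow> v k \<in> carrier R" "\<And>k. k < b \<Longrightarrow> x k \<in> carrier R"
  shows "f (lincomb (ring_module R) b v x) = lincomb (ring_module T) b (\<lambda>k. f (v k)) (\<lambda>k. f (x k))"
  using assms by (intro module.lincomb_image[OF R.module_ring_module]) (simp_all add: f_add f_mult)

lemma f_vec_closed:
  "v \<in> carrier (free_module R b) \<Longrightarrow> (\<lambda>k. f (v k)) \<in> carrier (free_module T b)"
  by (simp add: carrier_free_module)

context
  fixes b c g
  assumes g: "g \<in> mod_hom R (free_module R b) (free_module R c)"
begin

lemma base_change_hom: "base_change_hom b c g \<in> mod_hom T (free_module T b) (free_module T c)"
  unfolding base_change_hom_def
  using mod_hom_closed[OF g R.unit_vec_closed]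
  by (intro module.lincomb_mod_hom[OF T.module_free_module] f_vec_closed)

lemma base_change_hom_vec:
  assumes u: "u \<in> carrier (free_module R b)"
  shows "base_change_hom b c g (\<lambda>k. f (u k)) = (\<lambda>k. f (g u k))"
proof
  fix k
  have "g u = lincomb (free_module R c) b u (\<lambda>j. g (unit_vec R j))"
    by (rule module.free_hom_expand[OF R.module_free_module g u])
  then have "f (g u k) = f (lincomb (ring_module R) b u (\<lambda>j. g (unit_vec R j) k))"
    by (simp add: lincomb_free_module_nth)
  also have "\<dots> = lincomb (ring_module T) b (\<lambda>j. f (u j)) (\<lambda>j. f (g (unit_vec R j) k))"
    using R.free_module_nth[OF u] R.free_module_nth[OF mod_hom_closed[OF g R.unit_vec_closed]]
    by (rule f_lincomb)
  also have "\<dots> = base_change_hom b c g (\<lambda>k. f (u k)) k"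
    by (simp add: base_change_hom_def lincomb_free_module_nth)
  finally show "base_change_hom b c g (\<lambda>k. f (u k)) k = f (g u k)" ..
qed

lemma base_change_hom_unit_vec:
  assumes "j < b"
  shows "base_change_hom b c g (unit_vec T j) = (\<lambda>k. f (g (unit_vec R j) k))"
proof -
  have "unit_vec T j = (\<lambda>k. f (unit_vec R j k))" by (auto simp: unit_vec_def)
  then show ?thesis using base_change_hom_vec[OF R.unit_vec_closed[OF assms]] by simp
qed

end

text \<open>The differentials have the matrices of P, read over T. The augmentation is prescribed as
  the projection onto T/J; this fits a P that begins with rank 1 and the projection onto
  R/I.\<close>

definition base_change_res :: "'t set \<Rightarrow> ('r, 'a) free_res \<Rightarrow> ('t, 't set) free_res"
  where "base_change_res J P = \<lparr>res_rank = res_rank P,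
     res_diff = (\<lambda>i. base_change_hom (res_rank P (Suc i)) (res_rank P i) (res_diff P i)),
     res_aug = (\<lambda>v. J +>\<^bsub>T\<^esub> v 0)\<rparr>"

lemma base_change_genideal: "I \<subseteq> carrier R \<Longrightarrow> ideal (genideal T (f ` I)) T"
  by (rule T.genideal_ideal) auto

text \<open>The chain map equations survive entry by entry, being equations on basis vectors. Only
  the augmentation calls for an argument, because over T it is prescribed rather than obtained from
  P.\<close>

lemma base_change_lift:
  assumes I: "ideal I R" and J: "ideal J R" and IJ: "I \<subseteq> J"
    and P: "is_free_resolution R (cyclic_module R J) P" "res_rank P 0 = 1" "res_aug P = (\<lambda>v. J +>\<^bsub>R\<^esub> v 0)"
    and Q: "is_free_resolution R (cyclic_module R I) Q" "res_rank Q 0 = 1" "res_aug Q = (\<lambda>v. I +>\<^bsub>R\<^esub> v 0)"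
    and \<phi>: "is_lift R Q P (cyclic_proj R J) \<phi>"
    and I': "I' = genideal T (f ` I)" and J': "J' = genideal T (f ` J)"
  shows "is_lift T (base_change_res I' Q) (base_change_res J' P) (cyclic_proj T J')
    (\<lambda>i. base_change_hom (res_rank Q i) (res_rank P i) (\<phi> i))"
proof -
  note p = free_resolutionD[OF P(1), unfolded res_mod_def] and q = free_resolutionD[OF Q(1), unfolded res_mod_def]
  note l = is_liftD[OF \<phi>, unfolded res_mod_def]
  have Ic: "I \<subseteq> carrier R" and Jc: "J \<subseteq> carrier R" using ideal.Icarr[OF I] ideal.Icarr[OF J] by auto
  have I'': "ideal I' T" and J'': "ideal J' T" unfolding I' J' using base_change_genideal Ic Jc by auto
  have fJ: "f x \<in> J'" if "x \<in> J" for x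
  proof -
    have "f ` J \<subseteq> carrier T" using Jc by (auto simp: subset_iff)
    from T.genideal_self[OF this] show ?thesis unfolding J' using that by blast
  qed
  have IJ': "I' \<subseteq> J'" unfolding I'
    by (rule T.genideal_minimal[OF J'']) (use fJ IJ in auto)
  let ?bc = "\<lambda>i. base_change_hom (res_rank Q i) (res_rank P i) (\<phi> i)"
  note bch = base_change_hom[OF l(1)]
  show ?thesis
    unfolding is_lift_def res_mod_def base_change_res_def free_res.simps
  proof (intro conjI allI ballI)
    show "?bc i \<in> mod_hom T (free_module T (res_rank Q i)) (free_module T (res_rank P i))" for i
      by (rule bch)
    have C: "module T (cyclic_module T J')" by (rule T.module_cyclic_module[OF J''])
    have h1: "(\<lambda>x. J' +>\<^bsub>T\<^esub> ?bc 0 x 0) \<in> mod_hom T (free_module T 1) (cyclic_module T J')"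
      using mod_hom_comp[OF bch[of 0, unfolded P(2) Q(2)] T.cyclic_aug_hom[OF J'']] by (simp add: P(2) Q(2))
    have h2: "(\<lambda>x. cyclic_proj T J' (I' +>\<^bsub>T\<^esub> x 0)) \<in> mod_hom T (free_module T 1) (cyclic_module T J')"
      by (rule mod_hom_comp[OF T.cyclic_aug_hom[OF I''] T.cyclic_proj_hom[OF I'' J'' IJ']])
    \<comment> \<open>The lift sends the basis vector of degree 0 to some y congruent to 1 modulo J.
      Applying \<open>f\<close> gives a congruence modulo J', which is the condition over T at the
      only basis vector.\<close>
    have base: "J' +>\<^bsub>T\<^esub> ?bc 0 (unit_vec T j) 0 = cyclic_proj T J' (I' +>\<^bsub>T\<^esub> unit_vec T j 0)" if "j < 1" for j
    proof -
      have j: "j = 0" using that by simp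
      let ?e = "unit_vec R 0"
      have e: "?e \<in> carrier (free_module R (res_rank Q 0))" by (simp add: Q(2))
      define y where "y = \<phi> 0 ?e 0"
      have yc: "y \<in> carrier R" unfolding y_def by (rule R.free_module_nth[OF mod_hom_closed[OF l(1) e]])
      have "J +>\<^bsub>R\<^esub> y = cyclic_proj R J (I +>\<^bsub>R\<^esub> ?e 0)"
        using l(2)[OF e] by (simp add: P(3) Q(3) y_def)
      also have "\<dots> = J +>\<^bsub>R\<^esub> \<one>\<^bsub>R\<^esub>"
        using R.cyclic_proj_coset[OF I J IJ R.one_closed] by (simp add: unit_vec_def)
      finally have "y \<ominus>\<^bsub>R\<^esub> \<one>\<^bsub>R\<^esub> \<in> J" using R.coset_eq_iff[OF J yc R.one_closed] by simp
      then have "f (y \<ominus>\<^bsub>R\<^esub> \<one>\<^bsub>R\<^esub>) \<in> J'" by (rule fJ)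
      moreover have "f (y \<ominus>\<^bsub>R\<^esub> \<one>\<^bsub>R\<^esub>) = f y \<ominus>\<^bsub>T\<^esub> \<one>\<^bsub>T\<^esub>"
      proof -
        have "f (y \<ominus>\<^bsub>R\<^esub> \<one>\<^bsub>R\<^esub>) \<oplus>\<^bsub>T\<^esub> \<one>\<^bsub>T\<^esub> = f y"
          using f_add[of "y \<ominus>\<^bsub>R\<^esub> \<one>\<^bsub>R\<^esub>" "\<one>\<^bsub>R\<^esub>"] yc by (simp add: R.minus_eq R.a_assoc R.l_neg)
        moreover have "f (y \<ominus>\<^bsub>R\<^esub> \<one>\<^bsub>R\<^esub>) \<in> carrier T" using yc by simp
        ultimately show ?thesis by (metis T.minus_eq T.a_assoc T.one_closed T.a_inv_closed T.r_neg T.r_zero)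
      qed
      ultimately have "J' +>\<^bsub>T\<^esub> f y = J' +>\<^bsub>T\<^esub> \<one>\<^bsub>T\<^esub>"
        using T.coset_eq_iff[OF J'' f_closed[OF yc] T.one_closed] by simp
      then show ?thesis
        unfolding j using base_change_hom_unit_vec[OF l(1)[of 0], of 0] Q(2)
          T.cyclic_proj_coset[OF I'' J'' IJ' T.one_closed]
        by (simp add: y_def) (simp add: unit_vec_def)
    qed
    show "J' +>\<^bsub>T\<^esub> ?bc 0 x 0 = cyclic_proj T J' (I' +>\<^bsub>T\<^esub> x 0)" if "x \<in> carrier (free_module T (res_rank Q 0))" for x
      by (rule free_hom_eqI[OF C h1 h2 base]) (use that in \<open>simp_all add: Q(2)\<close>)
    show "base_change_hom (res_rank P (Suc i)) (res_rank P i) (res_diff P i) (?bc (Suc i) x) =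
        ?bc i (base_change_hom (res_rank Q (Suc i)) (res_rank Q i) (res_diff Q i) x)"
      if x: "x \<in> carrier (free_module T (res_rank Q (Suc i)))" for i x
    proof (rule free_hom_eqI[OF T.module_free_module mod_hom_comp[OF bch base_change_hom[OF p(1)]]
          mod_hom_comp[OF base_change_hom[OF q(1)] bch] _ x])
      fix j assume j: "j < res_rank Q (Suc i)"
      note e = R.unit_vec_closed[OF j]
      show "base_change_hom (res_rank P (Suc i)) (res_rank P i) (res_diff P i) (?bc (Suc i) (unit_vec T j)) =
        ?bc i (base_change_hom (res_rank Q (Suc i)) (res_rank Q i) (res_diff Q i) (unit_vec T j))"
        by (simp add: base_change_hom_unit_vec[OF l(1) j] base_change_hom_unit_vec[OF q(1) j]
            base_change_hom_vec[OF p(1) mod_hom_closed[OF l(1) e]] base_change_hom_vec[OF l(1) mod_hom_closed[OF q(1) e]]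
            l(3)[OF e])
    qed
  qed
qed

end

section \<open>Exactness of the base change of a resolution\<close>

lemma (in cring) fin_gen_ring_module: "fin_gen_module R (ring_module R)"
proof -
  interpret RM: module R "ring_module R" by (rule module_ring_module)
  have "x = (\<Oplus>\<^bsub>ring_module R\<^esub>s\<in>{\<one>}. x \<odot>\<^bsub>ring_module R\<^esub> s)" if "x \<in> carrier R" for x
    using that by simp
  then show ?thesis
    unfolding fin_gen_module_def by (intro exI[of _ "{\<one>}"]) (auto intro!: bexI[of _ "\<lambda>_. _"])
qed

context flat_change
begin

text \<open>\<open>flat_kernel\<close> for M = R, carried to T through the isomorphism of T
  \<otimes> R with T.\<close>

lemma flat_kernel_ring:
  fixes q r :: nat
  assumes B: "\<And>j k. j < r \<Longrightarrow> k < q \<Longrightarrow> B j k \<in> carrier R"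
    and x: "\<And>k. k < q \<Longrightarrow> x k \<in> carrier T"
    and eq: "\<And>j. j < r \<Longrightarrow> lincomb (ring_module T) q (\<lambda>k. f (B j k)) x = \<zero>\<^bsub>T\<^esub>"
  shows "\<exists>s t w. (\<forall>l<s. t l \<in> carrier T) \<and> (\<forall>l<s. \<forall>k<q. w l k \<in> carrier R) \<and>
    (\<forall>l<s. \<forall>j<r. lincomb (ring_module R) q (B j) (w l) = \<zero>\<^bsub>R\<^esub>) \<and>
    (\<forall>k<q. x k = lincomb (ring_module T) s t (\<lambda>l. f (w l k)))"
proof -
  let ?R = "ring_module R"
  note M = R.module_ring_module and N = T.module_ring_module
  note bM = module_bc[OF M]
  interpret bM: module T "bc ?R" by (rule bM)
  interpret N: module T "ring_module T" by (rule N)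
  obtain \<kappa> :: "(nat \<Rightarrow> 'r) \<Rightarrow> (nat \<Rightarrow> 'r) set" where \<kappa>: "inj_on \<kappa> {x. \<forall>k. x k \<in> carrier ?R}"
    by (rule fin_gen_embedding[OF M R.fin_gen_ring_module])
  obtain h where h: "h \<in> mod_hom T (bc ?R) (ring_module T)" "bij_betw h (carrier (bc ?R)) (carrier T)"
    "\<And>t r. t \<in> carrier T \<Longrightarrow> r \<in> carrier R \<Longrightarrow> h (tens ?R t r) = t \<otimes>\<^bsub>T\<^esub> f r"
    by (rule bc_ring_module) blast
  have "\<forall>k. \<exists>y. k < q \<longrightarrow> y \<in> carrier (bc ?R) \<and> h y = x k"
    using h(2) x unfolding bij_betw_def by (metis imageE)
  from choice[OF this] obtain y where y: "\<And>k. k < q \<Longrightarrow> y k \<in> carrier (bc ?R)" "\<And>k. k < q \<Longrightarrow> h (y k) = x k"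
    by blast
  have "lincomb (bc ?R) q (\<lambda>k. f (B j k)) y = \<zero>\<^bsub>bc ?R\<^esub>" if j: "j < r" for j
  proof -
    have cl: "lincomb (bc ?R) q (\<lambda>k. f (B j k)) y \<in> carrier (bc ?R)"
      using y(1) B[OF j] by (intro bM.lincomb_closed) auto
    have "h (lincomb (bc ?R) q (\<lambda>k. f (B j k)) y) = lincomb (ring_module T) q (\<lambda>k. f (B j k)) (\<lambda>k. h (y k))"
      using y(1) B[OF j] by (intro mod_hom_lincomb[OF bM N h(1)]) auto
    also have "\<dots> = lincomb (ring_module T) q (\<lambda>k. f (B j k)) x" by (rule lincomb_cong) (simp_all add: y(2))
    also have "\<dots> = h \<zero>\<^bsub>bc ?R\<^esub>" using eq[OF j] mod_hom_zero[OF bM N h(1)] by simp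
    finally show ?thesis using h(2) cl bM.zero_closed unfolding bij_betw_def inj_on_def by blast
  qed
  from flat_kernel[where q = q and r = r and B = B and x = y, OF M \<kappa> B y(1) this] obtain s t w where stw:
    "\<forall>l<s. t l \<in> carrier T" "\<forall>l<s. \<forall>k<q. w l k \<in> carrier ?R"
    "\<forall>l<s. \<forall>j<r. lincomb ?R q (B j) (w l) = \<zero>\<^bsub>?R\<^esub>"
    "\<forall>k<q. y k = lincomb (bc ?R) s t (\<lambda>l. tens ?R \<one>\<^bsub>T\<^esub> (w l k))"
    by auto
  have "x k = lincomb (ring_module T) s t (\<lambda>l. f (w l k))" if k: "k < q" for k
  proof -
    have "x k = h (lincomb (bc ?R) s t (\<lambda>l. tens ?R \<one>\<^bsub>T\<^esub> (w l k)))" using y(2) stw(4) k by simp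
    also have "\<dots> = lincomb (ring_module T) s t (\<lambda>l. h (tens ?R \<one>\<^bsub>T\<^esub> (w l k)))"
      using stw(1,2) k by (intro mod_hom_lincomb[OF bM N h(1)]) auto
    also have "\<dots> = lincomb (ring_module T) s t (\<lambda>l. f (w l k))"
      using stw(2) k by (intro lincomb_cong) (simp_all add: h(3))
    finally show ?thesis .
  qed
  then show ?thesis using stw(1,2,3) by (intro exI[of _ s] exI[of _ t] exI[of _ w]) simp
qed

text \<open>In positive degrees a cycle over T is, by flatness, a combination of cycles over R, and
  those are boundaries. In degree 0 the image of the differential is an ideal of T that lies in J
  and contains the image of I, so it equals J.\<close>

lemma base_change_resolution:
  assumes I: "ideal I R" and P: "is_free_resolution R (cyclic_module R I) P"
    and rank: "res_rank P 0 = 1" and aug: "res_aug P = (\<lambda>v. I +>\<^bsub>R\<^esub> v 0)"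
    and J: "J = genideal T (f ` I)"
  shows "is_free_resolution T (cyclic_module T J) (base_change_res J P)"
proof -
  note p = free_resolutionD[OF P, unfolded res_mod_def]
  have Ic: "I \<subseteq> carrier R" using ideal.Icarr[OF I] by auto
  have J': "ideal J T" unfolding J by (rule base_change_genideal[OF Ic])
  let ?F = "free_module T" and ?r = "res_rank P" and ?C = "cyclic_module T J"
  let ?d = "\<lambda>i. base_change_hom (?r (Suc i)) (?r i) (res_diff P i)"
  note d = base_change_hom[OF p(1)]
  have comb: "?d i (lincomb (?F (?r (Suc i))) s t (\<lambda>l k. f (u l k))) =
      lincomb (?F (?r i)) s t (\<lambda>l k. f (res_diff P i (u l) k))"
    if "\<And>l. l < s \<Longrightarrow> t l \<in> carrier T" "\<And>l. l < s \<Longrightarrow> u l \<in> carrier (free_module R (?r (Suc i)))" for i s t u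
  proof -
    have "?d i (lincomb (?F (?r (Suc i))) s t (\<lambda>l k. f (u l k))) =
        lincomb (?F (?r i)) s t (\<lambda>l. ?d i (\<lambda>k. f (u l k)))"
      using that by (intro mod_hom_lincomb[OF T.module_free_module T.module_free_module d]) (auto intro: f_vec_closed)
    also have "\<dots> = lincomb (?F (?r i)) s t (\<lambda>l k. f (res_diff P i (u l) k))"
      using that(2) by (intro lincomb_cong) (simp_all add: base_change_hom_vec[OF p(1)])
    finally show ?thesis .
  qed
  have dd: "?d i (?d (Suc i) v) = \<zero>\<^bsub>?F (?r i)\<^esub>" if "v \<in> carrier (?F (?r (Suc (Suc i))))" for i v
  proof (rule free_hom_eqI[OF T.module_free_module mod_hom_comp[OF d d] mod_hom_const_zero[OF T.module_free_module T.module_free_module] _ that])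
    fix j assume j: "j < ?r (Suc (Suc i))"
    note e = R.unit_vec_closed[OF j]
    have "res_diff P i (res_diff P (Suc i) (unit_vec R j)) = \<zero>\<^bsub>free_module R (?r i)\<^esub>"
      using free_resolution_diff_diff[OF P] e by (simp add: res_mod_def)
    then show "?d i (?d (Suc i) (unit_vec T j)) = \<zero>\<^bsub>?F (?r i)\<^esub>"
      by (simp add: base_change_hom_unit_vec[OF p(1) j] base_change_hom_vec[OF p(1) mod_hom_closed[OF p(1) e]])
  qed
  have ex: "v \<in> ?d (Suc i) ` carrier (?F (?r (Suc (Suc i))))"
    if v: "v \<in> carrier (?F (?r (Suc i)))" and dv: "?d i v = \<zero>\<^bsub>?F (?r i)\<^esub>" for i v
  proof -
    let ?q = "?r (Suc i)"
    \<comment> \<open>The transposed matrix, because the equation for coordinate k collects the k-th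
      entries of all rows.\<close>
    define B where "B k j = res_diff P i (unit_vec R j) k" for k j
    have B: "B k j \<in> carrier R" if "j < ?q" for k j
      unfolding B_def by (rule R.free_module_nth[OF mod_hom_closed[OF p(1) R.unit_vec_closed[OF that]]])
    \<comment> \<open>\<open>base_change_hom\<close> uses v as coefficients, the linear system uses
      it as unknowns; commutativity identifies the two readings.\<close>
    have swap: "lincomb (ring_module S) b x y = lincomb (ring_module S) b y x"
      if "cring S" "\<forall>k<b. x k \<in> carrier S" "\<forall>k<b. y k \<in> carrier S"
      for S :: "('s, 'z) ring_scheme" and b x y
    proof -
      interpret S: cring S by fact
      show ?thesis using that(2,3) by (induction b) (auto simp: S.m_comm)
    qed
    have "lincomb (ring_module T) ?q (\<lambda>j. f (B k j)) v = \<zero>\<^bsub>T\<^esub>" for k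
    proof -
      have "lincomb (ring_module T) ?q (\<lambda>j. f (B k j)) v = lincomb (ring_module T) ?q v (\<lambda>j. f (B k j))"
        using B T.free_module_nth[OF v] by (intro swap T.is_cring) auto
      also have "\<dots> = ?d i v k" by (simp add: base_change_hom_def lincomb_free_module_nth B_def)
      finally show ?thesis using dv by simp
    qed
    from flat_kernel_ring[of "?r i" ?q B v, OF B T.free_module_nth[OF v] this]
    obtain s t w where stw: "\<forall>l<s. t l \<in> carrier T" "\<forall>l<s. \<forall>k<?q. w l k \<in> carrier R"
      "\<forall>l<s. \<forall>j<?r i. lincomb (ring_module R) ?q (B j) (w l) = \<zero>\<^bsub>R\<^esub>"
      "\<forall>k<?q. v k = lincomb (ring_module T) s t (\<lambda>l. f (w l k))" by auto
    \<comment> \<open>Each solution over R, padded to an element of the free module, is a cycle of P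
      and hence a boundary.\<close>
    have "\<exists>u. u \<in> carrier (free_module R (?r (Suc (Suc i)))) \<and> (\<forall>k<?q. w l k = res_diff P (Suc i) u k)" if l: "l < s" for l
    proof -
      define x where "x = (\<lambda>k. if k < ?q then w l k else \<zero>\<^bsub>R\<^esub>)"
      have x: "x \<in> carrier (free_module R ?q)" using stw(2) l by (simp add: x_def carrier_free_module)
      have "res_diff P i x k = \<zero>\<^bsub>R\<^esub>" for k
      proof (cases "k < ?r i")
        case True
        have "res_diff P i x k = lincomb (ring_module R) ?q x (B k)"
          unfolding module.free_hom_expand[OF R.module_free_module p(1) x] by (simp add: lincomb_free_module_nth B_def[abs_def])
        also have "\<dots> = lincomb (ring_module R) ?q (B k) x"
          using B R.free_module_nth[OF x] by (intro swap R.is_cring) auto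
        also have "\<dots> = lincomb (ring_module R) ?q (B k) (w l)" by (rule lincomb_cong) (simp_all add: x_def)
        finally show ?thesis using stw(3) l True by simp
      next
        case False
        then show ?thesis using mod_hom_closed[OF p(1) x] by (simp add: carrier_free_module)
      qed
      then have "res_diff P i x = \<zero>\<^bsub>free_module R (?r i)\<^esub>" by auto
      then have "x \<in> res_diff P (Suc i) ` carrier (free_module R (?r (Suc (Suc i))))" using p(3)[OF x] by simp
      then obtain u where "u \<in> carrier (free_module R (?r (Suc (Suc i))))" "x = res_diff P (Suc i) u" by blast
      moreover have "w l k = x k" if "k < ?q" for k using that by (simp add: x_def)
      ultimately show ?thesis by metis
    qed
    then have "\<forall>l. \<exists>u. l < s \<longrightarrow> u \<in> carrier (free_module R (?r (Suc (Suc i)))) \<and> (\<forall>k<?q. w l k = res_diff P (Suc i) u k)"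
      by blast
    from choice[OF this] obtain u where u: "\<And>l. l < s \<Longrightarrow> u l \<in> carrier (free_module R (?r (Suc (Suc i))))"
      "\<And>l k. l < s \<Longrightarrow> k < ?q \<Longrightarrow> w l k = res_diff P (Suc i) (u l) k" by blast
    define y where "y = lincomb (?F (?r (Suc (Suc i)))) s t (\<lambda>l k. f (u l k))"
    have y: "y \<in> carrier (?F (?r (Suc (Suc i))))"
      unfolding y_def using stw(1) u(1) by (intro module.lincomb_closed[OF T.module_free_module] f_vec_closed) auto
    have "?d (Suc i) y = v"
    proof
      fix k
      have "?d (Suc i) y k = lincomb (ring_module T) s t (\<lambda>l. f (res_diff P (Suc i) (u l) k))"
        unfolding y_def using stw(1) u(1) by (subst comb) (simp_all add: lincomb_free_module_nth)
      also have "\<dots> = v k" if "k < ?q"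
        using stw(4) that u(2) by (auto intro!: lincomb_cong)
      finally show "?d (Suc i) y k = v k"
        using v mod_hom_closed[OF d y] by (cases "k < ?q") (auto simp: carrier_free_module)
    qed
    then show ?thesis using y by blast
  qed
  have img0: "?d 0 ` carrier (?F (?r (Suc 0))) = {v \<in> carrier (?F 1). J +>\<^bsub>T\<^esub> v 0 = \<zero>\<^bsub>?C\<^esub>}"
  proof -
    have ker: "J +>\<^bsub>T\<^esub> v 0 = \<zero>\<^bsub>?C\<^esub> \<longleftrightarrow> v 0 \<in> J" if "v \<in> carrier (?F 1)" for v
      using T.coset_zero_iff[OF J' T.free_module_nth[OF that]] by (simp add: T.cyclic_module_simps(2))
    have d0: "?d 0 \<in> mod_hom T (?F (?r (Suc 0))) (?F 1)" using d[of 0] by (simp add: rank)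
    have h: "(\<lambda>v. ?d 0 v 0) \<in> mod_hom T (?F (?r (Suc 0))) (ring_module T)"
      using mod_hom_comp[OF d0] module.pow_nth_hom[OF T.module_ring_module, of 0 1]
      by (simp add: free_module_eq_pow)
    have RJ: "u 0 \<in> I \<longleftrightarrow> u \<in> res_diff P 0 ` carrier (free_module R (?r (Suc 0)))"
      if "u \<in> carrier (free_module R 1)" for u
      using p(4)[of u] that R.coset_zero_iff[OF I R.free_module_nth[OF that]] by (simp add: rank aug R.cyclic_module_simps(2))
    have in_J: "?d 0 v 0 \<in> J" if v: "v \<in> carrier (?F (?r (Suc 0)))" for v
    proof -
      have fD: "f (res_diff P 0 (unit_vec R j) 0) \<in> J" if j: "j < ?r (Suc 0)" for j
      proof -
        have "res_diff P 0 (unit_vec R j) 0 \<in> I"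
          using RJ[of "res_diff P 0 (unit_vec R j)"] mod_hom_closed[OF p(1) R.unit_vec_closed[OF j]] R.unit_vec_closed[OF j]
          by (auto simp: rank)
        moreover have "f ` I \<subseteq> carrier T" using Ic by (auto simp: subset_iff)
        ultimately show ?thesis unfolding J using T.genideal_self by blast
      qed
      have "lincomb (ring_module T) b v (\<lambda>j. f (res_diff P 0 (unit_vec R j) 0)) \<in> J" if "b \<le> ?r (Suc 0)" for b
        using that fD T.free_module_nth[OF v] additive_subgroup.a_closed[OF ideal.axioms(1)[OF J']]
          additive_subgroup.zero_closed[OF ideal.axioms(1)[OF J']] ideal.I_l_closed[OF J']
        by (induction b) auto
      then show ?thesis by (simp add: base_change_hom_def lincomb_free_module_nth)
    qed
    \<comment> \<open>The right-hand side is an ideal, and it contains the image of I, since the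
      elements of I are the values of the first differential of P.\<close>
    have J_in: "J \<subseteq> (\<lambda>v. ?d 0 v 0) ` carrier (?F (?r (Suc 0)))"
      unfolding J
    proof (rule T.genideal_minimal[OF T.mod_hom_image_ideal[OF T.module_free_module h]], rule subsetI)
      fix a assume "a \<in> f ` I"
      then obtain x where x: "x \<in> I" "a = f x" by blast
      define w where "w = (\<lambda>j :: nat. if j = 0 then x else \<zero>\<^bsub>R\<^esub>)"
      have w: "w \<in> carrier (free_module R 1)" using x(1) Ic by (auto simp: w_def carrier_free_module)
      have "w 0 \<in> I" using x(1) by (simp add: w_def)
      then obtain u where u: "u \<in> carrier (free_module R (?r (Suc 0)))" "w = res_diff P 0 u" using RJ[OF w] by blast
      have "?d 0 (\<lambda>k. f (u k)) 0 = f (w 0)" unfolding base_change_hom_vec[OF p(1) u(1)] u(2) ..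
      then have "a = ?d 0 (\<lambda>k. f (u k)) 0" using x(2) by (simp add: w_def)
      then show "a \<in> (\<lambda>v. ?d 0 v 0) ` carrier (?F (?r (Suc 0)))"
        using f_vec_closed[OF u(1)] by blast
    qed
    have eq1: "v = w" if "v \<in> carrier (?F 1)" "w \<in> carrier (?F 1)" "v 0 = w 0" for v w
    proof
      fix k show "v k = w k" using that by (cases k) (auto simp: carrier_free_module)
    qed
    show ?thesis
    proof (intro equalityI subsetI)
      fix y assume "y \<in> ?d 0 ` carrier (?F (?r (Suc 0)))"
      then obtain v where v: "v \<in> carrier (?F (?r (Suc 0)))" "y = ?d 0 v" by (rule imageE) simp
      then have "y \<in> carrier (?F 1)" using mod_hom_closed[OF d0] by simp
      then show "y \<in> {v \<in> carrier (?F 1). J +>\<^bsub>T\<^esub> v 0 = \<zero>\<^bsub>?C\<^esub>}"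
        using ker[of y] in_J[OF v(1)] v(2) by simp
    next
      fix y assume "y \<in> {v \<in> carrier (?F 1). J +>\<^bsub>T\<^esub> v 0 = \<zero>\<^bsub>?C\<^esub>}"
      then have y: "y \<in> carrier (?F 1)" "y 0 \<in> J" using ker[of y] by simp_all
      obtain v where v: "v \<in> carrier (?F (?r (Suc 0)))" "y 0 = ?d 0 v 0" using J_in y(2) by blast
      have "y = ?d 0 v" by (rule eq1[OF y(1) mod_hom_closed[OF d0 v(1)] v(2)])
      then show "y \<in> ?d 0 ` carrier (?F (?r (Suc 0)))" using v(1) by (rule image_eqI)
    qed
  qed
  show ?thesis
    unfolding is_free_resolution_def exact_at_def res_mod_def base_change_res_def free_res.simps
  proof (intro conjI allI)
    show "?d i \<in> mod_hom T (?F (?r (Suc i))) (?F (?r i))" for i by (rule d)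
    show "(\<lambda>v. J +>\<^bsub>T\<^esub> v 0) \<in> mod_hom T (?F (?r 0)) ?C" using T.cyclic_aug_hom[OF J'] by (simp add: rank)
    show "?d (Suc i) ` carrier (?F (?r (Suc (Suc i)))) = {y \<in> carrier (?F (?r (Suc i))). ?d i y = \<zero>\<^bsub>?F (?r i)\<^esub>}" for i
      using dd ex mod_hom_closed[OF d[of "Suc i"]] by (intro equalityI subsetI) blast+
    show "?d 0 ` carrier (?F (?r (Suc 0))) = {y \<in> carrier (?F (?r 0)). J +>\<^bsub>T\<^esub> y 0 = \<zero>\<^bsub>?C\<^esub>}"
      using img0 by (simp add: rank)
    show "(\<lambda>v. J +>\<^bsub>T\<^esub> v 0) ` carrier (?F (?r 0)) = carrier ?C" using T.cyclic_aug_surj by (simp add: rank)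
  qed
qed

end

section \<open>Base change of Ext and local cohomology\<close>

lemma prev_diff_vec_closed:
  assumes "cring R" "is_free_resolution R A P" "k < res_rank P i" "l < prev_rank P i"
  shows "diff_vec R P (i - 1) k l \<in> carrier R"
proof (cases i)
  case (Suc j)
  then show ?thesis
    using cring.free_module_nth[OF assms(1) diff_vec_closed[OF assms(1,2), of k j]] assms(3) by simp
qed (use assms(4) in \<open>simp add: prev_rank_def\<close>)

context ring_change
begin

lemma base_change_res_rank [simp]: "res_rank (base_change_res J P) = res_rank P"
  by (simp add: base_change_res_def)

lemma base_change_prev_rank [simp]: "prev_rank (base_change_res J P) = prev_rank P"
  by (simp add: prev_rank_def fun_eq_iff split: nat.split)

lemma base_change_diff_vec:
  assumes "is_free_resolution R A P" "j < res_rank P (Suc i)"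
  shows "diff_vec T (base_change_res J P) i j = (\<lambda>k. f (diff_vec R P i j k))"
  using base_change_hom_unit_vec[OF free_resolutionD(1)[OF assms(1), unfolded res_mod_def] assms(2)]
  by (simp add: diff_vec_def base_change_res_def)

lemma base_change_prev_diff_vec:
  assumes "is_free_resolution R A P" "k < res_rank P i" "l < prev_rank P i"
  shows "diff_vec T (base_change_res J P) (i - 1) k l = f (diff_vec R P (i - 1) k l)"
proof (cases i)
  case (Suc j)
  then show ?thesis using base_change_diff_vec[OF assms(1), of k j J] assms(2) by simp
qed (use assms(3) in \<open>simp add: prev_rank_def\<close>)

lemma tens_zero_right:
  assumes M: "module R M"
  shows "tens M \<one>\<^bsub>T\<^esub> \<zero>\<^bsub>M\<^esub> = \<zero>\<^bsub>bc M\<^esub>"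
proof -
  interpret M: module R M by fact
  have "tens M \<one>\<^bsub>T\<^esub> (\<zero>\<^bsub>R\<^esub> \<odot>\<^bsub>M\<^esub> \<zero>\<^bsub>M\<^esub>) = tens M (\<one>\<^bsub>T\<^esub> \<otimes>\<^bsub>T\<^esub> f \<zero>\<^bsub>R\<^esub>) \<zero>\<^bsub>M\<^esub>"
    by (rule tens_balanced[OF M]) simp_all
  then show ?thesis using tens_zero_left[OF M] by simp
qed

lemma tens_lincomb:
  assumes M: "module R M" and "\<And>k. k < b \<Longrightarrow> v k \<in> carrier R" "\<And>k. k < b \<Longrightarrow> x k \<in> carrier M"
  shows "tens M \<one>\<^bsub>T\<^esub> (lincomb M b v x) = lincomb (bc M) b (\<lambda>k. f (v k)) (\<lambda>k. tens M \<one>\<^bsub>T\<^esub> (x k))"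
proof (rule module.lincomb_image[OF M])
  show "tens M \<one>\<^bsub>T\<^esub> \<zero>\<^bsub>M\<^esub> = \<zero>\<^bsub>bc M\<^esub>" by (rule tens_zero_right[OF M])
  show "tens M \<one>\<^bsub>T\<^esub> (v k \<odot>\<^bsub>M\<^esub> x k) = f (v k) \<odot>\<^bsub>bc M\<^esub> tens M \<one>\<^bsub>T\<^esub> (x k)" if "k < b" for k
    using assms(2,3)[OF that] by (simp add: tens_balanced[OF M] smult_tens[OF M])
qed (use assms in \<open>simp_all add: tens_add_right\<close>)

text \<open>A linear form with coefficients from R may be evaluated on the \<open>w l\<close> before
  tensoring: the double sum is interchanged, and the form is moved across 1 \<otimes> w.\<close>

lemma lincomb_tens_swap:
  assumes M: "module R M" and v: "\<And>k. k < b \<Longrightarrow> v k \<in> carrier R"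
    and t: "\<And>l. l < s \<Longrightarrow> t l \<in> carrier T" and w: "\<And>l k. l < s \<Longrightarrow> k < b \<Longrightarrow> w l k \<in> carrier M"
    and x: "\<And>k. k < b \<Longrightarrow> x k = lincomb (bc M) s t (\<lambda>l. tens M \<one>\<^bsub>T\<^esub> (w l k))"
  shows "lincomb (bc M) b (\<lambda>k. f (v k)) x = lincomb (bc M) s t (\<lambda>l. tens M \<one>\<^bsub>T\<^esub> (lincomb M b v (w l)))"
proof -
  interpret B: module T "bc M" by (rule module_bc[OF M])
  have "lincomb (bc M) b (\<lambda>k. f (v k)) x =
      lincomb (bc M) b (\<lambda>k. f (v k)) (\<lambda>k. lincomb (bc M) s t (\<lambda>l. tens M \<one>\<^bsub>T\<^esub> (w l k)))"
    by (rule lincomb_cong) (simp_all add: x)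
  also have "\<dots> = lincomb (bc M) s t (\<lambda>l. lincomb (bc M) b (\<lambda>k. f (v k)) (\<lambda>k. tens M \<one>\<^bsub>T\<^esub> (w l k)))"
    using v t w by (intro B.lincomb_swap) auto
  also have "\<dots> = lincomb (bc M) s t (\<lambda>l. tens M \<one>\<^bsub>T\<^esub> (lincomb M b v (w l)))"
    using v w by (intro lincomb_cong) (simp_all add: tens_lincomb[OF M])
  finally show ?thesis .
qed

lemma vec_cocycle_tens:
  assumes M: "module R M" and P: "is_free_resolution R A P" and w: "vec_cocycle R P i M w"
  shows "vec_cocycle T (base_change_res J P) i (bc M) (\<lambda>k. tens M \<one>\<^bsub>T\<^esub> (w k))"
proof -
  interpret M: module R M by fact
  have wc: "w k \<in> carrier M" if "k < res_rank P i" for k using w that by (simp add: vec_cocycle_def)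
  have "lincomb (bc M) (res_rank P i) (\<lambda>k. f (diff_vec R P i j k)) (\<lambda>k. tens M \<one>\<^bsub>T\<^esub> (w k)) = \<zero>\<^bsub>bc M\<^esub>"
    if j: "j < res_rank P (Suc i)" for j
  proof -
    have D: "diff_vec R P i j k \<in> carrier R" for k
      by (rule R.free_module_nth[OF diff_vec_closed[OF R.is_cring P j]])
    have "lincomb M (res_rank P i) (diff_vec R P i j) w = \<zero>\<^bsub>M\<^esub>" using w j by (simp add: vec_cocycle_def)
    moreover have "tens M \<one>\<^bsub>T\<^esub> (lincomb M (res_rank P i) (diff_vec R P i j) w) =
        lincomb (bc M) (res_rank P i) (\<lambda>k. f (diff_vec R P i j k)) (\<lambda>k. tens M \<one>\<^bsub>T\<^esub> (w k))"
      by (rule tens_lincomb[OF M D wc])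
    ultimately show ?thesis by (simp add: tens_zero_right[OF M])
  qed
  then show ?thesis using wc by (simp add: vec_cocycle_def base_change_diff_vec[OF P])
qed

text \<open>Primitives of the \<open>w l\<close>, tensored with 1 and combined with the same
  coefficients \<open>t l\<close>, give a primitive of x.\<close>

lemma vec_coboundary_lincomb:
  assumes M: "module R M" and P: "is_free_resolution R A P"
    and t: "\<And>l. l < s \<Longrightarrow> t l \<in> carrier T"
    and w: "\<And>l. l < s \<Longrightarrow> vec_coboundary R P i M (w l)"
    and x: "\<And>k. k < res_rank P i \<Longrightarrow> x k = lincomb (bc M) s t (\<lambda>l. tens M \<one>\<^bsub>T\<^esub> (w l k))"
  shows "vec_coboundary T (base_change_res J P) i (bc M) x"
proof -
  interpret M: module R M by fact
  interpret B: module T "bc M" by (rule module_bc[OF M])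
  let ?p = "prev_rank P i" and ?D = "\<lambda>k. diff_vec R P (i - 1) k"
  have "\<forall>l. \<exists>y. l < s \<longrightarrow> (\<forall>m<?p. y m \<in> carrier M) \<and> (\<forall>k<res_rank P i. w l k = lincomb M ?p (?D k) y)"
    using w unfolding vec_coboundary_def by blast
  from choice[OF this] obtain y where y: "\<And>l m. l < s \<Longrightarrow> m < ?p \<Longrightarrow> y l m \<in> carrier M"
    "\<And>l k. l < s \<Longrightarrow> k < res_rank P i \<Longrightarrow> w l k = lincomb M ?p (?D k) (y l)" by blast
  define z where "z m = lincomb (bc M) s t (\<lambda>l. tens M \<one>\<^bsub>T\<^esub> (y l m))" for m
  have z: "z m \<in> carrier (bc M)" if "m < ?p" for m
    unfolding z_def using t y(1) that by (intro B.lincomb_closed) auto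
  have "x k = lincomb (bc M) ?p (diff_vec T (base_change_res J P) (i - 1) k) z" if k: "k < res_rank P i" for k
  proof -
    have "x k = lincomb (bc M) s t (\<lambda>l. tens M \<one>\<^bsub>T\<^esub> (lincomb M ?p (?D k) (y l)))"
      unfolding x[OF k] using y(2) k by (intro lincomb_cong) simp_all
    also have "\<dots> = lincomb (bc M) ?p (\<lambda>m. f (?D k m)) z"
      by (rule lincomb_tens_swap[OF M prev_diff_vec_closed[OF R.is_cring P k] t y(1) z_def, symmetric])
    also have "\<dots> = lincomb (bc M) ?p (diff_vec T (base_change_res J P) (i - 1) k) z"
      using k by (intro lincomb_cong) (simp_all only: base_change_prev_diff_vec[OF P k])
    finally show ?thesis .
  qed
  then show ?thesis unfolding vec_coboundary_def using z by (intro exI[of _ z]) simp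
qed

end

context flat_change
begin

text \<open>The equation for a primitive is an inhomogeneous system with coefficients from R, whose
  right-hand side comes from M; \<open>faithful_solve\<close> brings a solution down to M.\<close>

lemma vec_coboundary_tens_imp:
  fixes \<kappa> :: "(nat \<Rightarrow> 'm) \<Rightarrow> (nat \<Rightarrow> 'r) set"
  assumes M: "module R M" and \<kappa>: "inj_on \<kappa> {x. \<forall>k. x k \<in> carrier M}"
    and P: "is_free_resolution R A P" and w: "\<And>k. k < res_rank P i \<Longrightarrow> w k \<in> carrier M"
    and cob: "vec_coboundary T (base_change_res J P) i (bc M) (\<lambda>k. tens M \<one>\<^bsub>T\<^esub> (w k))"
  shows "vec_coboundary R P i M w"
proof -
  let ?p = "prev_rank P i"
  obtain y where y: "\<And>l. l < ?p \<Longrightarrow> y l \<in> carrier (bc M)"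
    "\<And>k. k < res_rank P i \<Longrightarrow> tens M \<one>\<^bsub>T\<^esub> (w k) = lincomb (bc M) ?p (diff_vec T (base_change_res J P) (i - 1) k) y"
    using cob unfolding vec_coboundary_def by auto
  have "tens M \<one>\<^bsub>T\<^esub> (w k) = lincomb (bc M) ?p (\<lambda>l. f (diff_vec R P (i - 1) k l)) y" if k: "k < res_rank P i" for k
    unfolding y(2)[OF k] by (rule lincomb_cong) (simp_all only: base_change_prev_diff_vec[OF P k])
  from faithful_solve[where p = ?p and q = "res_rank P i" and A = "diff_vec R P (i - 1)" and z = w and y = y,
      OF M \<kappa> prev_diff_vec_closed[OF R.is_cring P] w y(1) this]
  show ?thesis unfolding vec_coboundary_def by blast
qed

text \<open>The cocycle condition over T is a homogeneous system whose coefficients come from R, so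
  \<open>flat_kernel\<close> applies.\<close>

lemma vec_cocycle_span:
  fixes \<kappa> :: "(nat \<Rightarrow> 'm) \<Rightarrow> (nat \<Rightarrow> 'r) set"
  assumes M: "module R M" and \<kappa>: "inj_on \<kappa> {x. \<forall>k. x k \<in> carrier M}"
    and P: "is_free_resolution R A P" and x: "vec_cocycle T (base_change_res J P) i (bc M) x"
  obtains s t w where "\<And>l. l < s \<Longrightarrow> t l \<in> carrier T" "\<And>l. l < s \<Longrightarrow> vec_cocycle R P i M (w l)"
    "\<And>k. k < res_rank P i \<Longrightarrow> x k = lincomb (bc M) s t (\<lambda>l. tens M \<one>\<^bsub>T\<^esub> (w l k))"
proof -
  have D: "diff_vec R P i j k \<in> carrier R" if "j < res_rank P (Suc i)" for j k
    by (rule R.free_module_nth[OF diff_vec_closed[OF R.is_cring P that]])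
  have xc: "x k \<in> carrier (bc M)" if "k < res_rank P i" for k using x that by (simp add: vec_cocycle_def)
  have "lincomb (bc M) (res_rank P i) (\<lambda>k. f (diff_vec R P i j k)) x = \<zero>\<^bsub>bc M\<^esub>" if "j < res_rank P (Suc i)" for j
  proof -
    have "lincomb (bc M) (res_rank P i) (diff_vec T (base_change_res J P) i j) x = \<zero>\<^bsub>bc M\<^esub>"
      using x that by (simp add: vec_cocycle_def)
    then show ?thesis unfolding base_change_diff_vec[OF P that] .
  qed
  from flat_kernel[where q = "res_rank P i" and r = "res_rank P (Suc i)" and B = "diff_vec R P i" and x = x,
      OF M \<kappa> D xc this]
  obtain s t w where "\<forall>l<s. t l \<in> carrier T" "\<forall>l<s. \<forall>k<res_rank P i. w l k \<in> carrier M"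
    "\<forall>l<s. \<forall>j<res_rank P (Suc i). lincomb M (res_rank P i) (diff_vec R P i j) (w l) = \<zero>\<^bsub>M\<^esub>"
    "\<forall>k<res_rank P i. x k = lincomb (bc M) s t (\<lambda>l. tens M \<one>\<^bsub>T\<^esub> (w l k))" by blast
  then show thesis by (intro that[of s t w]) (simp_all add: vec_cocycle_def)
qed

text \<open>A resolution over R and its base change compute the two sides. Upwards, a cocycle over T
  \<otimes> M is a combination of cocycles over M, each of which is a coboundary; downwards, a
  cocycle w becomes the cocycle 1 \<otimes> w, and solvability for its primitive descends.\<close>

theorem zero_Ext_base_change_iff:
  fixes M :: "('r, 'm, 'y) module_scheme"
  assumes noeth: "noetherian_ring R" "noetherian_ring T" and I: "ideal I R"
    and M: "module R M" and fg: "fin_gen_module R M"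
  shows "zero_module (Ext_module R (cyclic_module R I) i M) \<longleftrightarrow>
    zero_module (Ext_module T (cyclic_module T (genideal T (f ` I))) i (bc M))"
proof -
  obtain \<kappa> :: "(nat \<Rightarrow> 'm) \<Rightarrow> (nat \<Rightarrow> 'r) set" where \<kappa>: "inj_on \<kappa> {x. \<forall>k. x k \<in> carrier M}"
    by (rule fin_gen_embedding[OF M fg])
  obtain P where P: "is_free_resolution R (cyclic_module R I) P" "res_rank P 0 = 1" "res_aug P = (\<lambda>v. I +>\<^bsub>R\<^esub> v 0)"
    using R.cyclic_resolution_exists[OF noeth(1) I] by blast
  let ?J = "genideal T (f ` I)"
  have J: "ideal ?J T" using base_change_genideal ideal.Icarr[OF I] by blast
  note PT = base_change_resolution[OF I P refl]
  have "(\<forall>x. vec_cocycle R P i M x \<longrightarrow> vec_coboundary R P i M x) \<longleftrightarrow>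
      (\<forall>x. vec_cocycle T (base_change_res ?J P) i (bc M) x \<longrightarrow> vec_coboundary T (base_change_res ?J P) i (bc M) x)"
  proof (intro iffI allI impI)
    fix x assume *: "\<forall>x. vec_cocycle R P i M x \<longrightarrow> vec_coboundary R P i M x"
      and x: "vec_cocycle T (base_change_res ?J P) i (bc M) x"
    obtain s t w where stw: "\<And>l. l < s \<Longrightarrow> t l \<in> carrier T" "\<And>l. l < s \<Longrightarrow> vec_cocycle R P i M (w l)"
      "\<And>k. k < res_rank P i \<Longrightarrow> x k = lincomb (bc M) s t (\<lambda>l. tens M \<one>\<^bsub>T\<^esub> (w l k))"
      by (rule vec_cocycle_span[OF M \<kappa> P(1) x]) blast
    show "vec_coboundary T (base_change_res ?J P) i (bc M) x"
      by (rule vec_coboundary_lincomb[OF M P(1) stw(1) _ stw(3)]) (use * stw(2) in blast)+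
  next
    fix w assume *: "\<forall>x. vec_cocycle T (base_change_res ?J P) i (bc M) x \<longrightarrow> vec_coboundary T (base_change_res ?J P) i (bc M) x"
      and w: "vec_cocycle R P i M w"
    have wc: "w k \<in> carrier M" if "k < res_rank P i" for k using w that by (simp add: vec_cocycle_def)
    have cob: "vec_coboundary T (base_change_res ?J P) i (bc M) (\<lambda>k. tens M \<one>\<^bsub>T\<^esub> (w k))"
      using * vec_cocycle_tens[OF M P(1) w] by blast
    show "vec_coboundary R P i M w" by (rule vec_coboundary_tens_imp[OF M \<kappa> P(1) wc cob])
  qed
  then show ?thesis
    unfolding module.zero_Ext_cyclic_iff[OF M noeth(1) I P(1)]
      module.zero_Ext_cyclic_iff[OF module_bc[OF M] noeth(2) J PT]
      module.ext_vanishing_iff_vec[OF M P(1)] module.ext_vanishing_iff_vec[OF module_bc[OF M] PT] .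
qed

text \<open>The argument for Ext, with one addition in the upward direction: the finitely many
  cocycles over M may die at different stages, and by persistence they are all dead at a common
  later stage.\<close>

lemma lc_vanishes_base_change_iff:
  fixes \<kappa> :: "(nat \<Rightarrow> 'm) \<Rightarrow> (nat \<Rightarrow> 'r) set"
  assumes M: "module R M" and \<kappa>: "inj_on \<kappa> {x. \<forall>k. x k \<in> carrier M}"
    and A: "\<And>n. module R (A n)" and P: "\<And>n. is_free_resolution R (A n) (P n)"
    and u: "\<And>n m k x. n \<le> m \<Longrightarrow> m \<le> k \<Longrightarrow> x \<in> carrier (A k) \<Longrightarrow> u n k x = u n m (u m k x)"
    and \<phi>: "\<And>n k. n \<le> k \<Longrightarrow> is_lift R (P k) (P n) (u n k) (\<phi> n k)"
    and PT: "\<And>n. is_free_resolution T (A' n) (base_change_res (J n) (P n))"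
    and \<phi>T: "\<And>n k. n \<le> k \<Longrightarrow> is_lift T (base_change_res (J k) (P k)) (base_change_res (J n) (P n)) (u' n k)
      (\<lambda>i. base_change_hom (res_rank (P k) i) (res_rank (P n) i) (\<phi> n k i))"
  shows "lc_vanishes R P i M \<phi> \<longleftrightarrow> lc_vanishes T (\<lambda>n. base_change_res (J n) (P n)) i (bc M)
    (\<lambda>n k i. base_change_hom (res_rank (P k) i) (res_rank (P n) i) (\<phi> n k i))"
proof -
  interpret M: module R M by fact
  let ?r = "\<lambda>n. res_rank (P n) i"
  let ?e = "\<lambda>n k j. \<phi> n k i (unit_vec R j)"
  let ?PT = "\<lambda>n. base_change_res (J n) (P n)"
  let ?tr = "\<lambda>n k w j. lincomb M (?r n) (?e n k j) w"
  let ?trT = "\<lambda>n k x j. lincomb (bc M) (?r n) (base_change_hom (?r k) (?r n) (\<phi> n k i) (unit_vec T j)) x"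
  have e: "?e n k j l \<in> carrier R" if "n \<le> k" "j < ?r k" for n k j l
    by (rule R.free_module_nth[OF mod_hom_closed[OF is_liftD(1)[OF \<phi>[OF that(1)], unfolded res_mod_def] R.unit_vec_closed[OF that(2)]]])
  have trT: "?trT n k x j = lincomb (bc M) (?r n) (\<lambda>l. f (?e n k j l)) x" if "n \<le> k" "j < ?r k" for n k x j
    using base_change_hom_unit_vec[OF is_liftD(1)[OF \<phi>[OF that(1)], unfolded res_mod_def] that(2)] by simp
  have persist: "vec_coboundary R (P j) i M (?tr n j w)"
    if "n \<le> k" "k \<le> j" and w: "vec_cocycle R (P n) i M w" and cob: "vec_coboundary R (P k) i M (?tr n k w)" for n k j w
  proof -
    have nj: "n \<le> j" using that by simp
    have wc: "w k \<in> carrier M" if "k < ?r n" for k using w that by (simp add: vec_cocycle_def)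
    note iff = M.ext_coboundary_hom_iff_vec[OF P P is_liftD(1)[OF \<phi>] wc]
    have "ext_coboundary R (P k) i M (\<lambda>v. lincomb M (?r n) (\<phi> n k i v) w)"
      using cob iff[OF that(1)] by simp
    from M.ext_coboundary_persists[OF A P P P \<phi>[OF that(1)] \<phi>[OF that(2)] \<phi>[OF nj] u[OF that(1,2)]
        M.vec_cocycle_hom[OF P w] this]
    show ?thesis using iff[OF nj] by simp
  qed
  have "(\<forall>n x. vec_cocycle R (P n) i M x \<longrightarrow> (\<exists>k\<ge>n. vec_coboundary R (P k) i M (?tr n k x))) \<longleftrightarrow>
    (\<forall>n x. vec_cocycle T (?PT n) i (bc M) x \<longrightarrow> (\<exists>k\<ge>n. vec_coboundary T (?PT k) i (bc M) (?trT n k x)))"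
  proof (intro iffI allI impI)
    fix n x assume *: "\<forall>n x. vec_cocycle R (P n) i M x \<longrightarrow> (\<exists>k\<ge>n. vec_coboundary R (P k) i M (?tr n k x))"
      and x: "vec_cocycle T (?PT n) i (bc M) x"
    obtain s t w where stw: "\<And>l. l < s \<Longrightarrow> t l \<in> carrier T" "\<And>l. l < s \<Longrightarrow> vec_cocycle R (P n) i M (w l)"
      "\<And>k. k < ?r n \<Longrightarrow> x k = lincomb (bc M) s t (\<lambda>l. tens M \<one>\<^bsub>T\<^esub> (w l k))"
      by (rule vec_cocycle_span[OF M \<kappa> P x]) blast
    have wc: "w l k \<in> carrier M" if "l < s" "k < ?r n" for l k
      using stw(2)[OF that(1)] that(2) by (simp add: vec_cocycle_def)
    have "\<forall>l. \<exists>k. l < s \<longrightarrow> n \<le> k \<and> vec_coboundary R (P k) i M (?tr n k (w l))" using * stw(2) by blast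
    from choice[OF this] obtain K where K: "\<And>l. l < s \<Longrightarrow> n \<le> K l"
      "\<And>l. l < s \<Longrightarrow> vec_coboundary R (P (K l)) i M (?tr n (K l) (w l))" by blast
    \<comment> \<open>A common upper bound of n and of the finitely many stages \<open>K l\<close>,
      valid also for s = 0.\<close>
    define k where "k = n + (\<Sum>l<s. K l)"
    have nk: "n \<le> k" by (simp add: k_def)
    have Kk: "K l \<le> k" if "l < s" for l
      using member_le_sum[of l "{..<s}" K] that by (simp add: k_def)
    have "vec_coboundary T (?PT k) i (bc M) (?trT n k x)"
    proof (rule vec_coboundary_lincomb[OF M P stw(1)])
      show "vec_coboundary R (P k) i M (?tr n k (w l))" if "l < s" for l
        by (rule persist[OF K(1)[OF that] Kk[OF that] stw(2)[OF that] K(2)[OF that]])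
      show "?trT n k x j = lincomb (bc M) s t (\<lambda>l. tens M \<one>\<^bsub>T\<^esub> (?tr n k (w l) j))" if j: "j < ?r k" for j
        unfolding trT[OF nk j] by (rule lincomb_tens_swap[OF M e[OF nk j] stw(1) wc stw(3)])
    qed
    then show "\<exists>k\<ge>n. vec_coboundary T (?PT k) i (bc M) (?trT n k x)" using nk by blast
  next
    fix n w assume *: "\<forall>n x. vec_cocycle T (?PT n) i (bc M) x \<longrightarrow> (\<exists>k\<ge>n. vec_coboundary T (?PT k) i (bc M) (?trT n k x))"
      and w: "vec_cocycle R (P n) i M w"
    have wc: "w k \<in> carrier M" if "k < ?r n" for k using w that by (simp add: vec_cocycle_def)
    obtain k where k: "n \<le> k" "vec_coboundary T (?PT k) i (bc M) (?trT n k (\<lambda>k. tens M \<one>\<^bsub>T\<^esub> (w k)))"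
      using * vec_cocycle_tens[OF M P w] by blast
    have eq: "?trT n k (\<lambda>k. tens M \<one>\<^bsub>T\<^esub> (w k)) j = tens M \<one>\<^bsub>T\<^esub> (?tr n k w j)" if j: "j < ?r k" for j
      unfolding trT[OF k(1) j] by (rule tens_lincomb[OF M e[OF k(1) j] wc, symmetric])
    have "vec_coboundary T (?PT k) i (bc M) (\<lambda>j. tens M \<one>\<^bsub>T\<^esub> (?tr n k w j))"
      using k(2) vec_coboundary_cong[of "?PT k" i "?trT n k (\<lambda>k. tens M \<one>\<^bsub>T\<^esub> (w k))" "\<lambda>j. tens M \<one>\<^bsub>T\<^esub> (?tr n k w j)" T "bc M"] eq
      by simp
    then have "vec_coboundary R (P k) i M (?tr n k w)"
      using e[OF k(1)] wc by (intro vec_coboundary_tens_imp[OF M \<kappa> P]) (auto intro!: M.lincomb_closed)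
    then show "\<exists>k\<ge>n. vec_coboundary R (P k) i M (?tr n k w)" using k(1) by blast
  qed
  moreover have "lc_vanishes R P i M \<phi> \<longleftrightarrow>
      (\<forall>n x. vec_cocycle R (P n) i M x \<longrightarrow> (\<exists>k\<ge>n. vec_coboundary R (P k) i M (?tr n k x)))"
    by (rule M.lc_vanishes_iff_vec[where u = u, OF P]) (erule \<phi>)
  moreover have "lc_vanishes T ?PT i (bc M) (\<lambda>n k i. base_change_hom (res_rank (P k) i) (res_rank (P n) i) (\<phi> n k i)) \<longleftrightarrow>
      (\<forall>n x. vec_cocycle T (?PT n) i (bc M) x \<longrightarrow> (\<exists>k\<ge>n. vec_coboundary T (?PT k) i (bc M) (?trT n k x)))"
    by (subst module.lc_vanishes_iff_vec[where u = u', OF module_bc[OF M] PT]) (erule \<phi>T, simp)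
  ultimately show ?thesis by simp
qed

end

section \<open>Extended ideals\<close>

context ring_change
begin

lemma image_subset_genideal: "S \<subseteq> carrier R \<Longrightarrow> f ` S \<subseteq> genideal T (f ` S)"
  by (rule T.genideal_self) (auto simp: subset_iff)

text \<open>Reduces membership of products to generators: if the product of a with each generator of
  an ideal lies in K, so does its product with every element of that ideal.\<close>

lemma colon_ideal:
  assumes K: "ideal K T" and a: "a \<in> carrier T"
  shows "ideal {x \<in> carrier T. a \<otimes>\<^bsub>T\<^esub> x \<in> K} T"
proof (rule idealI[OF T.ring_axioms])
  note add = additive_subgroup.a_closed[OF ideal.axioms(1)[OF K]]
  show "subgroup {x \<in> carrier T. a \<otimes>\<^bsub>T\<^esub> x \<in> K} (add_monoid T)"
  proof (rule T.add.subgroupI)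
    have "a \<otimes>\<^bsub>T\<^esub> \<zero>\<^bsub>T\<^esub> \<in> K" using a additive_subgroup.zero_closed[OF ideal.axioms(1)[OF K]] by simp
    then show "{x \<in> carrier T. a \<otimes>\<^bsub>T\<^esub> x \<in> K} \<noteq> {}" by blast
    show "\<ominus>\<^bsub>T\<^esub> x \<in> {x \<in> carrier T. a \<otimes>\<^bsub>T\<^esub> x \<in> K}" if "x \<in> {x \<in> carrier T. a \<otimes>\<^bsub>T\<^esub> x \<in> K}" for x
      using that a additive_subgroup.a_inv_closed[OF ideal.axioms(1)[OF K], of "a \<otimes>\<^bsub>T\<^esub> x"]
      by (simp add: T.r_minus)
    show "x \<oplus>\<^bsub>T\<^esub> y \<in> {x \<in> carrier T. a \<otimes>\<^bsub>T\<^esub> x \<in> K}"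
      if "x \<in> {x \<in> carrier T. a \<otimes>\<^bsub>T\<^esub> x \<in> K}" "y \<in> {x \<in> carrier T. a \<otimes>\<^bsub>T\<^esub> x \<in> K}" for x y
      using that a add by (simp add: T.r_distr)
  qed auto
  fix x r assume x: "x \<in> {x \<in> carrier T. a \<otimes>\<^bsub>T\<^esub> x \<in> K}" and r: "r \<in> carrier T"
  then have "(a \<otimes>\<^bsub>T\<^esub> x) \<otimes>\<^bsub>T\<^esub> r \<in> K" using ideal.I_r_closed[OF K] by blast
  then show "x \<otimes>\<^bsub>T\<^esub> r \<in> {x \<in> carrier T. a \<otimes>\<^bsub>T\<^esub> x \<in> K}" using x r a by (simp add: T.m_assoc)
  then show "r \<otimes>\<^bsub>T\<^esub> x \<in> {x \<in> carrier T. a \<otimes>\<^bsub>T\<^esub> x \<in> K}" using x r by (simp add: T.m_comm)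
qed

text \<open>For the product of the extensions, generators are replaced by arbitrary elements one
  factor at a time: with \<open>f x\<close> fixed, the second factor is extended to the ideal
  generated over T; then such a second factor is fixed and the first one is extended.\<close>

lemma genideal_ideal_prod:
  assumes I: "ideal I R" and J: "ideal J R"
  shows "genideal T (f ` ideal_prod R I J) = ideal_prod T (genideal T (f ` I)) (genideal T (f ` J))"
proof
  have Ic: "I \<subseteq> carrier R" and Jc: "J \<subseteq> carrier R" using ideal.Icarr[OF I] ideal.Icarr[OF J] by auto
  have IJ: "ideal (ideal_prod R I J) R" by (rule R.ideal_prod_is_ideal[OF I J])
  have IJc: "ideal_prod R I J \<subseteq> carrier R" by (rule subsetI) (rule ideal.Icarr[OF IJ])
  let ?I = "genideal T (f ` I)" and ?J = "genideal T (f ` J)" and ?K = "genideal T (f ` ideal_prod R I J)"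
  have I': "ideal ?I T" and J': "ideal ?J T" and K: "ideal ?K T"
    using base_change_genideal Ic Jc IJc by auto
  show "?K \<subseteq> ideal_prod T ?I ?J"
  proof (rule T.genideal_minimal[OF T.ideal_prod_is_ideal[OF I' J']], rule subsetI)
    fix a assume "a \<in> f ` ideal_prod R I J"
    then obtain x where x: "x \<in> ideal_prod R I J" "a = f x" by blast
    have "f x \<in> ideal_prod T ?I ?J \<and> x \<in> carrier R"
      using x(1)
    proof (induction rule: ideal_prod.induct)
      case (prod i j)
      then have "f i \<in> ?I" "f j \<in> ?J" using image_subset_genideal Ic Jc by blast+
      then show ?case using prod Ic Jc ideal_prod.prod[of "f i" ?I "f j" ?J T] by (auto simp: f_mult subset_iff)
    next
      case (sum x y)
      then show ?case using ideal_prod.sum[of "f x" T ?I ?J "f y"] by (simp add: f_add)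
    qed
    then show "a \<in> ideal_prod T ?I ?J" using x(2) by simp
  qed
  have 1: "f x \<otimes>\<^bsub>T\<^esub> j \<in> ?K" if x: "x \<in> I" and j: "j \<in> ?J" for x j
  proof -
    have xc: "f x \<in> carrier T" using x Ic by auto
    have "f ` J \<subseteq> {y \<in> carrier T. f x \<otimes>\<^bsub>T\<^esub> y \<in> ?K}"
    proof
      fix b assume "b \<in> f ` J"
      then obtain y where y: "y \<in> J" "b = f y" by blast
      have "f (x \<otimes>\<^bsub>R\<^esub> y) \<in> ?K" using image_subset_genideal[OF IJc] ideal_prod.prod[OF x y(1), of R] by blast
      then show "b \<in> {y \<in> carrier T. f x \<otimes>\<^bsub>T\<^esub> y \<in> ?K}" using x y Ic Jc by (auto simp: f_mult subset_iff)
    qed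
    from T.genideal_minimal[OF colon_ideal[OF K xc] this] show ?thesis using j by blast
  qed
  have 2: "i \<otimes>\<^bsub>T\<^esub> j \<in> ?K" if i: "i \<in> ?I" and j: "j \<in> ?J" for i j
  proof -
    have jc: "j \<in> carrier T" using ideal.Icarr[OF J' j] .
    have "f ` I \<subseteq> {y \<in> carrier T. j \<otimes>\<^bsub>T\<^esub> y \<in> ?K}"
    proof
      fix b assume "b \<in> f ` I"
      then obtain x where x: "x \<in> I" "b = f x" by blast
      have xc: "f x \<in> carrier T" using x(1) Ic by auto
      show "b \<in> {y \<in> carrier T. j \<otimes>\<^bsub>T\<^esub> y \<in> ?K}"
        using 1[OF x(1) j] xc jc x(2) T.m_comm[OF xc jc] by simp
    qed
    from T.genideal_minimal[OF colon_ideal[OF K jc] this] have "j \<otimes>\<^bsub>T\<^esub> i \<in> ?K" using i by blast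
    then show ?thesis using T.m_comm[OF jc ideal.Icarr[OF I' i]] by simp
  qed
  show "ideal_prod T ?I ?J \<subseteq> ?K"
  proof
    fix x assume "x \<in> ideal_prod T ?I ?J"
    then show "x \<in> ?K"
      by (induction rule: ideal_prod.induct)
        (simp_all add: 2 additive_subgroup.a_closed[OF ideal.axioms(1)[OF K]])
  qed
qed

lemma ideal_power_base_change:
  assumes I: "ideal I R"
  shows "ideal_power T (genideal T (f ` I)) n = genideal T (f ` ideal_power R I n)"
proof (induction n)
  case 0
  have id: "ideal (genideal T (f ` carrier R)) T" by (rule base_change_genideal) simp
  have "f \<one>\<^bsub>R\<^esub> \<in> genideal T (f ` carrier R)" using image_subset_genideal[of "carrier R"] by blast
  then have "genideal T (f ` carrier R) = carrier T" using ideal.one_imp_carrier[OF id] by simp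
  then show ?case by (simp add: T.ideal_power_0 R.ideal_power_0)
next
  case (Suc n)
  then show ?case
    by (simp add: T.ideal_power_Suc R.ideal_power_Suc genideal_ideal_prod[OF R.ideal_power_ideal[OF I] I])
qed

end

section \<open>The submodule IM and its base change\<close>

context module
begin

text \<open>The additive span is closed under scalars because s (r x) = (s r) x with s r again in
  I.\<close>

lemma ideal_smult_submodule:
  assumes "ideal I R"
  shows "submodule (ideal_smult I M) R M"
proof -
  let ?G = "{r \<odot>\<^bsub>M\<^esub> x | r x. r \<in> I \<and> x \<in> carrier M}"
  have G: "?G \<subseteq> carrier (add_monoid M)" using ideal.Icarr[OF assms] by auto
  have sub: "subgroup (ideal_smult I M) (add_monoid M)"
    unfolding ideal_smult_def by (rule M.add.generate_is_subgroup[simplified]) (use G in auto)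
  have "s \<odot>\<^bsub>M\<^esub> y \<in> ideal_smult I M" if s: "s \<in> carrier R" and y: "y \<in> ideal_smult I M" for s y
  proof -
    have "y \<in> carrier M \<and> s \<odot>\<^bsub>M\<^esub> y \<in> ideal_smult I M"
      using y unfolding ideal_smult_def
    proof (induction rule: generate.induct)
      case one
      then show ?case using s generate.one[of "add_monoid M" ?G] by simp
    next
      case (incl h)
      then obtain r x where h: "h = r \<odot>\<^bsub>M\<^esub> x" "r \<in> I" "x \<in> carrier M" by blast
      have rc: "r \<in> carrier R" using ideal.Icarr[OF assms h(2)] .
      have "s \<odot>\<^bsub>M\<^esub> h = (s \<otimes>\<^bsub>R\<^esub> r) \<odot>\<^bsub>M\<^esub> x" using h s rc by (simp add: smult_assoc1)
      moreover have "s \<otimes>\<^bsub>R\<^esub> r \<in> I" using ideal.I_l_closed[OF assms h(2) s] .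
      ultimately have "s \<odot>\<^bsub>M\<^esub> h \<in> ?G" using h(3) by blast
      then show ?case using generate.incl[of _ ?G "add_monoid M"] h rc by simp
    next
      case (inv h)
      then obtain r x where h: "h = r \<odot>\<^bsub>M\<^esub> x" "r \<in> I" "x \<in> carrier M" by blast
      have rc: "r \<in> carrier R" using ideal.Icarr[OF assms h(2)] .
      have "s \<odot>\<^bsub>M\<^esub> (\<ominus>\<^bsub>M\<^esub> h) = (\<ominus>\<^bsub>R\<^esub> (s \<otimes>\<^bsub>R\<^esub> r)) \<odot>\<^bsub>M\<^esub> x"
        using h s rc by (simp add: smult_r_minus smult_l_minus smult_assoc1)
      moreover have "\<ominus>\<^bsub>R\<^esub> (s \<otimes>\<^bsub>R\<^esub> r) \<in> I"
        using additive_subgroup.a_inv_closed[OF ideal.axioms(1)[OF assms] ideal.I_l_closed[OF assms h(2) s]] .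
      ultimately have "s \<odot>\<^bsub>M\<^esub> (\<ominus>\<^bsub>M\<^esub> h) \<in> ?G" using h(3) by blast
      then show ?case using generate.incl[of _ ?G "add_monoid M"] h rc by (simp flip: a_inv_def)
    next
      case (eng h1 h2)
      then show ?case using generate.eng[of _ "add_monoid M" ?G] s by (simp add: smult_r_distr)
    qed
    then show ?thesis by simp
  qed
  then show ?thesis using sub by (intro submodule.intro) (auto simp: submodule_axioms_def)
qed

lemma ideal_smult_incl: "r \<in> I \<Longrightarrow> x \<in> carrier M \<Longrightarrow> r \<odot>\<^bsub>M\<^esub> x \<in> ideal_smult I M"
  unfolding ideal_smult_def by (rule generate.incl) blast

lemma ideal_smult_minimal:
  assumes "submodule H R M" "\<And>r x. r \<in> I \<Longrightarrow> x \<in> carrier M \<Longrightarrow> r \<odot>\<^bsub>M\<^esub> x \<in> H"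
  shows "ideal_smult I M \<subseteq> H"
  unfolding ideal_smult_def
  by (rule M.add.generate_subgroup_incl[simplified]) (use assms submodule.axioms(1)[OF assms(1)] in auto)

end

context flat_change
begin

text \<open>Upwards, t \<otimes> (r x) is \<open>f r\<close> times t \<otimes> x. Downwards, the
  image of T \<otimes> IM in T \<otimes> M contains the product of the extended ideal with T
  \<otimes> M; so the inclusion of IM becomes surjective over T, and \<open>faithful_surj\<close>
  applies.\<close>

theorem ideal_smult_base_change_iff:
  fixes M :: "('r, 'm, 'y) module_scheme"
  assumes I: "ideal I R" and M: "module R M" and fg: "fin_gen_module R M"
  shows "carrier M = ideal_smult I M \<longleftrightarrow> carrier (bc M) = ideal_smult (genideal T (f ` I)) (bc M)"
proof -
  interpret M: module R M by fact
  interpret B: module T "bc M" by (rule module_bc[OF M])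
  let ?J = "genideal T (f ` I)"
  let ?H = "ideal_smult I M" and ?HT = "ideal_smult ?J (bc M)"
  have Ic: "I \<subseteq> carrier R" using ideal.Icarr[OF I] by auto
  have J: "ideal ?J T" by (rule base_change_genideal[OF Ic])
  have fJ: "f r \<in> ?J" if "r \<in> I" for r using image_subset_genideal[OF Ic] that by blast
  note H = M.ideal_smult_submodule[OF I] and HT = B.ideal_smult_submodule[OF J]
  note HTE = B.submoduleE[OF HT] and HE = M.submoduleE[OF H]
  show ?thesis
  proof
    assume eq: "carrier M = ?H"
    \<comment> \<open>The elements all of whose tensors lie in the target form a submodule, so it is
      enough to treat the products r x.\<close>
    let ?S = "{m \<in> carrier M. \<forall>t\<in>carrier T. tens M t m \<in> ?HT}"
    have zero: "\<zero>\<^bsub>bc M\<^esub> \<in> ?HT" using subgroup.one_closed[OF submodule.axioms(1)[OF HT]] by simp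
    have S: "submodule ?S R M"
    proof (rule M.submoduleI)
      have "tens M t \<zero>\<^bsub>M\<^esub> = \<zero>\<^bsub>bc M\<^esub>" if "t \<in> carrier T" for t
        using tens_balanced[OF M that R.zero_closed M.zero_closed] tens_zero_left[OF M M.zero_closed] that by simp
      then show "\<zero>\<^bsub>M\<^esub> \<in> ?S" using zero by simp
      have sm: "r \<odot>\<^bsub>M\<^esub> m \<in> ?S" if "r \<in> carrier R" "m \<in> ?S" for r m
        using that by (simp add: tens_balanced[OF M])
      then show "r \<odot>\<^bsub>M\<^esub> m \<in> ?S" if "r \<in> carrier R" "m \<in> ?S" for r m using that by blast
      show "\<ominus>\<^bsub>M\<^esub> m \<in> ?S" if "m \<in> ?S" for m
        using sm[of "\<ominus>\<^bsub>R\<^esub> \<one>\<^bsub>R\<^esub>" m] that by (simp add: M.smult_l_minus)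
      show "a \<oplus>\<^bsub>M\<^esub> b \<in> ?S" if "a \<in> ?S" "b \<in> ?S" for a b
        using that HTE(5) by (simp add: tens_add_right[OF M])
    qed auto
    have "?H \<subseteq> ?S"
    proof (rule M.ideal_smult_minimal[OF S])
      fix r x assume r: "r \<in> I" and x: "x \<in> carrier M"
      have rc: "r \<in> carrier R" using r Ic by auto
      have "tens M t (r \<odot>\<^bsub>M\<^esub> x) \<in> ?HT" if t: "t \<in> carrier T" for t
      proof -
        have "tens M t (r \<odot>\<^bsub>M\<^esub> x) = f r \<odot>\<^bsub>bc M\<^esub> tens M t x"
          using rc x t by (simp add: tens_balanced[OF M] smult_tens[OF M] T.m_comm)
        then show ?thesis using B.ideal_smult_incl[OF fJ[OF r], of "tens M t x"] t x by simp
      qed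
      then show "r \<odot>\<^bsub>M\<^esub> x \<in> ?S" using rc x by simp
    qed
    then have S': "tens M t m \<in> ?HT" if "t \<in> carrier T" "m \<in> carrier M" for t m
      using that eq by blast
    have "x \<in> ?HT" if "x \<in> carrier (bc M)" for x
      using M that by (induction rule: bc_induct) (use zero S' HTE(5) in auto)
    then show "carrier (bc M) = ?HT" using HTE(1) by blast
  next
    assume eq: "carrier (bc M) = ?HT"
    obtain \<kappa> :: "(nat \<Rightarrow> 'm) \<Rightarrow> (nat \<Rightarrow> 'r) set" where \<kappa>: "inj_on \<kappa> {x. \<forall>k. x k \<in> carrier M}"
      by (rule fin_gen_embedding[OF M fg])
    \<comment> \<open>The embedding is defined on sequences; an element of M is embedded as a
      constant sequence.\<close>
    have \<kappa>': "inj_on (\<lambda>m. \<kappa> (\<lambda>_. m)) (carrier M)"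
    proof (rule inj_onI)
      fix x y assume "x \<in> carrier M" "y \<in> carrier M" "\<kappa> (\<lambda>_. x) = \<kappa> (\<lambda>_. y)"
      then have "(\<lambda>_::nat. x) = (\<lambda>_. y)" by (intro inj_onD[OF \<kappa>]) simp_all
      then show "x = y" by (rule fun_cong)
    qed
    let ?N = "M\<lparr>carrier := ?H\<rparr>"
    have N: "module R ?N" by (rule submodule.submodule_is_module[OF H M])
    interpret bN: module T "bc ?N" by (rule module_bc[OF N])
    have i: "(\<lambda>x. x) \<in> mod_hom R ?N M" by (rule M.mod_hom_incl[OF HE(1)])
    note bi = base_change_map_hom[OF N M i]
    let ?img = "base_change_map R T f M (\<lambda>x. x) ` carrier (bc ?N)"
    have img: "submodule ?img T (bc M)" by (rule bN.submodule_image[OF B.module_axioms bi])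
    note imgE = B.submoduleE[OF img]
    have gen: "f r \<odot>\<^bsub>bc M\<^esub> x \<in> ?img" if r: "r \<in> I" and x: "x \<in> carrier (bc M)" for r x
      using M x
    proof (induction rule: bc_induct)
      case zero
      have "f r \<odot>\<^bsub>bc M\<^esub> \<zero>\<^bsub>bc M\<^esub> = \<zero>\<^bsub>bc M\<^esub>" using r Ic by auto
      then show ?case using subgroup.one_closed[OF submodule.axioms(1)[OF img]] by simp
    next
      case (tens t m)
      have rc: "r \<in> carrier R" using r Ic by auto
      have rm: "r \<odot>\<^bsub>M\<^esub> m \<in> ?H" by (rule M.ideal_smult_incl[OF r tens(2)])
      have "f r \<odot>\<^bsub>bc M\<^esub> tens M t m = tens M t (r \<odot>\<^bsub>M\<^esub> m)"
        using rc tens by (simp add: tens_balanced[OF M] smult_tens[OF M] T.m_comm)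
      also have "\<dots> = base_change_map R T f M (\<lambda>x. x) (tens ?N t (r \<odot>\<^bsub>M\<^esub> m))"
        by (rule base_change_map_tens[OF N M i, symmetric])
      finally show ?case by (rule image_eqI) (use tens(1) rm in simp)
    next
      case (add x y)
      have "f r \<odot>\<^bsub>bc M\<^esub> (x \<oplus>\<^bsub>bc M\<^esub> y) = f r \<odot>\<^bsub>bc M\<^esub> x \<oplus>\<^bsub>bc M\<^esub> f r \<odot>\<^bsub>bc M\<^esub> y"
        using r Ic add.hyps by (intro B.smult_r_distr) auto
      then show ?case using imgE(5)[OF add.IH] by simp
    qed
    have "?HT \<subseteq> ?img"
    proof (rule B.ideal_smult_minimal[OF img])
      fix s x assume s: "s \<in> ?J" and x: "x \<in> carrier (bc M)"
      \<comment> \<open>The scalars that move x into the image form an ideal; as it contains the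
        image of I, it contains the extended ideal.\<close>
      let ?K = "{s \<in> carrier T. s \<odot>\<^bsub>bc M\<^esub> x \<in> ?img}"
      have "ideal ?K T"
      proof (rule idealI[OF T.ring_axioms])
        show "subgroup ?K (add_monoid T)"
        proof (rule T.add.subgroupI)
          have "\<zero>\<^bsub>T\<^esub> \<odot>\<^bsub>bc M\<^esub> x \<in> ?img" using x subgroup.one_closed[OF submodule.axioms(1)[OF img]] by simp
          then show "?K \<noteq> {}" by blast
          show "\<ominus>\<^bsub>T\<^esub> a \<in> ?K" if "a \<in> ?K" for a
            using that x imgE(3)[of "a \<odot>\<^bsub>bc M\<^esub> x"] by (simp add: B.smult_l_minus)
          show "a \<oplus>\<^bsub>T\<^esub> b \<in> ?K" if "a \<in> ?K" "b \<in> ?K" for a b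
            using that x imgE(5)[of "a \<odot>\<^bsub>bc M\<^esub> x" "b \<odot>\<^bsub>bc M\<^esub> x"] by (simp add: B.smult_l_distr)
        qed auto
        fix a r assume a: "a \<in> ?K" and r: "r \<in> carrier T"
        then show "r \<otimes>\<^bsub>T\<^esub> a \<in> ?K" using x imgE(4)[of r "a \<odot>\<^bsub>bc M\<^esub> x"] by (simp add: B.smult_assoc1)
        then show "a \<otimes>\<^bsub>T\<^esub> r \<in> ?K" using a r by (simp add: T.m_comm)
      qed
      moreover have "f ` I \<subseteq> ?K"
      proof
        fix a assume "a \<in> f ` I"
        then obtain r where r: "r \<in> I" "a = f r" by blast
        then show "a \<in> ?K" using gen[OF r(1) x] Ic by (simp add: subset_iff)
      qed
      ultimately have "?J \<subseteq> ?K" by (rule T.genideal_minimal)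
      then show "s \<odot>\<^bsub>bc M\<^esub> x \<in> ?img" using s by blast
    qed
    then have "carrier (bc M) \<subseteq> ?img" using eq by simp
    from faithful_surj[OF \<kappa>' M H this] show "carrier M = ?H" by simp
  qed
qed

text \<open>\<open>N\<close> may be any module isomorphic to T \<otimes> M, so that for M = R the
  ring T can be taken. Resolutions and lifts are fixed over R, and those over T are their base
  changes; this fits because the powers of the extended ideal are the extensions of the
  powers.\<close>

theorem zero_local_cohomology_base_change_iff:
  fixes M :: "('r, 'm, 'y) module_scheme" and N :: "('t, 'n, 'z) module_scheme"
  assumes noeth: "noetherian_ring R" "noetherian_ring T" and I: "ideal I R"
    and M: "module R M" and fg: "fin_gen_module R M"
    and N: "module T N" and h: "h \<in> mod_hom T (bc M) N" "bij_betw h (carrier (bc M)) (carrier N)"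
  shows "zero_module (local_cohomology R I i M) \<longleftrightarrow>
    zero_module (local_cohomology T (genideal T (f ` I)) i N)"
proof -
  obtain \<kappa> :: "(nat \<Rightarrow> 'm) \<Rightarrow> (nat \<Rightarrow> 'r) set" where \<kappa>: "inj_on \<kappa> {x. \<forall>k. x k \<in> carrier M}"
    by (rule fin_gen_embedding[OF M fg])
  let ?I = "ideal_power R I" and ?u = "\<lambda>n k :: nat. cyclic_proj R (ideal_power R I n)"
  have Ip: "ideal (?I n) R" for n by (rule R.ideal_power_ideal[OF I])
  define J where "J n = genideal T (f ` ?I n)" for n
  have IT: "ideal (genideal T (f ` I)) T" using base_change_genideal ideal.Icarr[OF I] by blast
  have Jp: "ideal_power T (genideal T (f ` I)) n = J n" for n
    unfolding J_def by (rule ideal_power_base_change[OF I])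
  have "\<forall>n. \<exists>P. is_free_resolution R (cyclic_module R (?I n)) P \<and> res_rank P 0 = 1 \<and>
      res_aug P = (\<lambda>v. ?I n +>\<^bsub>R\<^esub> v 0)"
    using R.cyclic_resolution_exists[OF noeth(1) Ip] by blast
  from choice[OF this] obtain P where P: "\<And>n. is_free_resolution R (cyclic_module R (?I n)) (P n)"
    "\<And>n. res_rank (P n) 0 = 1" "\<And>n. res_aug (P n) = (\<lambda>v. ?I n +>\<^bsub>R\<^esub> v 0)" by blast
  note C = R.module_cyclic_module[OF Ip]
  note sub = R.ideal_power_mono[OF I]
  have "\<forall>n k. \<exists>\<phi>. n \<le> k \<longrightarrow> is_lift R (P k) (P n) (?u n k) \<phi>"
    using lift_exists[OF C C P(1) P(1) R.cyclic_proj_hom[OF Ip Ip sub]] by blast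
  then obtain \<phi> where \<phi>: "\<And>n k. n \<le> k \<Longrightarrow> is_lift R (P k) (P n) (?u n k) (\<phi> n k)"
    by metis
  have uu: "?u n k x = ?u n m (?u m k x)" if "n \<le> m" "m \<le> k" "x \<in> carrier (cyclic_module R (?I k))" for n m k x
  proof -
    have nk: "n \<le> k" using that by simp
    show ?thesis
      using that(3) R.cyclic_proj_coset[OF Ip Ip sub[OF that(1)]] R.cyclic_proj_coset[OF Ip Ip sub[OF that(2)]]
        R.cyclic_proj_coset[OF Ip Ip sub[OF nk]] by (auto simp: R.cyclic_module_simps(1))
  qed
  let ?PT = "\<lambda>n. base_change_res (J n) (P n)"
  let ?\<phi>T = "\<lambda>n k i. base_change_hom (res_rank (P k) i) (res_rank (P n) i) (\<phi> n k i)"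
  have PT: "is_free_resolution T (cyclic_module T (J n)) (?PT n)" for n
    by (rule base_change_resolution[OF Ip P J_def])
  have \<phi>T: "is_lift T (?PT k) (?PT n) (cyclic_proj T (J n)) (?\<phi>T n k)" if "n \<le> k" for n k
    by (rule base_change_lift[OF Ip Ip sub[OF that] P P \<phi>[OF that] J_def J_def])
  have "zero_module (local_cohomology R I i M) \<longleftrightarrow> lc_vanishes R P i M \<phi>"
    by (rule module.zero_local_cohomology_iff[OF M noeth(1) I P(1)]) (erule \<phi>)
  also have "\<dots> \<longleftrightarrow> lc_vanishes T ?PT i (bc M) ?\<phi>T"
    by (rule lc_vanishes_base_change_iff[where A = "\<lambda>n. cyclic_module R (?I n)" and u = ?u
          and u' = "\<lambda>n k. cyclic_proj T (J n)", OF M \<kappa> C P(1) uu _ PT])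
      (assumption | erule \<phi> | erule \<phi>T)+
  also have "\<dots> \<longleftrightarrow> lc_vanishes T ?PT i N ?\<phi>T"
    by (rule lc_vanishes_iso[where u = "\<lambda>n k. cyclic_proj T (J n)", OF module_bc[OF M] N PT _ h]) (erule \<phi>T)
  also have "\<dots> \<longleftrightarrow> zero_module (local_cohomology T (genideal T (f ` I)) i N)"
    by (rule module.zero_local_cohomology_iff[OF N noeth(2) IT, symmetric]) (simp_all add: Jp PT \<phi>T)
  finally show ?thesis .
qed

end

theorem proposition4p6:
  fixes R :: "('r, 'p) ring_scheme" and T :: "('t, 'q) ring_scheme"
    and f :: "'r \<Rightarrow> 't" and \<aa> :: "'r set" and M :: "('r, 'm, 'y) module_scheme"
  assumes "cring R" and "noetherian_ring R"
    and "cring T" and "noetherian_ring T"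
    and "f \<in> ring_hom R T" and "faithfully_flat R T f"
    and "ideal \<aa> R" and "\<aa> \<noteq> carrier R"
    and "module R M" and "fin_gen_module R M"
  shows "(rel_CM R \<aa> M \<longleftrightarrow> rel_CM T (genideal T (f ` \<aa>)) (base_change R T f M)) \<and>
         (rel_maximal_CM R \<aa> M \<longleftrightarrow> rel_maximal_CM T (genideal T (f ` \<aa>)) (base_change R T f M)) \<and>
         (rel_Gorenstein R \<aa> M \<longleftrightarrow> rel_Gorenstein T (genideal T (f ` \<aa>)) (base_change R T f M))"
proof -
  interpret F: flat_change R T f
    by (intro flat_change.intro ring_change.intro ring_change_axioms.intro flat_change_axioms.intro assms)
  let ?J = "genideal T (f ` \<aa>)" and ?MT = "base_change R T f M"
  have Ext: "zero_module (Ext_module R (cyclic_module R \<aa>) i M) \<longleftrightarrow>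
      zero_module (Ext_module T (cyclic_module T ?J) i ?MT)" for i
    by (rule F.zero_Ext_base_change_iff[OF assms(2,4,7,9,10)])
  \<comment> \<open>For M the module over T is the base change itself, so the required isomorphism
    is the identity.\<close>
  have id: "(\<lambda>x. x) \<in> mod_hom T ?MT ?MT" "bij_betw (\<lambda>x. x) (carrier ?MT) (carrier ?MT)"
    by (auto simp: mod_hom_def bij_betw_def)
  have "zero_module (local_cohomology R \<aa> i M) \<longleftrightarrow> zero_module (local_cohomology T ?J i ?MT)" for i
    by (rule F.zero_local_cohomology_base_change_iff[OF assms(2,4,7,9,10) F.module_bc[OF assms(9)] id])
  then have cd: "cd R \<aa> M = cd T ?J ?MT" by (simp add: cd_def)
  \<comment> \<open>The maximal and the Gorenstein notion refer to \<open>cd\<close> of the ring,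
    which over T is formed with T and not with T \<otimes> R.\<close>
  obtain h where h: "h \<in> mod_hom T (base_change R T f (ring_module R)) (ring_module T)"
    "bij_betw h (carrier (base_change R T f (ring_module R))) (carrier (ring_module T))"
    using F.bc_ring_module by (metis ring_module_simps(1))
  have "zero_module (local_cohomology R \<aa> i (ring_module R)) \<longleftrightarrow>
      zero_module (local_cohomology T ?J i (ring_module T))" for i
    by (rule F.zero_local_cohomology_base_change_iff[OF assms(2,4,7) F.R.module_ring_module
          F.R.fin_gen_ring_module F.T.module_ring_module h])
  then have cd_ring: "cd R \<aa> (ring_module R) = cd T ?J (ring_module T)" by (simp add: cd_def)
  have grade: "grade R \<aa> M = grade T ?J ?MT" by (simp add: grade_def Ext)
  have "carrier M = ideal_smult \<aa> M \<longleftrightarrow> carrier ?MT = ideal_smult ?J ?MT"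
    by (rule F.ideal_smult_base_change_iff[OF assms(7,9,10)])
  then show ?thesis
    by (simp add: rel_CM_def rel_maximal_CM_def rel_Gorenstein_def cd cd_ring grade Ext)
qed

end
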